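(* Let $\mathcal H$ be a real Hilbert space and $\beta\ge0$. Let $f:\mathcal H\to\mathbb R$ be a convex function which is twice continuously differentiable, and such that $\inf_{\mathcal H}f>-\infty$. Suppose that $\nabla f$ is Lipschitz continuous on the bounded subsets of $\mathcal H$. Let $\phi:\mathcal H\to\mathbb R_+$ be a damping potential. Then, for any Cauchy data $(x_0,x_1)\in\mathcal H\times\mathcal H$, there exists a unique strong global solution $x:[0,+\infty[\to\mathcal H$ of $$\ddot x(t)+\partial\phi\big(\dot x(t)+\beta\nabla f(x(t))\big)+\beta\nabla^2f(x(t))\dot x(t)+\nabla f(x(t))\ni0$$ satisfying $x(0)=x_0$ and $\dot x(0)=x_1$.
   Context: A function $\phi:\mathcal H\to\mathbb R_+$ is a damping potential if: (i) $\phi$ is nonnegative, convex and continuous; (ii) $\phi(0)=0=\min_{\mathcal H}\phi$; (iii) for every $R>0$, $\sup_{\|u\|\le R}\|(\partial\phi)^0(u)\|<+\infty$, where $\partial\phi$ is the convex subdifferential and $(\partial\phi)^0(u)$ is the element of minimal norm of $\partial\phi(u)$. A function $x:[0,+\infty[\to\mathcal H$ is a strong global solution of the inclusion if: (i) $x\in\mathcal C^1([0,+\infty[;\mathcal H)$; (ii) for all $T>0$, $\dot x$ is Lipschitz continuous on $(0,T)$ and $\ddot x\in L^\infty(0,T;\mathcal H)$; (iii) the inclusion holds for almost every $t>0$. *)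

theory Defs
  imports "HOL-Analysis.Analysis"
begin

definition grad :: "('a::real_inner \<Rightarrow> real) \<Rightarrow> 'a \<Rightarrow> 'a" where
  "grad f x = (THE D. GDERIV f x :> D)"

definition hess :: "('a::real_inner \<Rightarrow> real) \<Rightarrow> 'a \<Rightarrow> ('a \<Rightarrow>\<^sub>L 'a)" where
  "hess f x = Blinfun (frechet_derivative (grad f) (at x))"

text \<open>
  Derivatives are Frechet derivatives. The first derivative is identified with the gradient
  (Riesz), and the Hessian has to be continuous for the operator norm.
\<close>

definition twice_continuously_differentiable :: "('a::real_inner \<Rightarrow> real) \<Rightarrow> bool" where
  "twice_continuously_differentiable f \<longleftrightarrow>
     (\<forall>x. \<exists>D. GDERIV f x :> D) \<and>
     (\<forall>x. grad f differentiable (at x)) \<and>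
     continuous_on UNIV (hess f)"

definition subdifferential :: "('a::real_inner \<Rightarrow> real) \<Rightarrow> 'a \<Rightarrow> 'a set" where
  "subdifferential \<phi> u = {p. \<forall>v. \<phi> u + inner p (v - u) \<le> \<phi> v}"

definition minimal_subgradient :: "('a::real_inner \<Rightarrow> real) \<Rightarrow> 'a \<Rightarrow> 'a" where
  "minimal_subgradient \<phi> u = arg_min norm (\<lambda>p. p \<in> subdifferential \<phi> u)"

definition damping_potential :: "('a::real_inner \<Rightarrow> real) \<Rightarrow> bool" where
  "damping_potential \<phi> \<longleftrightarrow>
     (\<forall>u. 0 \<le> \<phi> u) \<and> convex_on UNIV \<phi> \<and> continuous_on UNIV \<phi> \<and>
     \<phi> 0 = 0 \<and> (\<forall>u. \<phi> 0 \<le> \<phi> u) \<and>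
     (\<forall>R>0. bdd_above ((\<lambda>u. norm (minimal_subgradient \<phi> u)) ` {u. norm u \<le> R}))"

text \<open>
  Measurability is strong (Bochner) measurability: the target space need not be separable, so
  Borel measurability would be too weak. Membership only depends on the function up to null sets.
\<close>

definition strongly_measurable :: "'b measure \<Rightarrow> ('b \<Rightarrow> 'a::real_normed_vector) \<Rightarrow> bool" where
  "strongly_measurable M g \<longleftrightarrow>
     (\<exists>s. (\<forall>n. simple_function M (s n)) \<and> (AE t in M. (\<lambda>n. s n t) \<longlonglongrightarrow> g t))"

definition Linfty :: "'b measure \<Rightarrow> ('b \<Rightarrow> 'a::real_normed_vector) set" where
  "Linfty M = {g. strongly_measurable M g \<and> (\<exists>C. AE t in M. norm (g t) \<le> C)}"

text \<open>
  A trajectory on the closed half-line is a function on all reals of which only the values at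
  nonnegative times matter; the derivative at time 0 is the right derivative.
\<close>

definition velocity :: "(real \<Rightarrow> 'a::real_normed_vector) \<Rightarrow> real \<Rightarrow> 'a" where
  "velocity x t = vector_derivative x (at t within {0..})"

definition acceleration :: "(real \<Rightarrow> 'a::real_normed_vector) \<Rightarrow> real \<Rightarrow> 'a" where
  "acceleration x t = vector_derivative (velocity x) (at t within {0..})"

text \<open>
  The second derivative is the almost everywhere derivative of the velocity. Its existence almost
  everywhere is part of the second condition, because the term \<open>acceleration x t\<close> is
  meaningless where the velocity is not differentiable.
\<close>

definition strong_global_solution ::
    "real \<Rightarrow> ('a::real_inner \<Rightarrow> real) \<Rightarrow> ('a \<Rightarrow> real) \<Rightarrow> (real \<Rightarrow> 'a) \<Rightarrow> bool" where
  "strong_global_solution \<beta> f \<phi> x \<longleftrightarrow>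
     (\<forall>t\<ge>0. x differentiable (at t within {0..})) \<and> continuous_on {0..} (velocity x) \<and>
     (\<forall>T>0. (\<exists>L. L-lipschitz_on {0<..<T} (velocity x)) \<and>
            (AE t in lebesgue_on {0<..<T}. velocity x differentiable (at t within {0..})) \<and>
            acceleration x \<in> Linfty (lebesgue_on {0<..<T})) \<and>
     (AE t in lebesgue_on {0<..}.
        0 \<in> {acceleration x t + p + \<beta> *\<^sub>R hess f (x t) (velocity x t) + grad f (x t) | p.
               p \<in> subdifferential \<phi> (velocity x t + \<beta> *\<^sub>R grad f (x t))})"

end

theory Submission
  imports Defs
begin

text \<open>
  Put \<open>y = x' + \<beta> *\<^sub>R grad f x\<close>. By the chain rule the derivative of \<open>grad f x\<close> is the Hessian term, so
  the second-order inclusion is equivalent to the first-order system \<open>x' = y - \<beta> *\<^sub>R grad f x\<close>,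
  \<open>y' + grad f x \<in> - \<partial>\<phi>(y)\<close>. In the product space this is the evolution generated by a monotone
  operator together with a perturbation that is Lipschitz continuous on bounded sets: this is
  \<open>monotone_coupling\<close>. Gronwall's inequality for the distance of two solutions gives uniqueness
  (\<open>solution_unique\<close>).

  The same inequality gives existence. Since minimal subgradients are bounded on bounded sets, they
  can serve as the selection in an explicit Euler scheme. The energy \<open>f x + (norm y)\<^sup>2 / 2\<close> increases by at
  most a second-order error in each step, which bounds the scheme on every finite time interval
  (\<open>euler_a_priori\<close>), and by monotonicity two polygons with small steps stay close together
  (\<open>euler_polygons_converge\<close>). In the limit, the first equation holds in the classical sense, and
  the second one holds as a variational inequality for \<open>(norm (y - v))\<^sup>2\<close>
  (\<open>limit_damped_evolution\<close>).

  It remains to differentiate \<open>y\<close>, with values in a Hilbert space that need be neither finite-dimensional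
  nor separable. Let \<open>m t\<close> be the element of minimal norm of \<open>grad f (x t) + \<partial>\<phi>(y t)\<close>. The
  variational inequality shows that the forward difference quotients of \<open>y\<close> at \<open>t\<close>, with opposite sign,
  are almost elements of this set and asymptotically have at most the norm of \<open>m t\<close>. By a
  parallelogram argument for nested convex sets (\<open>nested_convex_min_norm\<close>) they converge to \<open>m t\<close>,
  so \<open>y\<close> has the right derivative \<open>- m t\<close> at every time. Comparing \<open>y\<close> with its time shifts
  shows that \<open>exp (- t) * (norm (m t))\<^sup>2 - C\<^sup>2 * t\<close> decreases. Hence \<open>norm (m t)\<close> is continuous off a
  countable set; where it is continuous, so is \<open>m\<close> by the same parallelogram argument, and there
  \<open>y\<close> is differentiable (\<open>strong_solution_off_countable\<close>).
\<close>

section \<open>Differential inequalities with right derivatives\<close>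

lemma lipschitz_on_inner:
  fixes f g :: "'c::metric_space \<Rightarrow> 'b::real_inner"
  assumes f: "C-lipschitz_on S f" and g: "D-lipschitz_on S g"
    and A: "\<And>x. x \<in> S \<Longrightarrow> norm (f x) \<le> A" and B: "\<And>x. x \<in> S \<Longrightarrow> norm (g x) \<le> B"
    and "0 \<le> A" "0 \<le> B"
  shows "(C * B + A * D)-lipschitz_on S (\<lambda>x. f x \<bullet> g x)"
proof (rule lipschitz_onI)
  have C: "0 \<le> C" and D: "0 \<le> D" using f g lipschitz_on_nonneg by auto
  show "0 \<le> C * B + A * D" using C D assms by simp
  fix x y assume x: "x \<in> S" and y: "y \<in> S"
  have "f x \<bullet> g x - f y \<bullet> g y = (f x - f y) \<bullet> g x + f y \<bullet> (g x - g y)"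
    by (simp add: inner_diff)
  also have "\<bar>\<dots>\<bar> \<le> \<bar>(f x - f y) \<bullet> g x\<bar> + \<bar>f y \<bullet> (g x - g y)\<bar>" by linarith
  also have "\<dots> \<le> norm (f x - f y) * norm (g x) + norm (f y) * norm (g x - g y)"
    by (intro add_mono Cauchy_Schwarz_ineq2)
  also have "\<dots> \<le> (C * dist x y) * B + A * (D * dist x y)"
    using lipschitz_onD[OF f x y] lipschitz_onD[OF g x y] A[OF y] B[OF x] C D assms(5,6)
    by (intro add_mono mult_mono) (auto simp: dist_norm)
  finally show "dist (f x \<bullet> g x) (f y \<bullet> g y) \<le> (C * B + A * D) * dist x y"
    by (simp add: dist_real_def algebra_simps)
qed

lemma lipschitz_on_interval_bounded:
  fixes f :: "real \<Rightarrow> 'b::real_normed_vector"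
  assumes "L-lipschitz_on {a..b} f"
  obtains B where "0 \<le> B" "\<And>t. t \<in> {a..b} \<Longrightarrow> norm (f t) \<le> B"
proof -
  have "compact (f ` {a..b})"
    using assms by (intro compact_continuous_image lipschitz_on_continuous_on) auto
  then obtain B where "\<And>t. t \<in> {a..b} \<Longrightarrow> norm (f t) \<le> B"
    using compact_imp_bounded[of "f ` {a..b}"] unfolding bounded_iff by blast
  then show thesis by (intro that[of "max B 0"]) (auto simp: le_max_iff_disj)
qed

text \<open>
  The Lipschitz hypothesis makes the image of the exceptional set negligible, so almost every level
  is crossed at a point where the sign of the right derivative is known. Only right derivatives
  occur: Euler polygons have them everywhere, including the corners.
\<close>

lemma antimono_if_right_deriv_nonpos:
  fixes h :: "real \<Rightarrow> real"
  assumes ab: "a \<le> b" and lip: "L-lipschitz_on {a..b} h" and N: "negligible N"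
    and der: "\<And>t. \<lbrakk>a < t; t < b; t \<notin> N\<rbrakk> \<Longrightarrow> \<exists>D\<le>0. (h has_real_derivative D) (at_right t)"
  shows "h b \<le> h a"
proof (rule field_le_epsilon)
  fix e0 :: real assume "e0 > 0"
  define e where "e = e0 / (b - a + 1)"
  have e: "e > 0" using \<open>e0 > 0\<close> ab by (simp add: e_def)
  \<comment> \<open>Tilting makes the right derivatives strictly negative.\<close>
  define k where "k t = h t - e * (t - a)" for t
  have klip: "(L + e * 1)-lipschitz_on {a..b} k"
    unfolding k_def using e
    by (intro lipschitz_intros lip) (auto intro!: lipschitz_onI simp: dist_real_def)
  then have kcont: "continuous_on {a..b} k" by (rule lipschitz_on_continuous_on)
  have "k b \<le> k a"
  proof (rule ccontr)
    assume "\<not> k b \<le> k a"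
    then have lt: "k a < k b" by simp
    \<comment> \<open>A level \<open>c\<close> between \<open>k a\<close> and \<open>k b\<close> that is not taken on the exceptional set; at the last
      time \<open>\<tau>\<close> where \<open>k \<le> c\<close>, the function must not decrease to the right.\<close>
    have "negligible (k ` (N \<inter> {a..b}))"
    proof (rule negligible_locally_Lipschitz_image)
      show "negligible (N \<inter> {a..b})" using N by (simp add: negligible_Int)
      fix x assume "x \<in> N \<inter> {a..b}"
      then show "\<exists>T B. open T \<and> x \<in> T \<and>
          (\<forall>y \<in> (N \<inter> {a..b}) \<inter> T. norm (k y - k x) \<le> B * norm (y - x))"
        using lipschitz_on_normD[OF klip] by (intro exI[of _ UNIV] exI[of _ "L + e * 1"]) auto
    qed simp
    moreover have "\<not> negligible {k a<..<k b}"
      using lt open_not_negligible[of "{k a<..<k b}"] by auto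
    ultimately obtain c where c: "k a < c" "c < k b" "c \<notin> k ` (N \<inter> {a..b})"
      using negligible_subset by (metis greaterThanLessThan_iff subsetI)
    define S where "S = {t\<in>{a..b}. k t \<le> c}"
    have "closed S" unfolding S_def
      by (intro continuous_on_closed_Collect_le kcont continuous_intros)
    have "a \<in> S" using c ab by (simp add: S_def)
    have bdd: "bdd_above S" by (auto simp: S_def bdd_above_def)
    define \<tau> where "\<tau> = Sup S"
    have "\<tau> \<in> S" unfolding \<tau>_def
      using \<open>a \<in> S\<close> by (intro closed_contains_Sup bdd \<open>closed S\<close>) auto
    have above: "k t > c" if "t \<in> {a..b}" "t > \<tau>" for t
      using that cSup_upper[OF _ bdd, of t] by (force simp: S_def \<tau>_def)
    have "a \<le> \<tau>" "\<tau> \<le> b" "k \<tau> \<le> c" using \<open>\<tau> \<in> S\<close> by (auto simp: S_def)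
    have "k \<tau> = c"
    proof (rule ccontr)
      assume "k \<tau> \<noteq> c"
      then have "k \<tau> < c" using \<open>k \<tau> \<le> c\<close> by simp
      obtain t where "\<tau> \<le> t" "t \<le> b" "k t = c"
        using IVT'[of k \<tau> c b] c \<open>k \<tau> \<le> c\<close> \<open>\<tau> \<le> b\<close> \<open>a \<le> \<tau>\<close>
        by (meson atLeastatMost_subset_iff continuous_on_subset kcont less_imp_le order_refl)
      then show False using above[of t] \<open>k \<tau> \<noteq> c\<close> \<open>a \<le> \<tau>\<close> by force
    qed
    then have "a < \<tau>" "\<tau> < b" using c \<open>a \<le> \<tau>\<close> \<open>\<tau> \<le> b\<close> by (auto simp: less_le)
    moreover have "\<tau> \<notin> N" using c \<open>k \<tau> = c\<close> \<open>a \<le> \<tau>\<close> \<open>\<tau> \<le> b\<close> by auto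
    ultimately obtain D where D: "D \<le> 0" "(h has_real_derivative D) (at_right \<tau>)"
      using der by blast
    have "(k has_real_derivative (D - e)) (at_right \<tau>)"
      unfolding k_def by (auto intro!: derivative_eq_intros D(2))
    then obtain d where d: "d > 0" "\<And>s. s > 0 \<Longrightarrow> s < d \<Longrightarrow> k (\<tau> + s) < k \<tau>"
      using has_real_derivative_neg_dec_right[of k "D - e" \<tau> "{\<tau><..}"] D(1) e by auto
    define s where "s = min (d/2) (b - \<tau>)"
    have "k (\<tau> + s) < k \<tau>" "k (\<tau> + s) > c"
      using d \<open>\<tau> < b\<close> \<open>a < \<tau>\<close> by (auto simp: s_def intro!: d(2) above)
    then show False using \<open>k \<tau> = c\<close> by simp
  qed
  then have "h b \<le> h a + e * (b - a)" by (simp add: k_def)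
  also have "e * (b - a) \<le> e0" using ab \<open>e0 > 0\<close> by (simp add: e_def field_simps)
  finally show "h b \<le> h a + e0" by simp
qed

text \<open>
  The form of Gronwall's inequality behind both halves of the proof: with \<open>E = 0\<close> and a negligible
  set \<open>N\<close> it gives uniqueness, with \<open>N\<close> empty and \<open>E\<close> of the order of the step it compares Euler
  polygons.
\<close>

lemma norm_gronwall:
  fixes z :: "real \<Rightarrow> 'b::real_inner"
  assumes ab: "a \<le> b" and lip: "L-lipschitz_on {a..b} z" and N: "negligible N"
    and K: "0 \<le> K" and E: "0 \<le> E"
    and der: "\<And>t. \<lbrakk>a < t; t < b; t \<notin> N\<rbrakk> \<Longrightarrow>
      \<exists>d. (z has_vector_derivative d) (at_right t) \<and> d \<bullet> z t \<le> K * (norm (z t))\<^sup>2 + E"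
  shows "(norm (z b))\<^sup>2 \<le> exp (2 * K * (b - a)) * ((norm (z a))\<^sup>2 + 2 * E * (b - a))"
proof -
  obtain B where B: "0 \<le> B" "\<And>t. t \<in> {a..b} \<Longrightarrow> norm (z t) \<le> B"
    using lipschitz_on_interval_bounded[OF lip] by blast
  have zz: "(L * B + B * L)-lipschitz_on {a..b} (\<lambda>t. z t \<bullet> z t)"
    by (intro lipschitz_on_inner lip B)
  define w where "w t = exp (- (2 * K * (t - a)))" for t
  have wlip: "(2 * K)-lipschitz_on {a..b} w"
  proof (rule bounded_derivative_imp_lipschitz)
    fix t assume t: "t \<in> {a..b}"
    show "(w has_derivative (\<lambda>s. s * (w t * - (2 * K)))) (at t within {a..b})"
      unfolding w_def by (auto intro!: derivative_eq_intros simp: algebra_simps)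
    have "w t \<le> 1" "0 \<le> w t" using t K by (auto simp: w_def)
    then have "w t * (2 * K) \<le> 2 * K" using K by (simp add: mult_left_le_one_le)
    then show "onorm (\<lambda>s. s * (w t * - (2 * K))) \<le> 2 * K"
      using \<open>0 \<le> w t\<close> K
      by (intro onorm_le) (auto simp: abs_mult mult.commute mult_left_mono)
  qed (use K in auto)
  obtain Bw where Bw: "0 \<le> Bw" "\<And>t. t \<in> {a..b} \<Longrightarrow> norm (w t) \<le> Bw"
    using lipschitz_on_interval_bounded[OF wlip] by blast
  obtain Bz where Bz: "0 \<le> Bz" "\<And>t. t \<in> {a..b} \<Longrightarrow> norm (z t \<bullet> z t) \<le> Bz"
    using lipschitz_on_interval_bounded[OF zz] by blast
  \<comment> \<open>The integrating factor \<open>w\<close> turns the differential inequality into a nonpositive right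
    derivative of \<open>h\<close>.\<close>
  define h where "h t = w t \<bullet> (z t \<bullet> z t) - (2 * E) * (t - a)" for t
  have "(2 * K * Bz + Bw * (L * B + B * L) + (2 * E) * 1)-lipschitz_on {a..b} h"
    unfolding h_def using E
    by (intro lipschitz_intros lipschitz_on_inner wlip zz Bw Bz)
       (auto intro!: lipschitz_onI simp: dist_real_def)
  then have "h b \<le> h a"
  proof (rule antimono_if_right_deriv_nonpos[OF ab _ N])
    fix t assume t: "a < t" "t < b" "t \<notin> N"
    then obtain d where d: "(z has_vector_derivative d) (at_right t)"
      "d \<bullet> z t \<le> K * (norm (z t))\<^sup>2 + E"
      using der by blast
    have zd: "((\<lambda>t. z t \<bullet> z t) has_real_derivative 2 * (d \<bullet> z t)) (at_right t)"
      using has_derivative_inner[OF d(1)[unfolded has_vector_derivative_def]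
          d(1)[unfolded has_vector_derivative_def]]
      unfolding has_field_derivative_def
      by (simp add: inner_commute algebra_simps mult_commute_abs)
    let ?D = "w t * (2 * (d \<bullet> z t)) + w t * (- (2 * K)) * (z t \<bullet> z t) - 2 * E"
    have "(h has_real_derivative ?D) (at_right t)"
      unfolding h_def w_def inner_real_def
      by (auto intro!: derivative_eq_intros zd simp: algebra_simps)
    moreover have "?D \<le> 0"
    proof -
      have "?D = w t * (2 * (d \<bullet> z t - K * (norm (z t))\<^sup>2)) - 2 * E"
        by (simp add: power2_norm_eq_inner algebra_simps)
      also have "\<dots> \<le> w t * (2 * E) - 2 * E"
        using d(2) by (auto simp: w_def)
      also have "\<dots> \<le> 0"
        using t K E by (auto simp: w_def mult_left_le_one_le)
      finally show ?thesis .
    qed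
    ultimately show "\<exists>D\<le>0. (h has_real_derivative D) (at_right t)" by blast
  qed
  then have "w b * (norm (z b))\<^sup>2 \<le> (norm (z a))\<^sup>2 + 2 * E * (b - a)"
    by (simp add: h_def w_def power2_norm_eq_inner)
  then have "exp (2 * K * (b - a)) * (w b * (norm (z b))\<^sup>2) \<le>
      exp (2 * K * (b - a)) * ((norm (z a))\<^sup>2 + 2 * E * (b - a))"
    by simp
  moreover have "exp (2 * K * (b - a)) * w b = 1" by (simp add: w_def exp_minus)
  ultimately show ?thesis by (simp only: mult.assoc[symmetric] mult_1_left)
qed

text \<open>
  The mean value inequality, obtained by testing \<open>Y\<close> against the direction of its own defect.
\<close>

lemma norm_increment_le_of_right_deriv:
  fixes Y :: "real \<Rightarrow> 'b::real_inner"
  assumes ab: "a \<le> b" and lip: "L-lipschitz_on {a..b} Y"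
    and der: "\<And>t. \<lbrakk>a < t; t < b\<rbrakk> \<Longrightarrow>
      \<exists>d. (Y has_vector_derivative d) (at_right t) \<and> norm (d - c) \<le> \<eta>"
  shows "norm (Y b - Y a - (b - a) *\<^sub>R c) \<le> \<eta> * (b - a)"
proof -
  define e where "e = Y b - Y a - (b - a) *\<^sub>R c"
  define h where "h t = (Y t - t *\<^sub>R c) \<bullet> e - \<eta> * norm e * t" for t
  have "((L + norm c) * norm e + \<bar>\<eta> * norm e\<bar> * 1)-lipschitz_on {a..b} h"
  proof (rule lipschitz_onI)
    have L: "0 \<le> L" using lip lipschitz_on_nonneg by auto
    then show "0 \<le> (L + norm c) * norm e + \<bar>\<eta> * norm e\<bar> * 1" by simp
    fix x y assume xy: "x \<in> {a..b}" "y \<in> {a..b}"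
    have "h x - h y = (Y x - Y y - (x - y) *\<^sub>R c) \<bullet> e - (\<eta> * norm e) * (x - y)"
      by (simp add: h_def algebra_simps inner_diff)
    also have "\<bar>\<dots>\<bar> \<le> \<bar>(Y x - Y y - (x - y) *\<^sub>R c) \<bullet> e\<bar> + \<bar>(\<eta> * norm e) * (x - y)\<bar>"
      by linarith
    also have "\<dots> \<le> norm (Y x - Y y - (x - y) *\<^sub>R c) * norm e + \<bar>\<eta> * norm e\<bar> * \<bar>x - y\<bar>"
      by (intro add_mono Cauchy_Schwarz_ineq2) (simp add: abs_mult)
    also have "norm (Y x - Y y - (x - y) *\<^sub>R c) \<le> L * \<bar>x - y\<bar> + \<bar>x - y\<bar> * norm c"
      using lipschitz_on_normD[OF lip xy] norm_triangle_ineq4[of "Y x - Y y" "(x - y) *\<^sub>R c"]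
      by simp
    finally show "dist (h x) (h y) \<le> ((L + norm c) * norm e + \<bar>\<eta> * norm e\<bar> * 1) * dist x y"
      by (simp add: dist_real_def algebra_simps mult_right_mono)
  qed
  then have "h b \<le> h a"
  proof (rule antimono_if_right_deriv_nonpos[OF ab _ negligible_empty])
    fix t assume t: "a < t" "t < b"
    then obtain d where d: "(Y has_vector_derivative d) (at_right t)" "norm (d - c) \<le> \<eta>"
      using der by blast
    have "((\<lambda>t. Y t - t *\<^sub>R c) has_vector_derivative d - c) (at_right t)"
      by (auto intro!: derivative_eq_intros d)
    from has_derivative_inner_left[OF this[unfolded has_vector_derivative_def], of e]
    have 1: "((\<lambda>t. (Y t - t *\<^sub>R c) \<bullet> e) has_real_derivative (d - c) \<bullet> e) (at_right t)"
      unfolding has_field_derivative_def by (simp add: mult_commute_abs)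
    have "(h has_real_derivative (d - c) \<bullet> e - \<eta> * norm e) (at_right t)"
      unfolding h_def by (auto intro!: derivative_eq_intros 1)
    moreover have "(d - c) \<bullet> e \<le> \<eta> * norm e"
      using norm_cauchy_schwarz[of "d - c" e] mult_right_mono[OF d(2) norm_ge_zero[of e]]
      by linarith
    ultimately show "\<exists>D\<le>0. (h has_real_derivative D) (at_right t)"
      by (intro exI[of _ "(d - c) \<bullet> e - \<eta> * norm e"]) auto
  qed
  then have "e \<bullet> e \<le> \<eta> * norm e * (b - a)"
    by (simp add: h_def e_def algebra_simps inner_diff)
  then have "norm e * norm e \<le> norm e * (\<eta> * (b - a))"
    by (simp add: power2_norm_eq_inner[symmetric] power2_eq_square algebra_simps)
  moreover have "0 \<le> \<eta> * (b - a)" if "e = 0"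
  proof (cases "a = b")
    case False
    then obtain d where "norm (d - c) \<le> \<eta>" using der[of "(a + b)/2"] ab by auto
    then have "0 \<le> \<eta>" using norm_ge_zero order_trans by blast
    then show ?thesis using ab by simp
  qed simp
  ultimately have "norm e \<le> \<eta> * (b - a)"
    by (cases "e = 0") (simp_all)
  then show ?thesis by (simp add: e_def)
qed

text \<open>
  Strict differentiability at \<open>t\<close>. The increments on both sides of \<open>t\<close> are treated alike, so that
  bounds obtained from right derivatives yield a two-sided derivative.
\<close>

lemma has_vector_derivative_if_increments:
  fixes Y :: "real \<Rightarrow> 'b::real_normed_vector"
  assumes t: "t \<in> S"
    and incr: "\<And>\<eta>. \<eta> > 0 \<Longrightarrow> \<exists>\<delta>>0. \<forall>a\<in>S. \<forall>b\<in>S. a \<le> b \<longrightarrow> \<bar>a - t\<bar> < \<delta> \<longrightarrow> \<bar>b - t\<bar> < \<delta> \<longrightarrow>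
      norm (Y b - Y a - (b - a) *\<^sub>R d) \<le> \<eta> * (b - a)"
  shows "(Y has_vector_derivative d) (at t within S)"
  unfolding has_vector_derivative_def has_derivative_within_alt
proof (intro conjI allI impI)
  show "bounded_linear (\<lambda>x. x *\<^sub>R d)" by (rule bounded_linear_scaleR_left)
  fix \<eta> :: real assume "\<eta> > 0"
  then obtain \<delta> where \<delta>: "\<delta> > 0" "\<And>a b. \<lbrakk>a \<in> S; b \<in> S; a \<le> b; \<bar>a - t\<bar> < \<delta>; \<bar>b - t\<bar> < \<delta>\<rbrakk> \<Longrightarrow>
      norm (Y b - Y a - (b - a) *\<^sub>R d) \<le> \<eta> * (b - a)"
    using incr by meson
  have "norm (Y y - Y t - (y - t) *\<^sub>R d) \<le> \<eta> * norm (y - t)" if "y \<in> S" "norm (y - t) < \<delta>" for y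
  proof (cases "t \<le> y")
    case True then show ?thesis using \<delta>(2)[of t y] that t \<delta>(1) by simp
  next
    case False
    then have "norm (Y t - Y y - (t - y) *\<^sub>R d) \<le> \<eta> * (t - y)"
      using \<delta>(2)[of y t] that t \<delta>(1) by simp
    moreover have "Y y - Y t - (y - t) *\<^sub>R d = - (Y t - Y y - (t - y) *\<^sub>R d)"
      by (simp add: algebra_simps)
    ultimately show ?thesis using False by (simp only: norm_minus_cancel) simp
  qed
  then show "\<exists>\<delta>>0. \<forall>y\<in>S. norm (y - t) < \<delta> \<longrightarrow>
      norm (Y y - Y t - (y - t) *\<^sub>R d) \<le> \<eta> * norm (y - t)"
    using \<delta>(1) by blast
qed

section \<open>Convergence of explicit Euler polygons\<close>

definition euler :: "('b::real_vector \<Rightarrow> 'b) \<Rightarrow> real \<Rightarrow> 'b \<Rightarrow> nat \<Rightarrow> 'b" where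
  "euler F h z0 k = ((\<lambda>z. z + h *\<^sub>R F z) ^^ k) z0"

lemma euler_0 [simp]: "euler F h z0 0 = z0"
  and euler_Suc [simp]: "euler F h z0 (Suc k) = euler F h z0 k + h *\<^sub>R F (euler F h z0 k)"
  by (simp_all add: euler_def)

definition euler_sample :: "('b::real_vector \<Rightarrow> 'b) \<Rightarrow> real \<Rightarrow> 'b \<Rightarrow> real \<Rightarrow> 'b" where
  "euler_sample F h z0 t = euler F h z0 (nat \<lfloor>t / h\<rfloor>)"

definition euler_polygon :: "('b::real_vector \<Rightarrow> 'b) \<Rightarrow> real \<Rightarrow> 'b \<Rightarrow> real \<Rightarrow> 'b" where
  "euler_polygon F h z0 t = euler_sample F h z0 t +
     (t - real (nat \<lfloor>t / h\<rfloor>) * h) *\<^sub>R F (euler_sample F h z0 t)"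

lemma euler_cell:
  assumes "0 < h" "0 \<le> t"
  shows "real (nat \<lfloor>t / h\<rfloor>) * h \<le> t" "t < (real (nat \<lfloor>t / h\<rfloor>) + 1) * h"
proof -
  have "0 \<le> \<lfloor>t / h\<rfloor>" using assms by simp
  then have eq: "real (nat \<lfloor>t / h\<rfloor>) = of_int \<lfloor>t / h\<rfloor>" by simp
  show "real (nat \<lfloor>t / h\<rfloor>) * h \<le> t"
    unfolding eq by (rule floor_divide_lower[OF assms(1)])
  show "t < (real (nat \<lfloor>t / h\<rfloor>) + 1) * h"
    unfolding eq by (rule floor_divide_upper[OF assms(1)])
qed

lemma euler_polygon_on_cell:
  assumes h: "0 < h" and t: "t \<in> {real k * h..(real k + 1) * h}"
  shows "euler_polygon F h z0 t = euler F h z0 k + (t - real k * h) *\<^sub>R F (euler F h z0 k)"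
proof (cases "t = (real k + 1) * h")
  case True
  then have "t / h = of_nat (Suc k)" using h by simp
  then have "nat \<lfloor>t / h\<rfloor> = Suc k" by (metis floor_of_nat nat_int)
  then show ?thesis using True
    by (simp add: euler_polygon_def euler_sample_def algebra_simps)
next
  case False
  then have "real k \<le> t / h" "t / h < real k + 1" using t h
    by (auto simp: pos_le_divide_eq pos_divide_less_eq)
  then have "\<lfloor>t / h\<rfloor> = int k" by (intro floor_unique) auto
  then show ?thesis by (simp add: euler_polygon_def euler_sample_def)
qed

lemma euler_polygon_0 [simp]: "0 < h \<Longrightarrow> euler_polygon F h z0 0 = z0"
  by (simp add: euler_polygon_def euler_sample_def)

lemma euler_polygon_lipschitz:
  fixes F :: "'b::real_normed_vector \<Rightarrow> 'b"
  assumes h: "0 < h" and M: "0 \<le> M" "\<And>k. real k * h \<le> T \<Longrightarrow> norm (F (euler F h z0 k)) \<le> M"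
  shows "M-lipschitz_on {0..T} (euler_polygon F h z0)"
proof (rule lipschitz_on_closed_Union[where I = "{k. real k * h \<le> T}"
      and U = "\<lambda>k. {real k * h..(real k + 1) * h}"])
  show "finite {k. real k * h \<le> T}"
  proof (rule finite_subset)
    show "{k. real k * h \<le> T} \<subseteq> {..nat \<lfloor>T / h\<rfloor>}"
      using h by (auto simp: pos_le_divide_eq le_nat_floor)
  qed simp
  show "{0..T} \<subseteq> (\<Union>k\<in>{k. real k * h \<le> T}. {real k * h..(real k + 1) * h})"
  proof
    fix t assume "t \<in> {0..T}"
    then show "t \<in> (\<Union>k\<in>{k. real k * h \<le> T}. {real k * h..(real k + 1) * h})"
      using euler_cell[OF h, of t] by (intro UN_I[of "nat \<lfloor>t / h\<rfloor>"]) auto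
  qed
  fix k assume k: "k \<in> {k. real k * h \<le> T}"
  show "M-lipschitz_on {real k * h..(real k + 1) * h} (euler_polygon F h z0)"
  proof (rule lipschitz_onI)
    fix s t assume s: "s \<in> {real k * h..(real k + 1) * h}" and t: "t \<in> {real k * h..(real k + 1) * h}"
    have "euler_polygon F h z0 s - euler_polygon F h z0 t = (s - t) *\<^sub>R F (euler F h z0 k)"
      by (simp add: euler_polygon_on_cell[OF h s] euler_polygon_on_cell[OF h t] algebra_simps)
    then show "dist (euler_polygon F h z0 s) (euler_polygon F h z0 t) \<le> M * dist s t"
      using mult_right_mono[OF M(2)[of k], of "\<bar>s - t\<bar>"] k by (simp add: dist_norm mult.commute)
  qed (use M in auto)
qed (use M in auto)

lemma euler_polygon_right_deriv:
  fixes F :: "'b::real_normed_vector \<Rightarrow> 'b"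
  assumes h: "0 < h" and t: "0 \<le> t"
  shows "(euler_polygon F h z0 has_vector_derivative F (euler_sample F h z0 t)) (at_right t)"
proof -
  define k where "k = nat \<lfloor>t / h\<rfloor>"
  define g where "g s = euler F h z0 k + (s - real k * h) *\<^sub>R F (euler F h z0 k)" for s
  have k: "real k * h \<le> t" "t < (real k + 1) * h" using euler_cell[OF h t] by (auto simp: k_def)
  have "(g has_vector_derivative F (euler F h z0 k)) (at t within {t..})"
    unfolding g_def by (auto intro!: derivative_eq_intros)
  then have "(euler_polygon F h z0 has_vector_derivative F (euler F h z0 k)) (at t within {t..})"
  proof (rule has_vector_derivative_transform_within)
    show "0 < (real k + 1) * h - t" using k by simp
    fix s assume "s \<in> {t..}" "dist s t < (real k + 1) * h - t"
    then have "s \<in> {real k * h..(real k + 1) * h}" using k by (auto simp: dist_real_def)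
    then show "g s = euler_polygon F h z0 s"
      using euler_polygon_on_cell[OF h, of s k F z0] by (simp add: g_def)
  qed simp
  then have "(euler_polygon F h z0 has_vector_derivative F (euler F h z0 k)) (at_right t)"
    by (rule has_vector_derivative_within_subset) auto
  then show ?thesis by (simp add: k_def euler_sample_def)
qed

lemma euler_polygon_near_sample:
  fixes F :: "'b::real_normed_vector \<Rightarrow> 'b"
  assumes h: "0 < h" and t: "0 \<le> t"
  shows "norm (euler_polygon F h z0 t - euler_sample F h z0 t) \<le> h * norm (F (euler_sample F h z0 t))"
proof -
  have "\<bar>t - real (nat \<lfloor>t / h\<rfloor>) * h\<bar> \<le> h" using euler_cell[OF h t] by (simp add: algebra_simps)
  then show ?thesis unfolding euler_polygon_def by (simp add: mult_right_mono)
qed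

text \<open>
  What remains of an Euler polygon \<open>P\<close> once its step is forgotten: a curve within \<open>\<epsilon>\<close> of \<open>z\<close> that
  moves with the velocity of \<open>F\<close> at nearby points \<open>S t\<close>. The bounds \<open>R\<close> and \<open>M\<close> are kept separate from
  \<open>\<epsilon>\<close> because they have to be uniform as \<open>\<epsilon>\<close> tends to 0.
\<close>

definition approximant ::
    "('b::real_normed_vector \<Rightarrow> 'b) \<Rightarrow> real \<Rightarrow> real \<Rightarrow> real \<Rightarrow> real \<Rightarrow> (real \<Rightarrow> 'b) \<Rightarrow>
     (real \<Rightarrow> 'b) \<Rightarrow> (real \<Rightarrow> 'b) \<Rightarrow> bool" where
  "approximant F R M T \<epsilon> z P S \<longleftrightarrow> M-lipschitz_on {0..T} P \<and>
     (\<forall>t\<in>{0..T}. (P has_vector_derivative F (S t)) (at_right t) \<and>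
        norm (S t) \<le> R \<and> norm (F (S t)) \<le> M \<and> norm (P t - z t) \<le> \<epsilon> \<and> norm (S t - z t) \<le> \<epsilon>)"

text \<open>
  The vector field may be discontinuous. The one-sided Lipschitz bound replaces continuity: the
  squared distance of two polygons with steps at most \<open>s\<close> satisfies a linear differential inequality
  whose error term is of order \<open>s\<close>, so the polygons form a Cauchy sequence. As the field may be
  discontinuous, the limit need not solve the differential equation; it is described by its
  approximants.
\<close>

theorem euler_polygons_converge:
  fixes F :: "'b::{real_inner,banach} \<Rightarrow> 'b"
  assumes bounded: "\<And>R. \<exists>M. \<forall>z. norm z \<le> R \<longrightarrow> norm (F z) \<le> M"
    and one_sided: "\<And>R. \<exists>K. \<forall>z w. norm z \<le> R \<longrightarrow> norm w \<le> R \<longrightarrow>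
      (F z - F w) \<bullet> (z - w) \<le> K * (norm (z - w))\<^sup>2"
    and a_priori: "\<And>T. \<exists>R h0. 0 < h0 \<and>
      (\<forall>h k. 0 < h \<longrightarrow> h \<le> h0 \<longrightarrow> real k * h \<le> T \<longrightarrow> norm (euler F h z0 k) \<le> R)"
  shows "\<exists>z. z 0 = z0 \<and> (\<forall>T\<ge>0. \<exists>R M. M-lipschitz_on {0..T} z \<and> (\<forall>t\<in>{0..T}. norm (z t) \<le> R) \<and>
    (\<forall>\<epsilon>>0. \<exists>P S. approximant F R M T \<epsilon> z P S))"
proof -
  define P where "P n = euler_polygon F (1 / real (Suc n)) z0" for n
  define S where "S n = euler_sample F (1 / real (Suc n)) z0" for n
  define z where "z t = lim (\<lambda>n. P n t)" for t
  have main: "uniform_limit {0..T} P z sequentially \<and>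
     (\<exists>R M N. 0 \<le> M \<and> (\<forall>n\<ge>N. M-lipschitz_on {0..T} (P n) \<and> (\<forall>t\<in>{0..T}. norm (S n t) \<le> R \<and>
        norm (F (S n t)) \<le> M \<and> norm (P n t - S n t) \<le> M / real (Suc n))))"
    if T: "0 \<le> T" for T
  proof -
    obtain R h0 where h0: "0 < h0"
      and R: "\<And>h k. \<lbrakk>0 < h; h \<le> h0; real k * h \<le> T\<rbrakk> \<Longrightarrow> norm (euler F h z0 k) \<le> R"
      using a_priori[of T] by blast
    obtain M0 where "\<And>z. norm z \<le> R \<Longrightarrow> norm (F z) \<le> M0" using bounded[of R] by blast
    then obtain M where M: "\<And>z. norm z \<le> R \<Longrightarrow> norm (F z) \<le> M" "0 \<le> M"
      by (metis max.cobounded1 max.cobounded2 order_trans)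
    obtain K0 where K0: "\<And>z w. norm z \<le> R \<Longrightarrow> norm w \<le> R \<Longrightarrow>
      (F z - F w) \<bullet> (z - w) \<le> K0 * (norm (z - w))\<^sup>2" using one_sided[of R] by blast
    define K where "K = max K0 0"
    have K: "0 \<le> K" "\<And>z w. norm z \<le> R \<Longrightarrow> norm w \<le> R \<Longrightarrow>
      (F z - F w) \<bullet> (z - w) \<le> K * (norm (z - w))\<^sup>2"
      unfolding K_def using K0 by (auto intro!: order_trans[OF K0 mult_right_mono])
    obtain N where N: "1 / real (Suc N) < h0" using h0 by (meson nat_approx_posE)
    have small: "1 / real (Suc n) \<le> h0" if "n \<ge> N" for n
      using N that by (smt (verit) frac_le of_nat_0_less_iff of_nat_mono Suc_le_mono zero_less_Suc)
    have Sb: "norm (S n t) \<le> R" if "n \<ge> N" "t \<in> {0..T}" for n t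
      unfolding S_def euler_sample_def
      using that euler_cell(1)[of "1 / real (Suc n)" t] by (intro R small) auto
    have Fb: "norm (F (S n t)) \<le> M" if "n \<ge> N" "t \<in> {0..T}" for n t
      using M(1) Sb that by blast
    have lip: "M-lipschitz_on {0..T} (P n)" if "n \<ge> N" for n
      unfolding P_def using that small by (intro euler_polygon_lipschitz M R) auto
    have near: "norm (P n t - S n t) \<le> M / real (Suc n)" if "n \<ge> N" "t \<in> {0..T}" for n t
    proof -
      have "norm (P n t - S n t) \<le> 1 / real (Suc n) * norm (F (S n t))"
        unfolding P_def S_def using that by (intro euler_polygon_near_sample) auto
      also have "\<dots> \<le> 1 / real (Suc n) * M" using Fb[OF that] by (intro mult_left_mono) auto
      finally show ?thesis by simp
    qed
    have der: "(P n has_vector_derivative F (S n t)) (at_right t)" if "t \<in> {0..T}" for n t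
      unfolding P_def S_def using that by (intro euler_polygon_right_deriv) auto
    define E where "E s = 2 * K * (2 * s * M)\<^sup>2 + 2 * M * (2 * s * M)" for s
    have compare: "(norm (P m t - P n t))\<^sup>2 \<le> exp (4 * K * T) * (2 * E s * T)"
      if mn: "m \<ge> N" "n \<ge> N" and s: "1 / real (Suc m) \<le> s" "1 / real (Suc n) \<le> s"
        and t: "t \<in> {0..T}" for m n s t
    proof -
      have "0 \<le> s" using s(1) by (smt (verit) divide_nonneg_nonneg of_nat_0_le_iff)
      have E: "0 \<le> E s" using K M \<open>0 \<le> s\<close> by (simp add: E_def)
      have "(norm (P m t - P n t))\<^sup>2 \<le>
        exp (2 * (2 * K) * (t - 0)) * ((norm (P m 0 - P n 0))\<^sup>2 + 2 * E s * (t - 0))"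
      proof (rule norm_gronwall[where N = "{}" and z = "\<lambda>t. P m t - P n t" and L = "M + M"])
        have "(M + M)-lipschitz_on {0..T} (\<lambda>t. P m t - P n t)"
          using mn by (intro lipschitz_intros lip)
        then show "(M + M)-lipschitz_on {0..t} (\<lambda>t. P m t - P n t)"
          by (rule lipschitz_on_subset) (use t in auto)
        fix r assume r: "0 < r" "r < t"
        then have rT: "r \<in> {0..T}" using t by auto
        define d where "d = F (S m r) - F (S n r)"
        define e where "e = (P m r - S m r) - (P n r - S n r)"
        have "norm e \<le> M / real (Suc m) + M / real (Suc n)"
          unfolding e_def by (intro norm_triangle_le_diff add_mono near mn rT)
        also have "\<dots> = M * (1 / real (Suc m) + 1 / real (Suc n))" by (simp add: algebra_simps)
        also have "\<dots> \<le> M * (s + s)" using s M by (intro mult_left_mono add_mono) auto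
        finally have e: "norm e \<le> 2 * s * M" by (simp add: algebra_simps)
        \<comment> \<open>The one-sided bound compares the nodes \<open>S\<close>, the Gronwall inequality needs the polygons \<open>P\<close>;
          \<open>e\<close> is the discrepancy, of the order of the step.\<close>
        have Sd: "S m r - S n r = (P m r - P n r) - e" by (simp add: e_def)
        have "norm (S m r - S n r) \<le> norm (P m r - P n r) + norm e"
          unfolding Sd by (rule norm_triangle_ineq4)
        then have "(norm (S m r - S n r))\<^sup>2 \<le> (norm (P m r - P n r) + norm e)\<^sup>2"
          by (intro power_mono) auto
        also have "\<dots> \<le> 2 * (norm (P m r - P n r))\<^sup>2 + 2 * (norm e)\<^sup>2"
          using sum_squares_bound[of "norm (P m r - P n r)" "norm e"]
          by (simp add: power2_sum)
        also have "(norm e)\<^sup>2 \<le> (2 * s * M)\<^sup>2" using e by (intro power_mono) auto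
        finally have S2: "(norm (S m r - S n r))\<^sup>2 \<le> 2 * (norm (P m r - P n r))\<^sup>2 + 2 * (2 * s * M)\<^sup>2"
          by simp
        have "d \<bullet> (P m r - P n r) = d \<bullet> (S m r - S n r) + d \<bullet> e"
          by (simp add: Sd inner_diff_right)
        also have "\<dots> \<le> K * (norm (S m r - S n r))\<^sup>2 + norm d * norm e"
          unfolding d_def by (intro add_mono K(2) Sb mn rT norm_cauchy_schwarz)
        also have "\<dots> \<le> K * (2 * (norm (P m r - P n r))\<^sup>2 + 2 * (2 * s * M)\<^sup>2) + (M + M) * (2 * s * M)"
          using e K M S2 norm_triangle_le_diff[OF add_mono[OF Fb[OF mn(1) rT] Fb[OF mn(2) rT]]]
          by (intro add_mono mult_mono mult_left_mono) (auto simp: d_def)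
        also have "\<dots> = 2 * K * (norm (P m r - P n r))\<^sup>2 + E s"
          by (simp add: E_def algebra_simps)
        finally show "\<exists>d. ((\<lambda>t. P m t - P n t) has_vector_derivative d) (at_right r) \<and>
            d \<bullet> (P m r - P n r) \<le> 2 * K * (norm (P m r - P n r))\<^sup>2 + E s"
          using der[OF rT, of m] der[OF rT, of n]
          by (intro exI[of _ d]) (auto simp: d_def intro!: derivative_eq_intros)
      qed (use t K E in auto)
      also have "\<dots> = exp (4 * K * t) * (2 * E s * t)" by (simp add: P_def)
      also have "\<dots> \<le> exp (4 * K * T) * (2 * E s * T)"
        using t K E by (intro mult_mono) (auto intro!: mult_left_mono)
      finally show ?thesis .
    qed
    have "uniformly_Cauchy_on {0..T} P"
      unfolding uniformly_Cauchy_on_def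
    proof (intro allI impI)
      fix e :: real assume e: "e > 0"
      have "((\<lambda>s. exp (4 * K * T) * (2 * E s * T)) \<longlongrightarrow> exp (4 * K * T) * (2 * E 0 * T)) (at_right 0)"
        unfolding E_def by (intro tendsto_intros)
      then have "((\<lambda>s. exp (4 * K * T) * (2 * E s * T)) \<longlongrightarrow> 0) (at_right 0)" by (simp add: E_def)
      then have "\<forall>\<^sub>F s in at_right 0. exp (4 * K * T) * (2 * E s * T) < e\<^sup>2"
        by (rule order_tendstoD) (use e in simp)
      then obtain b where b: "b > 0" "\<And>s. \<lbrakk>0 < s; s < b\<rbrakk> \<Longrightarrow> exp (4 * K * T) * (2 * E s * T) < e\<^sup>2"
        unfolding eventually_at_right_field by blast
      obtain N' where N': "1 / real (Suc N') < b" using b(1) by (meson nat_approx_posE)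
      show "\<exists>M. \<forall>t\<in>{0..T}. \<forall>m\<ge>M. \<forall>n\<ge>M. dist (P m t) (P n t) < e"
      proof (intro exI[of _ "max N N'"] ballI allI impI)
        fix t m n assume t: "t \<in> {0..T}" and m: "m \<ge> max N N'" and n: "n \<ge> max N N'"
        have "(norm (P m t - P n t))\<^sup>2 \<le> exp (4 * K * T) * (2 * E (1 / real (Suc N')) * T)"
          using m n t by (intro compare) (auto simp: frac_le)
        also have "\<dots> < e\<^sup>2" using N' by (intro b) auto
        finally show "dist (P m t) (P n t) < e"
          using e by (auto simp: dist_norm intro: power2_less_imp_less)
      qed
    qed
    then have "uniformly_convergent_on {0..T} P" by (rule Cauchy_uniformly_convergent)
    then have "uniform_limit {0..T} P z sequentially"
      unfolding z_def uniformly_convergent_uniform_limit_iff .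
    then show ?thesis using M Sb Fb lip near by blast
  qed
  have "z 0 = z0"
    using tendsto_uniform_limitI[OF conjunct1[OF main[of 0]], of 0]
    by (auto simp: P_def intro: LIMSEQ_unique tendsto_const)
  moreover have "\<exists>R M. M-lipschitz_on {0..T} z \<and> (\<forall>t\<in>{0..T}. norm (z t) \<le> R) \<and>
    (\<forall>\<epsilon>>0. \<exists>P S. approximant F R M T \<epsilon> z P S)" if T: "0 \<le> T" for T
  proof -
    have lim: "uniform_limit {0..T} P z sequentially" using main[OF T] by blast
    obtain R M N where M: "0 \<le> M" and N: "\<And>n. n \<ge> N \<Longrightarrow> M-lipschitz_on {0..T} (P n)"
      "\<And>n t. \<lbrakk>n \<ge> N; t \<in> {0..T}\<rbrakk> \<Longrightarrow> norm (S n t) \<le> R"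
      "\<And>n t. \<lbrakk>n \<ge> N; t \<in> {0..T}\<rbrakk> \<Longrightarrow> norm (F (S n t)) \<le> M"
      "\<And>n t. \<lbrakk>n \<ge> N; t \<in> {0..T}\<rbrakk> \<Longrightarrow> norm (P n t - S n t) \<le> M / real (Suc n)"
      using main[OF T] by blast
    have appr: "\<exists>P S. approximant F R M T \<epsilon> z P S" if \<epsilon>: "\<epsilon> > 0" for \<epsilon>
    proof -
      have "\<forall>\<^sub>F n in sequentially. \<forall>t\<in>{0..T}. dist (P n t) (z t) < \<epsilon> / 2"
        using lim \<epsilon> unfolding uniform_limit_iff by (meson half_gt_zero)
      moreover have "(\<lambda>n. M / real (Suc n)) \<longlonglongrightarrow> 0" using LIMSEQ_Suc[OF lim_const_over_n[of M]] by simp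
      then have "\<forall>\<^sub>F n in sequentially. M / real (Suc n) < \<epsilon> / 2"
        by (rule order_tendstoD) (use \<epsilon> in simp)
      ultimately have "\<forall>\<^sub>F n in sequentially. n \<ge> N \<and> (\<forall>t\<in>{0..T}. dist (P n t) (z t) < \<epsilon> / 2) \<and>
          M / real (Suc n) < \<epsilon> / 2"
        using eventually_ge_at_top[of N] by eventually_elim auto
      then obtain n where n: "n \<ge> N" "\<And>t. t \<in> {0..T} \<Longrightarrow> norm (P n t - z t) < \<epsilon> / 2"
          "M / real (Suc n) < \<epsilon> / 2"
        unfolding eventually_sequentially dist_norm by blast
      have "norm (S n t - z t) \<le> \<epsilon>" if "t \<in> {0..T}" for t
      proof -
        have "norm (S n t - z t) \<le> norm (P n t - z t) + norm (P n t - S n t)"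
          using norm_triangle_ineq4[of "P n t - z t" "P n t - S n t"] by (simp add: algebra_simps)
        then show ?thesis using n(2)[OF that] n(3) N(4)[OF n(1) that] by linarith
      qed
      moreover have "(P n has_vector_derivative F (S n t)) (at_right t)" if "t \<in> {0..T}" for t
        unfolding P_def S_def using that by (intro euler_polygon_right_deriv) auto
      moreover have "norm (P n t - z t) \<le> \<epsilon>" if "t \<in> {0..T}" for t
        using n(2)[OF that] \<epsilon> by linarith
      ultimately have "approximant F R M T \<epsilon> z (P n) (S n)"
        unfolding approximant_def using N(1-3)[OF n(1)] by blast
      then show ?thesis by blast
    qed
    have "norm (z t) \<le> R" if t: "t \<in> {0..T}" for t
    proof (rule field_le_epsilon)
      fix \<epsilon> :: real assume "\<epsilon> > 0"
      then obtain P S where "approximant F R M T \<epsilon> z P S" using appr by blast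
      then have "norm (S t - z t) \<le> \<epsilon>" "norm (S t) \<le> R" using t by (auto simp: approximant_def)
      then show "norm (z t) \<le> R + \<epsilon>"
        using norm_triangle_ineq4[of "S t" "S t - z t"] by simp
    qed
    moreover have "M-lipschitz_on {0..T} z"
    proof (rule lipschitz_onI[OF _ M])
      fix s t assume st: "s \<in> {0..T}" "t \<in> {0..T}"
      have "(\<lambda>n. dist (P n s) (P n t)) \<longlonglongrightarrow> dist (z s) (z t)"
        by (intro tendsto_dist tendsto_uniform_limitI[OF lim] st)
      then show "dist (z s) (z t) \<le> M * dist s t"
        by (rule tendsto_upperbound)
           (use lipschitz_onD[OF N(1) st] in \<open>auto intro!: eventually_sequentiallyI[of N]\<close>)
    qed
    ultimately show ?thesis using appr by blast
  qed
  ultimately show ?thesis by blast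
qed

section \<open>Elements of minimal norm\<close>

text \<open>
  A substitute for weak compactness. In a decreasing family of closed convex sets, points of nearly
  minimal norm are close to each other by the parallelogram law, hence converge strongly. The last
  conclusion is the quantitative form of this: every point of \<open>C e\<close> that is not much longer than
  \<open>m\<close> lies near \<open>m\<close>.
\<close>

lemma nested_convex_min_norm:
  fixes C :: "real \<Rightarrow> 'a::{real_inner,banach} set"
  assumes cvx: "\<And>e. 0 < e \<Longrightarrow> convex (C e)" and closed: "\<And>e. 0 < e \<Longrightarrow> closed (C e)"
    and mono: "\<And>d e. \<lbrakk>0 < d; d \<le> e\<rbrakk> \<Longrightarrow> C d \<subseteq> C e"
    and bound: "\<And>e. 0 < e \<Longrightarrow> \<exists>q\<in>C e. norm q \<le> K"
  obtains m where "\<And>e. 0 < e \<Longrightarrow> m \<in> C e"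
    and "\<And>q. (\<And>e. 0 < e \<Longrightarrow> q \<in> C e) \<Longrightarrow> norm m \<le> norm q"
    and "\<And>\<eta>. 0 < \<eta> \<Longrightarrow> \<exists>e>0. \<forall>q\<in>C e. norm q \<le> norm m + e \<longrightarrow> norm (q - m) \<le> \<eta>"
proof -
  define \<delta> where "\<delta> e = Inf (norm ` C e)" for e
  define \<Delta> where "\<Delta> = Sup (\<delta> ` {0<..})"
  have bdd: "bdd_below (norm ` C e)" for e by (auto intro: bdd_belowI[of _ 0])
  have ne: "C e \<noteq> {}" if "0 < e" for e using bound[OF that] by blast
  have \<delta>_le: "\<delta> e \<le> norm q" if "q \<in> C e" for e q
    unfolding \<delta>_def using that by (intro cInf_lower bdd) auto
  have \<delta>_nonneg: "0 \<le> \<delta> e" if "0 < e" for e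
    unfolding \<delta>_def using ne[OF that] by (intro cInf_greatest) auto
  have \<delta>_K: "\<delta> e \<le> K" if "0 < e" for e
    using bound[OF that] \<delta>_le order_trans by blast
  have \<delta>_anti: "\<delta> e \<le> \<delta> d" if "0 < d" "d \<le> e" for d e
    unfolding \<delta>_def[of d] using mono[OF that] ne[OF that(1)] \<delta>_le by (intro cInf_greatest) auto
  have bddS: "bdd_above (\<delta> ` {0<..})" using \<delta>_K by (auto intro: bdd_aboveI[of _ K])
  have \<delta>_\<Delta>: "\<delta> e \<le> \<Delta>" if "0 < e" for e
    unfolding \<Delta>_def using that by (intro cSup_upper bddS) auto
  have \<Delta>: "0 \<le> \<Delta>" using \<delta>_\<Delta>[of 1] \<delta>_nonneg[of 1] by simp
  have close: "\<exists>e>0. \<forall>p\<in>C e. \<forall>q\<in>C e. norm p \<le> \<Delta> + e \<longrightarrow> norm q \<le> \<Delta> + e \<longrightarrow> norm (p - q) \<le> \<eta>"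
    if \<eta>: "0 < \<eta>" for \<eta>
  proof -
    define \<kappa> where "\<kappa> = min 1 (\<eta>\<^sup>2 / (8 * (2 * \<Delta> + 1)))"
    have \<kappa>: "0 < \<kappa>" "\<kappa> \<le> 1" "8 * \<kappa> * (2 * \<Delta> + 1) \<le> \<eta>\<^sup>2"
    proof -
      have "0 < 8 * (2 * \<Delta> + 1)" using \<Delta> by simp
      moreover have "\<kappa> \<le> \<eta>\<^sup>2 / (8 * (2 * \<Delta> + 1))" by (simp add: \<kappa>_def)
      ultimately have "\<kappa> * (8 * (2 * \<Delta> + 1)) \<le> \<eta>\<^sup>2" by (simp only: pos_le_divide_eq)
      then show "8 * \<kappa> * (2 * \<Delta> + 1) \<le> \<eta>\<^sup>2" by (simp add: algebra_simps)
    qed (use \<eta> \<Delta> in \<open>auto simp: \<kappa>_def\<close>)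
    have "\<Delta> - \<kappa> < \<Delta>" using \<kappa> by simp
    then obtain e1 where e1: "0 < e1" "\<Delta> - \<kappa> < \<delta> e1"
      unfolding \<Delta>_def by (subst (asm) less_cSup_iff[OF _ bddS]) auto
    define e where "e = min e1 \<kappa>"
    have e: "0 < e" "e \<le> \<kappa>" "\<Delta> - \<kappa> < \<delta> e"
      using e1 \<kappa> \<delta>_anti[of e e1] by (auto simp: e_def)
    have "norm (p - q) \<le> \<eta>"
      if p: "p \<in> C e" "norm p \<le> \<Delta> + e" and q: "q \<in> C e" "norm q \<le> \<Delta> + e" for p q
    proof -
      have "(1/2) *\<^sub>R p + (1/2) *\<^sub>R q \<in> C e"
        using cvx[OF e(1)] p q by (intro convexD) auto
      then have "\<delta> e \<le> norm ((1/2) *\<^sub>R p + (1/2) *\<^sub>R q)" by (rule \<delta>_le)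
      also have "\<dots> = norm (p + q) / 2" by (simp flip: scaleR_add_right)
      finally have mid: "(2 * \<delta> e)\<^sup>2 \<le> (norm (p + q))\<^sup>2"
        using \<delta>_nonneg[OF e(1)] by (intro power_mono) auto
      have sq: "(norm p)\<^sup>2 \<le> (\<Delta> + e)\<^sup>2" "(norm q)\<^sup>2 \<le> (\<Delta> + e)\<^sup>2"
        using p q by (auto intro: power_mono)
      \<comment> \<open>Parallelogram law: two points of nearly minimal norm whose midpoint cannot be shorter.\<close>
      have "(norm (p - q))\<^sup>2 = 2 * (norm p)\<^sup>2 + 2 * (norm q)\<^sup>2 - (norm (p + q))\<^sup>2"
        by (simp add: power2_norm_eq_inner inner_diff inner_add inner_commute)
      also have "\<dots> \<le> 4 * ((\<Delta> + e)\<^sup>2 - (\<delta> e)\<^sup>2)" using mid sq by (simp add: power_mult_distrib)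
      also have "(\<Delta> + e)\<^sup>2 - (\<delta> e)\<^sup>2 = (\<Delta> + e - \<delta> e) * (\<Delta> + e + \<delta> e)"
        by (simp add: power2_eq_square algebra_simps)
      also have "4 * \<dots> \<le> 4 * ((2 * \<kappa>) * (2 * \<Delta> + 1))"
        using e \<kappa> \<delta>_\<Delta>[OF e(1)] \<delta>_nonneg[OF e(1)] \<Delta> by (intro mult_left_mono mult_mono) auto
      also have "\<dots> \<le> \<eta>\<^sup>2" using \<kappa>(3) by simp
      finally show "norm (p - q) \<le> \<eta>" by (rule power2_le_imp_le) (use \<eta> in simp)
    qed
    then show ?thesis using e(1) by blast
  qed
  have "\<exists>q. q \<in> C (1 / real (Suc n)) \<and> norm q \<le> \<Delta> + 1 / real (Suc n)" for n
  proof -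
    have "\<delta> (1 / real (Suc n)) < \<Delta> + 1 / real (Suc n)"
      using \<delta>_\<Delta>[of "1 / real (Suc n)"] by (smt (verit) divide_pos_pos of_nat_0_less_iff zero_less_Suc)
    then show ?thesis
      unfolding \<delta>_def using ne[of "1 / real (Suc n)"]
      by (subst (asm) cInf_less_iff[OF _ bdd]) (auto intro: less_imp_le)
  qed
  then obtain q where q: "\<And>n. q n \<in> C (1 / real (Suc n))" "\<And>n. norm (q n) \<le> \<Delta> + 1 / real (Suc n)"
    by metis
  have ev: "\<exists>N. \<forall>n\<ge>N. q n \<in> C e \<and> norm (q n) \<le> \<Delta> + e" if e: "0 < e" for e
  proof -
    obtain N where N: "1 / real (Suc N) < e" using e by (meson nat_approx_posE)
    have "1 / real (Suc n) \<le> e" if "n \<ge> N" for n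
      using N that by (smt (verit) frac_le of_nat_0_less_iff of_nat_mono Suc_le_mono zero_less_Suc)
    then show ?thesis using q mono[of "1 / real (Suc n)" e for n]
      by (intro exI[of _ N]) (smt (verit) divide_pos_pos of_nat_0_less_iff zero_less_Suc subsetD)
  qed
  have "Cauchy q"
    unfolding Cauchy_iff
  proof (intro allI impI)
    fix \<eta> :: real assume "0 < \<eta>"
    then obtain e where e: "e > 0" "\<And>p q. \<lbrakk>p \<in> C e; q \<in> C e; norm p \<le> \<Delta> + e; norm q \<le> \<Delta> + e\<rbrakk> \<Longrightarrow>
        norm (p - q) \<le> \<eta> / 2"
      using close[of "\<eta> / 2"] by auto
    obtain N where "\<And>n. n \<ge> N \<Longrightarrow> q n \<in> C e \<and> norm (q n) \<le> \<Delta> + e" using ev[OF e(1)] by blast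
    then show "\<exists>N. \<forall>m\<ge>N. \<forall>n\<ge>N. norm (q m - q n) < \<eta>"
      using e(2) \<open>0 < \<eta>\<close> by (intro exI[of _ N]) (smt (verit) field_sum_of_halves)
  qed
  then obtain m where m: "q \<longlonglongrightarrow> m" using Cauchy_convergent_iff convergent_def by blast
  have mC: "m \<in> C e" if e: "0 < e" for e
  proof -
    obtain N where "\<And>n. n \<ge> N \<Longrightarrow> q n \<in> C e" using ev[OF e] by blast
    then have "\<forall>\<^sub>F n in sequentially. q n \<in> C e" by (rule eventually_sequentiallyI)
    then show ?thesis by (rule Lim_in_closed_set[OF closed[OF e] _ _ m]) simp
  qed
  have "norm m \<le> \<Delta>"
  proof (rule LIMSEQ_le[OF tendsto_norm[OF m]])
    show "(\<lambda>n. \<Delta> + 1 / real (Suc n)) \<longlonglongrightarrow> \<Delta>"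
      using tendsto_add[OF tendsto_const LIMSEQ_Suc[OF lim_1_over_n]] by force
  qed (use q in auto)
  have \<Delta>_le: "\<Delta> \<le> norm p" if "\<And>e. 0 < e \<Longrightarrow> p \<in> C e" for p
    unfolding \<Delta>_def using \<delta>_le that by (intro cSup_least) auto
  have norm_m: "norm m = \<Delta>" using \<Delta>_le[OF mC] \<open>norm m \<le> \<Delta>\<close> by simp
  show thesis
  proof (rule that)
    show "m \<in> C e" if "0 < e" for e using mC that .
    show "norm m \<le> norm p" if "\<And>e. 0 < e \<Longrightarrow> p \<in> C e" for p
      using \<Delta>_le[OF that] norm_m by simp
    show "\<exists>e>0. \<forall>q\<in>C e. norm q \<le> norm m + e \<longrightarrow> norm (q - m) \<le> \<eta>" if \<eta>: "0 < \<eta>" for \<eta>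
    proof -
      obtain e where "e > 0" "\<And>p q. \<lbrakk>p \<in> C e; q \<in> C e; norm p \<le> \<Delta> + e; norm q \<le> \<Delta> + e\<rbrakk> \<Longrightarrow>
        norm (p - q) \<le> \<eta>"
        using close[OF \<eta>] by auto
      then show ?thesis using mC[of e] norm_m by auto
    qed
  qed
qed

text \<open>
  The inequality for the inner product is the variational characterization of the projection of the
  origin.
\<close>

lemma closed_convex_min_norm:
  fixes C :: "'a::{real_inner,banach} set"
  assumes "convex C" "closed C" "C \<noteq> {}"
  shows "\<exists>m\<in>C. \<forall>q\<in>C. norm m \<le> norm q \<and> 0 \<le> m \<bullet> (q - m)"
proof -
  obtain q where "q \<in> C" using assms by blast
  have "\<exists>m\<in>C. \<forall>q\<in>C. norm m \<le> norm q"
  proof (rule nested_convex_min_norm[of "\<lambda>_. C" "norm q"])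
    fix m assume "\<And>e :: real. 0 < e \<Longrightarrow> m \<in> C" "\<And>q. (\<And>e :: real. 0 < e \<Longrightarrow> q \<in> C) \<Longrightarrow> norm m \<le> norm q"
    then show "\<exists>m\<in>C. \<forall>q\<in>C. norm m \<le> norm q" using zero_less_one by blast
  qed (use assms \<open>q \<in> C\<close> in auto)
  then obtain m where m: "m \<in> C" "\<And>q. q \<in> C \<Longrightarrow> norm m \<le> norm q" by blast
  have "0 \<le> m \<bullet> (q - m)" if q: "q \<in> C" for q
  proof (rule ccontr)
    assume "\<not> 0 \<le> m \<bullet> (q - m)"
    then have "0 < (0 - m) \<bullet> (q - m)" by simp
    then obtain u where u: "0 < u" "u \<le> 1" "dist (m + u *\<^sub>R (q - m)) 0 < dist m 0"
      using closer_point_lemma[of 0 m q] by blast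
    have "m + u *\<^sub>R (q - m) = (1 - u) *\<^sub>R m + u *\<^sub>R q" by (simp add: algebra_simps)
    also have "\<dots> \<in> C" using u m q assms(1) by (intro convexD) auto
    finally show False using m(2) u(3) by fastforce
  qed
  then show ?thesis using m by blast
qed

section \<open>Subdifferentials of continuous convex functions\<close>

text \<open>
  An enlargement of the subdifferential with an error that grows with the distance to \<open>u\<close>. The
  error has to absorb perturbations of the slope \<open>p\<close>, which the classical constant error
  does not.
\<close>

definition approx_subdifferential :: "('a::real_inner \<Rightarrow> real) \<Rightarrow> real \<Rightarrow> 'a \<Rightarrow> 'a set" where
  "approx_subdifferential \<phi> e u = {p. \<forall>v. \<phi> u + p \<bullet> (v - u) \<le> \<phi> v + e * (1 + norm (v - u))}"

lemma approx_subdifferentialI: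
  "(\<And>v. \<phi> u + p \<bullet> (v - u) \<le> \<phi> v + e * (1 + norm (v - u))) \<Longrightarrow> p \<in> approx_subdifferential \<phi> e u"
  by (simp add: approx_subdifferential_def)

lemma convex_approx_subdifferential: "convex (approx_subdifferential \<phi> e u)"
proof (rule convexI)
  fix p q and a b :: real
  assume p: "p \<in> approx_subdifferential \<phi> e u" and q: "q \<in> approx_subdifferential \<phi> e u"
    and ab: "0 \<le> a" "0 \<le> b" "a + b = 1"
  show "a *\<^sub>R p + b *\<^sub>R q \<in> approx_subdifferential \<phi> e u"
  proof (rule approx_subdifferentialI)
    fix v
    let ?r = "\<phi> v + e * (1 + norm (v - u)) - \<phi> u"
    have "a * (p \<bullet> (v - u)) + b * (q \<bullet> (v - u)) \<le> a * ?r + b * ?r"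
      using p q ab unfolding approx_subdifferential_def
      by (intro add_mono mult_left_mono) (auto simp: algebra_simps)
    also have "\<dots> = ?r" using ab by (simp flip: distrib_right)
    finally show "\<phi> u + (a *\<^sub>R p + b *\<^sub>R q) \<bullet> (v - u) \<le> \<phi> v + e * (1 + norm (v - u))"
      by (simp add: inner_add_left)
  qed
qed

lemma closed_approx_subdifferential: "closed (approx_subdifferential \<phi> e u)"
  unfolding approx_subdifferential_def
  by (intro closed_Collect_all closed_Collect_le continuous_intros)

lemma approx_subdifferential_mono:
  "d \<le> e \<Longrightarrow> approx_subdifferential \<phi> d u \<subseteq> approx_subdifferential \<phi> e u"
  unfolding approx_subdifferential_def
  by (auto intro: order_trans[OF _ add_left_mono[OF mult_right_mono]])

lemma subdifferential_iff_approx: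
  "p \<in> subdifferential \<phi> u \<longleftrightarrow> (\<forall>e>0. p \<in> approx_subdifferential \<phi> e u)"
proof
  assume "p \<in> subdifferential \<phi> u"
  then show "\<forall>e>0. p \<in> approx_subdifferential \<phi> e u"
    unfolding subdifferential_def approx_subdifferential_def
    by (auto intro: add_increasing2)
next
  assume p: "\<forall>e>0. p \<in> approx_subdifferential \<phi> e u"
  have "\<phi> u + p \<bullet> (v - u) \<le> \<phi> v" for v
  proof (rule field_le_epsilon)
    fix e0 :: real assume "e0 > 0"
    define n where "n = 1 + norm (v - u)"
    have n: "0 < n" by (simp add: n_def add_pos_nonneg)
    then have "0 < e0 / n" using \<open>e0 > 0\<close> by simp
    then have "p \<in> approx_subdifferential \<phi> (e0 / n) u" using p by blast
    then have "\<phi> u + p \<bullet> (v - u) \<le> \<phi> v + e0 / n * n"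
      unfolding n_def approx_subdifferential_def by blast
    then show "\<phi> u + p \<bullet> (v - u) \<le> \<phi> v + e0" using n by simp
  qed
  then show "p \<in> subdifferential \<phi> u" by (simp add: subdifferential_def)
qed

lemma closed_subdifferential: "closed (subdifferential \<phi> u)"
  unfolding subdifferential_def
  by (intro closed_Collect_all closed_Collect_le continuous_intros)

lemma convex_subdifferential: "convex (subdifferential \<phi> u)"
proof -
  have "subdifferential \<phi> u = (\<Inter>e\<in>{0<..}. approx_subdifferential \<phi> e u)"
    using subdifferential_iff_approx by fastforce
  then show ?thesis using convex_approx_subdifferential by (auto intro!: convex_INT)
qed

lemma subdifferential_monotone:
  assumes "p \<in> subdifferential \<phi> u" "q \<in> subdifferential \<phi> v"
  shows "0 \<le> (p - q) \<bullet> (u - v)"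
proof -
  have "\<phi> u + p \<bullet> (v - u) \<le> \<phi> v" "\<phi> v + q \<bullet> (u - v) \<le> \<phi> u"
    using assms by (auto simp: subdifferential_def)
  then show ?thesis by (simp add: inner_diff)
qed

text \<open>
  Project a point just below the graph onto the epigraph. The normal at the projection is not
  horizontal, because a convex function defined on the whole space has no vertical supporting
  hyperplane, and thus it is the slope of a subgradient at the foot of the projection.
\<close>

lemma subgradient_near:
  fixes \<phi> :: "'a::{real_inner,banach} \<Rightarrow> real"
  assumes cvx: "convex_on UNIV \<phi>" and cont: "continuous_on UNIV \<phi>" and \<epsilon>: "0 < \<epsilon>"
  obtains v p where "norm (v - u) \<le> \<epsilon>" "p \<in> subdifferential \<phi> v"
proof -
  \<comment> \<open>The epigraph, translated so that the point just below \<open>(u, \<phi> u)\<close> becomes the origin.\<close>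
  define C where "C = {w :: 'a \<times> real. \<phi> (u + fst w) \<le> \<phi> u - \<epsilon> + snd w}"
  have closed: "closed C"
    unfolding C_def
    by (intro closed_Collect_le continuous_on_compose2[OF cont] continuous_intros) auto
  have convex: "convex C"
  proof (rule convexI)
    fix x y :: "'a \<times> real" and a b :: real
    assume x: "x \<in> C" and y: "y \<in> C" and ab: "0 \<le> a" "0 \<le> b" "a + b = 1"
    have eq: "u + fst (a *\<^sub>R x + b *\<^sub>R y) = a *\<^sub>R (u + fst x) + b *\<^sub>R (u + fst y)"
      using ab by (simp add: algebra_simps flip: scaleR_add_left)
    have "\<phi> (u + fst (a *\<^sub>R x + b *\<^sub>R y)) \<le> a * \<phi> (u + fst x) + b * \<phi> (u + fst y)"
      unfolding eq using cvx ab by (auto simp: convex_on_def)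
    also have "\<dots> \<le> a * (\<phi> u - \<epsilon> + snd x) + b * (\<phi> u - \<epsilon> + snd y)"
      using x y ab unfolding C_def by (intro add_mono mult_left_mono) auto
    also have "\<dots> = (a + b) * (\<phi> u - \<epsilon>) + snd (a *\<^sub>R x + b *\<^sub>R y)"
      by (simp add: algebra_simps)
    finally show "a *\<^sub>R x + b *\<^sub>R y \<in> C" using ab by (simp add: C_def)
  qed
  have mem: "(0, \<epsilon>) \<in> C" by (simp add: C_def)
  obtain m where m: "m \<in> C" "\<And>q. q \<in> C \<Longrightarrow> norm m \<le> norm q" "\<And>q. q \<in> C \<Longrightarrow> 0 \<le> m \<bullet> (q - m)"
    using closed_convex_min_norm[OF convex closed] mem by blast
  obtain a b where ab: "m = (a, b)" by fastforce
  have ma: "\<phi> (u + a) \<le> \<phi> u - \<epsilon> + b" using m(1) by (simp add: C_def ab)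
  have "norm a \<le> norm m" using norm_fst_le[of a b] by (simp add: ab)
  also have "\<dots> \<le> \<epsilon>" using m(2)[OF mem] \<epsilon> by (simp add: norm_Pair)
  finally have a: "norm a \<le> \<epsilon>" .
  have "0 \<le> b" using m(3)[of "(a, b + 1)"] ma by (simp add: C_def ab inner_prod_def)
  moreover have "b \<noteq> 0"
  proof
    assume "b = 0"
    then have "0 \<le> - (a \<bullet> a)" using m(3)[OF mem] by (simp add: ab inner_prod_def)
    then have "a = 0" by (metis inner_gt_zero_iff neg_0_le_iff_le not_le)
    then show False using ma \<open>b = 0\<close> \<epsilon> by simp
  qed
  ultimately have b: "0 < b" by simp
  have "- (1 / b) *\<^sub>R a \<in> subdifferential \<phi> (u + a)"
    unfolding subdifferential_def
  proof (safe)
    fix v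
    have "0 \<le> a \<bullet> (v - (u + a)) + b * (\<phi> v - (\<phi> u - \<epsilon> + b))"
      using m(3)[of "(v - u, \<phi> v - \<phi> u + \<epsilon>)"] by (simp add: C_def ab inner_prod_def algebra_simps)
    then have "0 \<le> (1 / b) * (a \<bullet> (v - (u + a)) + b * (\<phi> v - (\<phi> u - \<epsilon> + b)))"
      using b by simp
    also have "\<dots> = (1 / b) * (a \<bullet> (v - (u + a))) + (\<phi> v - (\<phi> u - \<epsilon> + b))"
      using b by (simp add: field_simps)
    finally show "\<phi> (u + a) + (- (1 / b) *\<^sub>R a) \<bullet> (v - (u + a)) \<le> \<phi> v" using ma by simp
  qed
  then show thesis using a by (intro that[of "u + a"]) auto
qed

text \<open>
  Subgradients exist at points arbitrarily near \<open>u\<close>, and they are bounded because \<open>\<phi>\<close> is bounded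
  near \<open>u\<close>; so every approximate subdifferential at \<open>u\<close> contains a vector of bounded norm, and the
  nested sets have a common point.
\<close>

theorem subdifferential_nonempty:
  fixes \<phi> :: "'a::{real_inner,banach} \<Rightarrow> real"
  assumes cvx: "convex_on UNIV \<phi>" and cont: "continuous_on UNIV \<phi>"
  shows "subdifferential \<phi> u \<noteq> {}"
proof -
  have near: "\<exists>d>0. \<forall>v. norm (v - u) \<le> d \<longrightarrow> \<bar>\<phi> v - \<phi> u\<bar> \<le> e" if "e > 0" for e
  proof -
    have "isCont \<phi> u" using cont by (simp add: continuous_on_eq_continuous_at)
    then have "\<exists>d>0. \<forall>v. dist v u < d \<longrightarrow> dist (\<phi> v) (\<phi> u) < e"
      using that unfolding continuous_at_eps_delta by blast
    then obtain d where "d > 0" "\<And>v. dist v u < d \<Longrightarrow> dist (\<phi> v) (\<phi> u) < e"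
      by blast
    moreover have "\<bar>\<phi> v - \<phi> u\<bar> \<le> e" if "norm (v - u) \<le> d / 2" for v
    proof -
      have "dist v u < d" using that \<open>d > 0\<close> by (simp add: dist_norm)
      then have "dist (\<phi> v) (\<phi> u) < e" by fact
      then show ?thesis by (simp add: dist_real_def)
    qed
    ultimately show ?thesis by (intro exI[of _ "d / 2"]) simp
  qed
  obtain d2 where d2: "d2 > 0" "\<And>v. norm (v - u) \<le> d2 \<Longrightarrow> \<bar>\<phi> v - \<phi> u\<bar> \<le> 1"
    using near[of 1] by auto
  define d where "d = d2 / 2"
  have d: "0 < d" "d2 = 2 * d" using d2 by (auto simp: d_def)
  have bound: "norm p \<le> 2 / d" if v: "norm (v - u) \<le> d" and p: "p \<in> subdifferential \<phi> v" for v p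
  proof (cases "p = 0")
    case False
    \<comment> \<open>Along the direction of \<open>p\<close> the function grows at rate \<open>norm p\<close>, yet \<open>\<phi>\<close> varies by at
      most 2 on the ball of radius \<open>2 * d\<close>.\<close>
    define w where "w = v + (d / norm p) *\<^sub>R p"
    have "norm (w - v) = d" using False d by (simp add: w_def)
    then have "norm (w - u) \<le> d2" using v norm_triangle_ineq[of "w - v" "v - u"] d by simp
    then have "\<phi> w - \<phi> v \<le> 2" using d2(2)[of w] d2(2)[of v] v d by linarith
    moreover have "\<phi> v + p \<bullet> (w - v) \<le> \<phi> w" using p by (simp add: subdifferential_def)
    moreover have "p \<bullet> (w - v) = d * norm p"
      using False by (simp add: w_def dot_square_norm power2_eq_square)
    ultimately show ?thesis using d by (simp add: field_simps)
  qed (use d in simp)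
  have small: "\<exists>p\<in>approx_subdifferential \<phi> e u. norm p \<le> 2 / d" if e: "0 < e" for e
  proof -
    obtain d' where d': "d' > 0" "\<And>v. norm (v - u) \<le> d' \<Longrightarrow> \<bar>\<phi> v - \<phi> u\<bar> \<le> e / 2"
      using near[of "e / 2"] e by auto
    define \<epsilon> where "\<epsilon> = min (min d d') (d * e / 4)"
    have "0 < \<epsilon>" using d d' e by (simp add: \<epsilon>_def)
    then obtain v p where v: "norm (v - u) \<le> \<epsilon>" and p: "p \<in> subdifferential \<phi> v"
      using subgradient_near[OF cvx cont] by blast
    have pb: "norm p \<le> 2 / d" using bound[OF _ p] v by (simp add: \<epsilon>_def)
    have "p \<bullet> (v - u) \<le> norm p * norm (v - u)" by (rule norm_cauchy_schwarz)
    also have "\<dots> \<le> (2 / d) * (d * e / 4)"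
      using pb v d by (intro mult_mono) (auto simp: \<epsilon>_def)
    finally have pv: "p \<bullet> (v - u) \<le> e / 2" using d by simp
    have "p \<in> approx_subdifferential \<phi> e u"
    proof (rule approx_subdifferentialI)
      fix w
      have "\<phi> v + p \<bullet> (w - v) \<le> \<phi> w" using p by (simp add: subdifferential_def)
      moreover have "\<bar>\<phi> v - \<phi> u\<bar> \<le> e / 2" using d'(2) v by (simp add: \<epsilon>_def)
      moreover have "p \<bullet> (w - u) = p \<bullet> (w - v) + p \<bullet> (v - u)" by (simp add: inner_diff_right)
      moreover have "e \<le> e * (1 + norm (w - u))" using e by simp
      ultimately show "\<phi> u + p \<bullet> (w - u) \<le> \<phi> w + e * (1 + norm (w - u))" using pv by linarith
    qed
    then show ?thesis using pb by blast
  qed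
  have "\<exists>m. \<forall>e>0. m \<in> approx_subdifferential \<phi> e u"
  proof (rule nested_convex_min_norm[of "\<lambda>e. approx_subdifferential \<phi> e u" "2 / d"])
    fix m assume "\<And>e. 0 < e \<Longrightarrow> m \<in> approx_subdifferential \<phi> e u"
    then show ?thesis by blast
  qed (simp_all only: convex_approx_subdifferential closed_approx_subdifferential small
      approx_subdifferential_mono)
  then show ?thesis using subdifferential_iff_approx by blast
qed

text \<open>
  The selection operator in the definition of the minimal subgradient makes a meaningful choice
  only because the subdifferential is closed, convex and nonempty.
\<close>

lemma minimal_subgradient_in_subdifferential:
  fixes \<phi> :: "'a::{real_inner,banach} \<Rightarrow> real"
  assumes "convex_on UNIV \<phi>" "continuous_on UNIV \<phi>"
  shows "minimal_subgradient \<phi> u \<in> subdifferential \<phi> u"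
proof -
  obtain m where "is_arg_min norm (\<lambda>p. p \<in> subdifferential \<phi> u) m"
    using closed_convex_min_norm[OF convex_subdifferential closed_subdifferential
        subdifferential_nonempty[OF assms, of u]] by (auto simp: is_arg_min_def not_less)
  then have "is_arg_min norm (\<lambda>p. p \<in> subdifferential \<phi> u) (minimal_subgradient \<phi> u)"
    unfolding minimal_subgradient_def arg_min_def by (rule someI)
  then show ?thesis by (simp add: is_arg_min_def)
qed

lemma minimal_subgradient_bounded:
  assumes "damping_potential \<phi>"
  obtains M where "0 \<le> M" "\<And>u. norm u \<le> R \<Longrightarrow> norm (minimal_subgradient \<phi> u) \<le> M"
proof -
  have "bdd_above ((\<lambda>u. norm (minimal_subgradient \<phi> u)) ` {u. norm u \<le> max R 1})"
    using assms unfolding damping_potential_def by (metis less_max_iff_disj zero_less_one)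
  then obtain M where "\<And>u. norm u \<le> max R 1 \<Longrightarrow> norm (minimal_subgradient \<phi> u) \<le> M"
    unfolding bdd_above_def by blast
  then show thesis by (intro that[of "max M 0"]) (auto simp: le_max_iff_disj)
qed

section \<open>Gradients of convex functions\<close>

lemma GDERIV_grad:
  assumes "GDERIV f x :> D"
  shows "GDERIV f x :> grad f x"
proof -
  have "D' = D" if "GDERIV f x :> D'" for D'
  proof -
    have "(\<lambda>h. h \<bullet> D') = (\<lambda>h. h \<bullet> D)"
      using has_derivative_unique that assms unfolding gderiv_def by blast
    then have "(D' - D) \<bullet> D' = (D' - D) \<bullet> D" by meson
    then have "(D' - D) \<bullet> (D' - D) = 0" by (simp only: inner_diff_right)
    then show ?thesis by (simp only: inner_eq_zero_iff right_minus_eq)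
  qed
  then show ?thesis unfolding grad_def using assms by (metis theI)
qed

text \<open>
  Reduction to the tangent inequality on the line through \<open>x\<close> and \<open>v\<close>.
\<close>

lemma convex_above_tangent:
  fixes f :: "'a::real_inner \<Rightarrow> real"
  assumes cvx: "convex_on UNIV f" and D: "GDERIV f x :> D"
  shows "f x + D \<bullet> (v - x) \<le> f v"
proof -
  define g where "g t = f (x + t *\<^sub>R (v - x))" for t :: real
  have cvxg: "convex_on UNIV g"
  proof (rule convex_onI)
    fix t a b :: real assume t: "0 < t" "t < 1"
    have eq: "x + ((1 - t) *\<^sub>R a + t *\<^sub>R b) *\<^sub>R (v - x) =
        (1 - t) *\<^sub>R (x + a *\<^sub>R (v - x)) + t *\<^sub>R (x + b *\<^sub>R (v - x))"
      by (simp add: algebra_simps)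
    show "g ((1 - t) *\<^sub>R a + t *\<^sub>R b) \<le> (1 - t) * g a + t * g b"
      unfolding g_def eq by (rule convex_onD[OF cvx]) (use t in auto)
  qed simp
  have "((\<lambda>t. x + t *\<^sub>R (v - x)) has_derivative (\<lambda>t. t *\<^sub>R (v - x))) (at 0)"
    by (auto intro!: derivative_eq_intros)
  moreover have "(f has_derivative (\<lambda>h. h \<bullet> D)) (at (x + 0 *\<^sub>R (v - x)))"
    using D by (simp add: gderiv_def)
  ultimately have "(g has_derivative (\<lambda>t. (t *\<^sub>R (v - x)) \<bullet> D)) (at 0)"
    unfolding g_def by (rule has_derivative_compose)
  then have "(g has_field_derivative D \<bullet> (v - x)) (at 0)"
    unfolding has_field_derivative_def by (simp add: inner_commute mult_commute_abs)
  then have "(D \<bullet> (v - x)) * (1 - 0) \<le> g 1 - g 0"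
    using convex_on_imp_above_tangent[OF cvxg, of 0 1 "D \<bullet> (v - x)"] by simp
  then show ?thesis by (simp add: g_def)
qed

section \<open>Differentiability of solutions of the variational inequality\<close>

text \<open>
  A weak formulation of \<open>y' + g \<in> - \<partial>\<phi>(y)\<close>. Formally, the derivative of \<open>(norm (y - v))\<^sup>2 / 2\<close> is
  at most \<open>\<phi> v - \<phi> y - g \<bullet> (y - v)\<close>; the assumption \<open>variational\<close> is the integral of
  this, where affine upper bounds of the integrand take the place of the integral. It passes to
  uniform limits and does not mention a derivative of \<open>y\<close>.
\<close>

locale damped_evolution =
  fixes \<phi> :: "'a::{real_inner,banach} \<Rightarrow> real" and g y :: "real \<Rightarrow> 'a" and T M C :: real
  assumes convex: "convex_on UNIV \<phi>" and cont: "continuous_on UNIV \<phi>"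
    and y_lip: "M-lipschitz_on {0..T} y" and g_lip: "C-lipschitz_on {0..T} g"
    and variational: "\<And>v s t a b. \<lbrakk>0 \<le> s; s \<le> t; t \<le> T;
      \<And>\<tau>. \<tau> \<in> {s..t} \<Longrightarrow> \<phi> v - \<phi> (y \<tau>) - g \<tau> \<bullet> (y \<tau> - v) \<le> a + b * (\<tau> - s)\<rbrakk> \<Longrightarrow>
      (norm (y t - v))\<^sup>2 - (norm (y s - v))\<^sup>2 \<le> 2 * a * (t - s) + b * (t - s)\<^sup>2"
begin

lemma M_nonneg: "0 \<le> M" and C_nonneg: "0 \<le> C"
  using y_lip g_lip lipschitz_on_nonneg by auto

text \<open>
  The element of minimal norm of \<open>g t + \<partial>\<phi>(y t)\<close>, specified through the well-posedness property
  in which it is used. Its negative turns out to be the right derivative of \<open>y\<close>.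
\<close>

definition slope :: "real \<Rightarrow> 'a" where
  "slope t = (SOME m. m - g t \<in> subdifferential \<phi> (y t) \<and>
     (\<forall>\<eta>>0. \<exists>e>0. \<forall>q. q - g t \<in> approx_subdifferential \<phi> e (y t) \<longrightarrow> norm q \<le> norm m + e \<longrightarrow>
        norm (q - m) \<le> \<eta>))"

lemma slope_exists:
  "\<exists>m. m - g t \<in> subdifferential \<phi> (y t) \<and>
     (\<forall>\<eta>>0. \<exists>e>0. \<forall>q. q - g t \<in> approx_subdifferential \<phi> e (y t) \<longrightarrow> norm q \<le> norm m + e \<longrightarrow>
        norm (q - m) \<le> \<eta>)"
proof -
  define D where "D e = (\<lambda>p. g t + p) ` approx_subdifferential \<phi> e (y t)" for e
  have D_iff: "q \<in> D e \<longleftrightarrow> q - g t \<in> approx_subdifferential \<phi> e (y t)" for q e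
    unfolding D_def by (force simp: image_iff)
  obtain p where p: "p \<in> subdifferential \<phi> (y t)"
    using subdifferential_nonempty[OF convex cont] by blast
  show ?thesis
  proof (rule nested_convex_min_norm[of D "norm (g t + p)"])
    show "\<exists>q\<in>D e. norm q \<le> norm (g t + p)" if "0 < e" for e
      using p that unfolding subdifferential_iff_approx D_def by blast
    show "D d \<subseteq> D e" if "0 < d" "d \<le> e" for d e
      unfolding D_def using approx_subdifferential_mono[OF that(2)] by blast
    fix m assume m: "\<And>e. 0 < e \<Longrightarrow> m \<in> D e"
      and wp: "\<And>\<eta>. 0 < \<eta> \<Longrightarrow> \<exists>e>0. \<forall>q\<in>D e. norm q \<le> norm m + e \<longrightarrow> norm (q - m) \<le> \<eta>"
    show ?thesis
    proof (intro exI[of _ m] conjI allI impI)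
      show "m - g t \<in> subdifferential \<phi> (y t)" using m unfolding D_iff subdifferential_iff_approx by blast
      fix \<eta> :: real assume "0 < \<eta>"
      from wp[OF this] show "\<exists>e>0. \<forall>q. q - g t \<in> approx_subdifferential \<phi> e (y t) \<longrightarrow>
          norm q \<le> norm m + e \<longrightarrow> norm (q - m) \<le> \<eta>"
        unfolding Ball_def D_iff by blast
    qed
  qed (simp_all add: D_def convex_translation closed_translation convex_approx_subdifferential
      closed_approx_subdifferential)
qed

lemma slope_subdifferential: "slope t - g t \<in> subdifferential \<phi> (y t)"
  and slope_well_posed: "0 < \<eta> \<Longrightarrow> \<exists>e>0. \<forall>q. q - g t \<in> approx_subdifferential \<phi> e (y t) \<longrightarrow>
     norm q \<le> norm (slope t) + e \<longrightarrow> norm (q - slope t) \<le> \<eta>"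
  using someI_ex[OF slope_exists[of t], folded slope_def] by blast+

text \<open>
  Comparison of \<open>y\<close> with the constant curve \<open>y s\<close>, for which \<open>slope s - g s\<close> is a subgradient.
\<close>

lemma increment_le_slope:
  assumes st: "0 \<le> s" "s < t" "t \<le> T"
  shows "norm (y t - y s) \<le> (norm (slope s) + C * (t - s)) * (t - s)"
proof -
  define a where "a = norm (slope s) + C * (t - s)"
  have a: "0 \<le> a" using st C_nonneg by (simp add: a_def)
  define r where "r \<tau> = norm (y \<tau> - y s) / (\<tau> - s)" for \<tau>
  \<comment> \<open>\<open>K\<close> is the best constant with \<open>norm (y \<tau> - y s) \<le> K * (\<tau> - s)\<close>. Feeding this linear bound into
    the variational inequality gives the constant \<open>sqrt (a * K)\<close>, whence \<open>K \<le> a\<close>. A constant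
    bound on the right-hand side would lose a factor 2, which the strong convergence of the
    quotients could not tolerate.\<close>
  define K where "K = Sup (r ` {s<..t})"
  have "r \<tau> \<le> M" if "\<tau> \<in> {s<..t}" for \<tau>
    using lipschitz_on_normD[OF y_lip, of \<tau> s] that st by (simp add: r_def field_simps)
  then have bdd: "bdd_above (r ` {s<..t})" by (rule bdd_aboveI2)
  have r_K: "r \<tau> \<le> K" if "\<tau> \<in> {s<..t}" for \<tau>
    unfolding K_def using that by (intro cSup_upper bdd) auto
  have "0 \<le> r t" using st by (simp add: r_def)
  then have K: "0 \<le> K" using r_K[of t] st by simp
  have incr: "norm (y \<tau> - y s) \<le> K * (\<tau> - s)" if "\<tau> \<in> {s..t}" for \<tau>
    using r_K[of \<tau>] that by (cases "\<tau> = s") (auto simp: r_def field_simps)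
  have "r u \<le> sqrt (a * K)" if u: "u \<in> {s<..t}" for u
  proof -
    have "(norm (y u - y s))\<^sup>2 - (norm (y s - y s))\<^sup>2 \<le> 2 * 0 * (u - s) + (a * K) * (u - s)\<^sup>2"
    proof (rule variational)
      fix \<tau> assume \<tau>: "\<tau> \<in> {s..u}"
      have "\<phi> (y s) + (slope s - g s) \<bullet> (y \<tau> - y s) \<le> \<phi> (y \<tau>)"
        using slope_subdifferential[of s] by (simp add: subdifferential_def)
      then have "\<phi> (y s) - \<phi> (y \<tau>) - g \<tau> \<bullet> (y \<tau> - y s) \<le> - ((slope s + (g \<tau> - g s)) \<bullet> (y \<tau> - y s))"
        by (simp add: inner_diff_left inner_add_left)
      also have "\<dots> \<le> norm (slope s + (g \<tau> - g s)) * norm (y \<tau> - y s)"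
        using Cauchy_Schwarz_ineq2[of "slope s + (g \<tau> - g s)" "y \<tau> - y s"] by linarith
      also have "\<dots> \<le> a * (K * (\<tau> - s))"
      proof (rule mult_mono)
        have "norm (g \<tau> - g s) \<le> C * (\<tau> - s)"
          using lipschitz_on_normD[OF g_lip, of \<tau> s] \<tau> u st by simp
        also have "\<dots> \<le> C * (t - s)" using \<tau> u C_nonneg by (intro mult_left_mono) auto
        finally show "norm (slope s + (g \<tau> - g s)) \<le> a"
          unfolding a_def using norm_triangle_ineq[of "slope s" "g \<tau> - g s"] by linarith
      qed (use incr[of \<tau>] \<tau> u a in auto)
      finally show "\<phi> (y s) - \<phi> (y \<tau>) - g \<tau> \<bullet> (y \<tau> - y s) \<le> 0 + (a * K) * (\<tau> - s)" by simp
    qed (use u st in auto)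
    then have "(norm (y u - y s))\<^sup>2 \<le> (sqrt (a * K) * (u - s))\<^sup>2"
      using a K by (simp add: power_mult_distrib)
    then have "norm (y u - y s) \<le> sqrt (a * K) * (u - s)"
      using u a K by (intro power2_le_imp_le[of "norm (y u - y s)"]) auto
    then show ?thesis using u by (simp add: r_def field_simps)
  qed
  then have "K \<le> sqrt (a * K)" unfolding K_def[symmetric] using st
    by (subst K_def, intro cSup_least) auto
  then have "K\<^sup>2 \<le> a * K" using K a power_mono[of K "sqrt (a * K)" 2] by simp
  then have "K \<le> a" using K a by (cases "K = 0") (auto simp: power2_eq_square)
  then have "K * (t - s) \<le> a * (t - s)" using st by (intro mult_right_mono) auto
  moreover have "norm (y t - y s) \<le> K * (t - s)" using st by (intro incr) auto
  ultimately show ?thesis unfolding a_def by (rule order_trans[rotated])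
qed

lemma y_continuous: "continuous_on {0..T} y"
  using y_lip by (rule lipschitz_on_continuous_on)

lemma \<phi>_y_near:
  assumes "t \<in> {0..T}" "0 < e"
  shows "\<exists>\<delta>>0. \<forall>\<tau>\<in>{0..T}. \<bar>\<tau> - t\<bar> < \<delta> \<longrightarrow> \<bar>\<phi> (y \<tau>) - \<phi> (y t)\<bar> < e"
proof -
  have "continuous_on {0..T} (\<lambda>t. \<phi> (y t))"
    using y_continuous by (intro continuous_on_compose2[OF cont]) auto
  then show ?thesis using assms unfolding continuous_on_iff dist_real_def by blast
qed

lemma g_bounded: "\<exists>G\<ge>0. \<forall>t\<in>{0..T}. norm (g t) \<le> G"
  by (rule lipschitz_on_interval_bounded[OF g_lip]) blast

text \<open>
  The variational inequality on a short interval, divided by its length, is the inequality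
  defining an approximate subgradient.
\<close>

lemma difference_quotient_approx_subgradient:
  assumes t: "t \<in> {0..<T}" and e: "0 < e"
  shows "\<exists>\<delta>>0. \<forall>h. 0 < h \<longrightarrow> h < \<delta> \<longrightarrow> t + h \<le> T \<and>
    - ((1 / h) *\<^sub>R (y (t + h) - y t)) - g t \<in> approx_subdifferential \<phi> e (y t)"
proof -
  obtain G where G: "0 \<le> G" "\<And>t. t \<in> {0..T} \<Longrightarrow> norm (g t) \<le> G" using g_bounded by blast
  obtain \<delta>1 where \<delta>1: "\<delta>1 > 0" "\<And>\<tau>. \<tau> \<in> {0..T} \<Longrightarrow> \<bar>\<tau> - t\<bar> < \<delta>1 \<Longrightarrow> \<bar>\<phi> (y \<tau>) - \<phi> (y t)\<bar> < e / 2"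
    using \<phi>_y_near[of t "e / 2"] t e by auto
  define \<delta> where "\<delta> = min (min \<delta>1 (T - t)) (min (e / (C + 1)) (e / (2 * (G * M + 1))))"
  have GM: "0 < 2 * (G * M + 1)" using G M_nonneg by (smt (verit) mult_nonneg_nonneg)
  have \<delta>: "0 < \<delta>" "\<delta> \<le> \<delta>1" "\<delta> \<le> T - t"
    using \<delta>1 t e C_nonneg GM by (auto simp: \<delta>_def)
  have "\<delta> \<le> e / (C + 1)" "\<delta> \<le> e / (2 * (G * M + 1))" by (auto simp: \<delta>_def)
  then have \<delta>C: "\<delta> * (C + 1) \<le> e" and \<delta>G: "\<delta> * (2 * (G * M + 1)) \<le> e"
    using C_nonneg GM by (simp_all only: pos_le_divide_eq add_nonneg_pos zero_less_one)
  have C\<delta>: "C * \<delta> \<le> e" and GM\<delta>: "G * (M * \<delta>) \<le> e / 2" using \<delta>C \<delta>G \<delta>(1) by (auto simp: algebra_simps)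
  have "- ((1 / h) *\<^sub>R (y (t + h) - y t)) - g t \<in> approx_subdifferential \<phi> e (y t)"
    if h: "0 < h" "h < \<delta>" for h
  proof (rule approx_subdifferentialI)
    fix v
    define a where "a = \<phi> v - \<phi> (y t) - g t \<bullet> (y t - v) + e * (1 + norm (v - y t))"
    have "(norm (y (t + h) - v))\<^sup>2 - (norm (y t - v))\<^sup>2 \<le> 2 * a * (t + h - t) + 0 * (t + h - t)\<^sup>2"
    proof (rule variational)
      fix \<tau> assume \<tau>: "\<tau> \<in> {t..t + h}"
      then have \<tau>T: "\<tau> \<in> {0..T}" "\<bar>\<tau> - t\<bar> < \<delta>" using t h \<delta> by auto
      have "- (g \<tau> \<bullet> (y \<tau> - v)) = - (g t \<bullet> (y t - v)) - (g \<tau> - g t) \<bullet> (y t - v) - g \<tau> \<bullet> (y \<tau> - y t)"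
        by (simp add: inner_diff)
      moreover have "- ((g \<tau> - g t) \<bullet> (y t - v)) \<le> e * norm (v - y t)"
      proof -
        have "- ((g \<tau> - g t) \<bullet> (y t - v)) \<le> norm (g \<tau> - g t) * norm (y t - v)"
          using Cauchy_Schwarz_ineq2[of "g \<tau> - g t" "y t - v"] by linarith
        also have "\<dots> \<le> (C * \<bar>\<tau> - t\<bar>) * norm (y t - v)"
          using lipschitz_on_normD[OF g_lip \<tau>T(1), of t] t by (intro mult_right_mono) auto
        also have "\<dots> \<le> (C * \<delta>) * norm (y t - v)"
          using \<tau>T C_nonneg by (intro mult_right_mono mult_left_mono) auto
        also have "\<dots> \<le> e * norm (y t - v)" using C\<delta> by (intro mult_right_mono) auto
        finally show ?thesis by (simp add: norm_minus_commute)
      qed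
      moreover have "- (g \<tau> \<bullet> (y \<tau> - y t)) \<le> e / 2"
      proof -
        have "- (g \<tau> \<bullet> (y \<tau> - y t)) \<le> norm (g \<tau>) * norm (y \<tau> - y t)"
          using Cauchy_Schwarz_ineq2[of "g \<tau>" "y \<tau> - y t"] by linarith
        also have "norm (y \<tau> - y t) \<le> M * \<bar>\<tau> - t\<bar>"
          using lipschitz_on_normD[OF y_lip \<tau>T(1), of t] t by simp
        also have "M * \<bar>\<tau> - t\<bar> \<le> M * \<delta>" using \<tau>T M_nonneg by (intro mult_left_mono) auto
        also have "norm (g \<tau>) * (M * \<delta>) \<le> G * (M * \<delta>)"
          using G(2)[OF \<tau>T(1)] M_nonneg \<delta> by (intro mult_right_mono) auto
        finally show ?thesis using GM\<delta> by (simp add: mult_left_mono)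
      qed
      moreover have "\<bar>\<phi> (y \<tau>) - \<phi> (y t)\<bar> < e / 2" using \<delta>1(2)[OF \<tau>T(1)] \<tau>T \<delta> by simp
      ultimately show "\<phi> v - \<phi> (y \<tau>) - g \<tau> \<bullet> (y \<tau> - v) \<le> a + 0 * (\<tau> - t)"
        unfolding a_def distrib_left by linarith
    qed (use t h \<delta> in auto)
    then have "(norm (y (t + h) - v))\<^sup>2 - (norm (y t - v))\<^sup>2 \<le> 2 * a * h" by simp
    moreover have "2 * ((y (t + h) - y t) \<bullet> (y t - v)) \<le> (norm (y (t + h) - v))\<^sup>2 - (norm (y t - v))\<^sup>2"
    proof -
      have "(norm (y (t + h) - v))\<^sup>2 = (norm ((y (t + h) - y t) + (y t - v)))\<^sup>2" by simp
      also have "\<dots> = (norm (y (t + h) - y t))\<^sup>2 + 2 * ((y (t + h) - y t) \<bullet> (y t - v)) + (norm (y t - v))\<^sup>2"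
        by (simp only: power2_norm_eq_inner inner_add inner_commute)
      finally show ?thesis by simp
    qed
    ultimately have "(y (t + h) - y t) \<bullet> (y t - v) \<le> a * h" by linarith
    then have "(1 / h) * ((y (t + h) - y t) \<bullet> (y t - v)) \<le> a" using h by (simp add: field_simps)
    moreover have "(- ((1 / h) *\<^sub>R (y (t + h) - y t)) - g t) \<bullet> (v - y t) =
        (1 / h) * ((y (t + h) - y t) \<bullet> (y t - v)) + g t \<bullet> (y t - v)"
    proof -
      have "v - y t = - (y t - v)" by simp
      then show ?thesis by (simp only: inner_minus_right inner_diff_left inner_minus_left inner_scaleR_left)
    qed
    ultimately show "\<phi> (y t) + (- ((1 / h) *\<^sub>R (y (t + h) - y t)) - g t) \<bullet> (v - y t)
        \<le> \<phi> v + e * (1 + norm (v - y t))"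
      unfolding a_def by linarith
  qed
  then show ?thesis using \<delta> by (intro exI[of _ \<delta>]) auto
qed

text \<open>
  The quotients, up to sign, are approximate elements of \<open>g t + \<partial>\<phi>(y t)\<close> and are asymptotically no
  longer than its element of minimal norm; so they converge to it strongly.
\<close>

lemma difference_quotient_near_slope:
  assumes t: "t \<in> {0..<T}" and \<eta>: "0 < \<eta>"
  shows "\<exists>\<delta>>0. \<forall>h. 0 < h \<longrightarrow> h < \<delta> \<longrightarrow> norm ((1 / h) *\<^sub>R (y (t + h) - y t) - (- slope t)) \<le> \<eta>"
proof -
  obtain e where e: "0 < e" "\<And>q. q - g t \<in> approx_subdifferential \<phi> e (y t) \<Longrightarrow>
      norm q \<le> norm (slope t) + e \<Longrightarrow> norm (q - slope t) \<le> \<eta>"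
    using slope_well_posed[OF \<eta>] by blast
  obtain \<delta> where \<delta>: "\<delta> > 0" "\<And>h. 0 < h \<Longrightarrow> h < \<delta> \<Longrightarrow> t + h \<le> T \<and>
    - ((1 / h) *\<^sub>R (y (t + h) - y t)) - g t \<in> approx_subdifferential \<phi> e (y t)"
    using difference_quotient_approx_subgradient[OF t e(1)] by blast
  have "norm ((1 / h) *\<^sub>R (y (t + h) - y t) - (- slope t)) \<le> \<eta>"
    if h: "0 < h" "h < min \<delta> (e / (C + 1))" for h
  proof -
    define q where "q = - ((1 / h) *\<^sub>R (y (t + h) - y t))"
    have "h * (C + 1) \<le> e" using h C_nonneg by (simp add: field_simps)
    then have Ch: "C * h \<le> e" using h by (simp add: algebra_simps)
    have "norm (y (t + h) - y t) \<le> (norm (slope t) + C * h) * h"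
      using increment_le_slope[of t "t + h"] \<delta>(2)[of h] h t by simp
    moreover have "norm q = norm (y (t + h) - y t) / h" using h by (simp add: q_def)
    ultimately have "norm q \<le> norm (slope t) + C * h" using h by (simp add: pos_divide_le_eq)
    then have "norm (q - slope t) \<le> \<eta>" using \<delta>(2)[of h] h Ch by (intro e(2)) (auto simp: q_def)
    moreover have "(1 / h) *\<^sub>R (y (t + h) - y t) - (- slope t) = - (q - slope t)" by (simp add: q_def)
    ultimately show ?thesis by (simp only: norm_minus_cancel)
  qed
  moreover have "0 < min \<delta> (e / (C + 1))" using \<delta> e C_nonneg by auto
  ultimately show ?thesis by blast
qed

lemma right_derivative:
  assumes t: "t \<in> {0..<T}"
  shows "(y has_vector_derivative - slope t) (at_right t)"
  unfolding has_vector_derivative_def has_derivative_within_alt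
proof (intro conjI allI impI)
  show "bounded_linear (\<lambda>x. x *\<^sub>R - slope t)" by (rule bounded_linear_scaleR_left)
  fix \<eta> :: real assume "0 < \<eta>"
  then obtain \<delta> where \<delta>: "\<delta> > 0" "\<And>h. 0 < h \<Longrightarrow> h < \<delta> \<Longrightarrow>
      norm ((1 / h) *\<^sub>R (y (t + h) - y t) - (- slope t)) \<le> \<eta>"
    using difference_quotient_near_slope[OF t] by blast
  have "norm (y s - y t - (s - t) *\<^sub>R - slope t) \<le> \<eta> * norm (s - t)"
    if s: "t < s" "norm (s - t) < \<delta>" for s
  proof -
    have "y s - y t - (s - t) *\<^sub>R - slope t =
        (s - t) *\<^sub>R ((1 / (s - t)) *\<^sub>R (y (t + (s - t)) - y t) - (- slope t))"
      using s by (simp add: scaleR_diff_right scaleR_add_right)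
    also have "norm \<dots> \<le> \<bar>s - t\<bar> * \<eta>"
      unfolding norm_scaleR using s by (intro mult_left_mono \<delta>) auto
    finally show ?thesis by (simp add: mult.commute)
  qed
  then show "\<exists>d>0. \<forall>s\<in>{t<..}. norm (s - t) < d \<longrightarrow>
      norm (y s - y t - (s - t) *\<^sub>R - slope t) \<le> \<eta> * norm (s - t)"
    using \<delta>(1) by auto
qed

lemma difference_quotient_tendsto:
  assumes t: "t \<in> {0..<T}"
  shows "((\<lambda>h. (1 / h) *\<^sub>R (y (t + h) - y t)) \<longlongrightarrow> - slope t) (at_right 0)"
proof (rule tendstoI)
  fix e :: real assume "0 < e"
  then obtain \<delta> where \<delta>: "\<delta> > 0" "\<And>h. 0 < h \<Longrightarrow> h < \<delta> \<Longrightarrow>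
      norm ((1 / h) *\<^sub>R (y (t + h) - y t) - (- slope t)) \<le> e / 2"
    using difference_quotient_near_slope[OF t, of "e / 2"] by auto
  have "norm ((1 / h) *\<^sub>R (y (t + h) - y t) - (- slope t)) < e" if "0 < h" "h < \<delta>" for h
    using \<delta>(2)[OF that] \<open>0 < e\<close> by linarith
  then show "\<forall>\<^sub>F h in at_right 0. dist ((1 / h) *\<^sub>R (y (t + h) - y t)) (- slope t) < e"
    unfolding eventually_at_right_field dist_norm using \<delta>(1) by blast
qed

text \<open>
  By monotonicity, a curve and its time shift by \<open>h\<close> separate at a rate controlled by the
  variation \<open>C * h\<close> of \<open>g\<close>; dividing by \<open>h\<close> and letting \<open>h\<close> tend to 0 turns this into an
  estimate of the right derivative at two times.
\<close>

lemma slope_decay: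
  assumes rt: "0 \<le> r" "r \<le> t" "t < T"
  shows "(norm (slope t))\<^sup>2 \<le> exp (t - r) * ((norm (slope r))\<^sup>2 + C\<^sup>2 * (t - r))"
proof (rule tendsto_le[OF trivial_limit_at_right_real])
  have lim: "((\<lambda>h. (norm ((1 / h) *\<^sub>R (y (s + h) - y s)))\<^sup>2) \<longlongrightarrow> (norm (slope s))\<^sup>2) (at_right 0)"
    if "s \<in> {0..<T}" for s
    using tendsto_power[OF tendsto_norm[OF difference_quotient_tendsto[OF that]], of 2]
    by (simp only: norm_minus_cancel)
  show "((\<lambda>h. (norm ((1 / h) *\<^sub>R (y (t + h) - y t)))\<^sup>2) \<longlongrightarrow> (norm (slope t))\<^sup>2) (at_right 0)"
    using rt by (intro lim) auto
  show "((\<lambda>h. exp (t - r) * ((norm ((1 / h) *\<^sub>R (y (r + h) - y r)))\<^sup>2 + C\<^sup>2 * (t - r))) \<longlongrightarrow>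
      exp (t - r) * ((norm (slope r))\<^sup>2 + C\<^sup>2 * (t - r))) (at_right 0)"
    using rt by (intro tendsto_intros lim) auto
  have "(norm ((1 / h) *\<^sub>R (y (t + h) - y t)))\<^sup>2 \<le>
      exp (t - r) * ((norm ((1 / h) *\<^sub>R (y (r + h) - y r)))\<^sup>2 + C\<^sup>2 * (t - r))"
    if h: "0 < h" "h < T - t" for h
  proof -
    have "(norm (y (t + h) - y t))\<^sup>2 \<le>
      exp (2 * (1/2) * (t - r)) * ((norm (y (r + h) - y r))\<^sup>2 + 2 * ((C * h)\<^sup>2 / 2) * (t - r))"
    proof (rule norm_gronwall[where z = "\<lambda>\<tau>. y (\<tau> + h) - y \<tau>" and N = "{}" and L = "M * 1 + M"])
      show "(M * 1 + M)-lipschitz_on {r..t} (\<lambda>\<tau>. y (\<tau> + h) - y \<tau>)"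
      proof (intro lipschitz_intros lipschitz_on_compose2[where g = y])
        show "1-lipschitz_on {r..t} (\<lambda>\<tau>. \<tau> + h)" by (auto intro: lipschitz_onI simp: dist_real_def)
        show "M-lipschitz_on ((\<lambda>\<tau>. \<tau> + h) ` {r..t}) y" "M-lipschitz_on {r..t} y"
          by (rule lipschitz_on_subset[OF y_lip]; use rt h in force)+
      qed
      fix \<tau> assume \<tau>: "r < \<tau>" "\<tau> < t"
      define Z where "Z = y (\<tau> + h) - y \<tau>"
      have "((y \<circ> (\<lambda>\<tau>. \<tau> + h)) has_vector_derivative 1 *\<^sub>R (- slope (\<tau> + h))) (at \<tau> within {\<tau><..})"
      proof (rule vector_diff_chain_within)
        show "((\<lambda>\<tau>. \<tau> + h) has_vector_derivative 1) (at_right \<tau>)"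
          by (auto intro!: derivative_eq_intros)
        show "(y has_vector_derivative - slope (\<tau> + h)) (at (\<tau> + h) within (\<lambda>\<tau>. \<tau> + h) ` {\<tau><..})"
          using right_derivative[of "\<tau> + h"] \<tau> h rt
          by (auto intro: has_vector_derivative_within_subset)
      qed
      then have d: "((\<lambda>\<tau>. y (\<tau> + h) - y \<tau>) has_vector_derivative (- slope (\<tau> + h) - - slope \<tau>)) (at_right \<tau>)"
        using right_derivative[of \<tau>] \<tau> h rt
        by (intro has_vector_derivative_diff) (auto simp: o_def)
      have "0 \<le> ((slope (\<tau> + h) - g (\<tau> + h)) - (slope \<tau> - g \<tau>)) \<bullet> Z"
        unfolding Z_def by (rule subdifferential_monotone[OF slope_subdifferential slope_subdifferential])
      then have "(- slope (\<tau> + h) - - slope \<tau>) \<bullet> Z \<le> - ((g (\<tau> + h) - g \<tau>) \<bullet> Z)"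
        by (simp add: inner_diff_left)
      also have "\<dots> \<le> norm (g (\<tau> + h) - g \<tau>) * norm Z"
        using Cauchy_Schwarz_ineq2[of "g (\<tau> + h) - g \<tau>" Z] by linarith
      also have "\<dots> \<le> (C * h) * norm Z"
        using lipschitz_on_normD[OF g_lip, of "\<tau> + h" \<tau>] \<tau> h rt by (intro mult_right_mono) auto
      also have "\<dots> \<le> (1/2) * (norm Z)\<^sup>2 + (C * h)\<^sup>2 / 2"
        using sum_squares_bound[of "C * h" "norm Z"] by simp
      finally show "\<exists>d. ((\<lambda>\<tau>. y (\<tau> + h) - y \<tau>) has_vector_derivative d) (at_right \<tau>) \<and>
          d \<bullet> (y (\<tau> + h) - y \<tau>) \<le> (1/2) * (norm (y (\<tau> + h) - y \<tau>))\<^sup>2 + (C * h)\<^sup>2 / 2"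
        using d unfolding Z_def by blast
    qed (use rt in auto)
    then have "(norm (y (t + h) - y t))\<^sup>2 / h\<^sup>2 \<le>
        (exp (t - r) * ((norm (y (r + h) - y r))\<^sup>2 + (C * h)\<^sup>2 * (t - r))) / h\<^sup>2"
      by (intro divide_right_mono) auto
    also have "\<dots> = exp (t - r) * ((norm (y (r + h) - y r))\<^sup>2 / h\<^sup>2 + C\<^sup>2 * (t - r))"
      using h by (simp add: field_simps)
    finally show ?thesis by (simp add: power_divide)
  qed
  then show "\<forall>\<^sub>F h in at_right 0. (norm ((1 / h) *\<^sub>R (y (t + h) - y t)))\<^sup>2 \<le>
      exp (t - r) * ((norm ((1 / h) *\<^sub>R (y (r + h) - y r)))\<^sup>2 + C\<^sup>2 * (t - r))"
    unfolding eventually_at_right_field using rt by (intro exI[of _ "T - t"]) auto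
qed

lemma norm_slope_continuous_off_countable:
  "countable {t \<in> {0<..<T}. \<not> isCont (\<lambda>t. norm (slope t)) t}"
proof -
  \<comment> \<open>A monotone function has countably many discontinuities.\<close>
  define J where "J t = C\<^sup>2 * t - exp (- t) * (norm (slope t))\<^sup>2" for t
  have "mono_on {0<..<T} J"
  proof (rule mono_onI)
    fix r t assume r: "r \<in> {0<..<T}" and t: "t \<in> {0<..<T}" and rt: "r \<le> t"
    have "exp (- t) * (norm (slope t))\<^sup>2 \<le> exp (- t) * (exp (t - r) * ((norm (slope r))\<^sup>2 + C\<^sup>2 * (t - r)))"
      using slope_decay[of r t] r t rt by simp
    also have "\<dots> = exp (- r) * (norm (slope r))\<^sup>2 + exp (- r) * (C\<^sup>2 * (t - r))"
      by (simp add: mult.assoc[symmetric] exp_add[symmetric] distrib_left)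
    also have "exp (- r) * (C\<^sup>2 * (t - r)) \<le> C\<^sup>2 * (t - r)"
      using r rt by (intro mult_left_le_one_le) auto
    finally show "J r \<le> J t" by (simp add: J_def algebra_simps)
  qed
  then have "countable {t \<in> {0<..<T}. \<not> isCont J t}"
    by (intro mono_on_ctble_discont_open) auto
  moreover have "isCont (\<lambda>t. norm (slope t)) t" if "isCont J t" for t
  proof -
    have "isCont (\<lambda>t. sqrt (exp t * (C\<^sup>2 * t - J t))) t" by (intro continuous_intros that)
    moreover have "(\<lambda>t. sqrt (exp t * (C\<^sup>2 * t - J t))) = (\<lambda>t. norm (slope t))"
      by (simp add: J_def fun_eq_iff mult.assoc[symmetric] exp_add[symmetric])
    ultimately show ?thesis by simp
  qed
  ultimately show ?thesis by (auto elim: countable_subset[rotated])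
qed

text \<open>
  A subgradient at \<open>y \<tau>\<close> is an approximate subgradient at \<open>y t\<close> when \<open>\<tau>\<close> is near \<open>t\<close>. If moreover
  its norm is nearly that of \<open>slope t\<close>, well-posedness forces it to be near \<open>slope t\<close>.
\<close>

lemma slope_continuous:
  assumes t: "t \<in> {0<..<T}" and cn: "isCont (\<lambda>t. norm (slope t)) t"
  shows "isCont slope t"
  unfolding continuous_at_eps_delta
proof (intro allI impI)
  fix \<eta>0 :: real assume \<eta>0: "0 < \<eta>0"
  obtain e where e: "0 < e" "\<And>q. q - g t \<in> approx_subdifferential \<phi> e (y t) \<Longrightarrow>
      norm q \<le> norm (slope t) + e \<Longrightarrow> norm (q - slope t) \<le> \<eta>0 / 2"
    using slope_well_posed[of "\<eta>0 / 2"] \<eta>0 by auto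
  obtain G where G: "0 \<le> G" "\<And>t. t \<in> {0..T} \<Longrightarrow> norm (g t) \<le> G" using g_bounded by blast
  define P where "P = norm (slope t) + e + G"
  have P: "0 \<le> P" using e G by (simp add: P_def)
  obtain \<delta>1 where \<delta>1: "\<delta>1 > 0" "\<And>\<tau>. \<tau> \<in> {0..T} \<Longrightarrow> \<bar>\<tau> - t\<bar> < \<delta>1 \<Longrightarrow> \<bar>\<phi> (y \<tau>) - \<phi> (y t)\<bar> < e / 2"
    using \<phi>_y_near[of t "e / 2"] t e by auto
  have "\<exists>\<delta>>0. \<forall>\<tau>. dist \<tau> t < \<delta> \<longrightarrow> dist (norm (slope \<tau>)) (norm (slope t)) < e"
    using cn e(1) unfolding continuous_at_eps_delta by blast
  then obtain \<delta>2 where \<delta>2: "\<delta>2 > 0" "\<And>\<tau>. \<bar>\<tau> - t\<bar> < \<delta>2 \<Longrightarrow> norm (slope \<tau>) \<le> norm (slope t) + e"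
    unfolding dist_real_def by (smt (verit))
  define \<delta> where "\<delta> = min (min \<delta>1 \<delta>2) (min (min t (T - t)) (min (e / (C + 1)) (e / (2 * (P * M + 1)))))"
  have PM: "0 < 2 * (P * M + 1)" using P M_nonneg by (smt (verit) mult_nonneg_nonneg)
  have \<delta>: "0 < \<delta>" "\<delta> \<le> \<delta>1" "\<delta> \<le> \<delta>2" "\<delta> \<le> t" "\<delta> \<le> T - t"
    using \<delta>1 \<delta>2 t e C_nonneg PM by (auto simp: \<delta>_def)
  have "\<delta> \<le> e / (C + 1)" "\<delta> \<le> e / (2 * (P * M + 1))" by (auto simp: \<delta>_def)
  then have \<delta>C: "\<delta> * (C + 1) \<le> e" and \<delta>P: "\<delta> * (2 * (P * M + 1)) \<le> e"
    using C_nonneg PM by (simp_all only: pos_le_divide_eq add_nonneg_pos zero_less_one)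
  have C\<delta>: "C * \<delta> \<le> e" and PM\<delta>: "P * (M * \<delta>) \<le> e / 2" using \<delta>C \<delta>P \<delta>(1) by (auto simp: algebra_simps)
  have "dist (slope \<tau>) (slope t) < \<eta>0" if \<tau>: "dist \<tau> t < \<delta>" for \<tau>
  proof -
    have \<tau>T: "\<tau> \<in> {0..T}" "\<bar>\<tau> - t\<bar> < \<delta>" using \<tau> \<delta> by (auto simp: dist_real_def)
    define p where "p = slope \<tau> - g \<tau>"
    have sl: "norm (slope \<tau>) \<le> norm (slope t) + e" using \<delta>2 \<tau>T \<delta> by auto
    have "norm p \<le> norm (slope \<tau>) + norm (g \<tau>)" unfolding p_def by (rule norm_triangle_ineq4)
    then have p: "norm p \<le> P" using sl G(2)[OF \<tau>T(1)] by (simp add: P_def)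
    have "slope \<tau> - g t \<in> approx_subdifferential \<phi> e (y t)"
    proof (rule approx_subdifferentialI)
      fix v
      have "\<phi> (y \<tau>) + p \<bullet> (v - y \<tau>) \<le> \<phi> v"
        using slope_subdifferential[of \<tau>] by (simp add: subdifferential_def p_def)
      moreover have "(slope \<tau> - g t) \<bullet> (v - y t) = p \<bullet> (v - y \<tau>) + p \<bullet> (y \<tau> - y t) + (g \<tau> - g t) \<bullet> (v - y t)"
        by (simp add: p_def inner_diff)
      moreover have "p \<bullet> (y \<tau> - y t) \<le> e / 2"
      proof -
        have "p \<bullet> (y \<tau> - y t) \<le> norm p * norm (y \<tau> - y t)" by (rule norm_cauchy_schwarz)
        also have "\<dots> \<le> P * (M * \<bar>\<tau> - t\<bar>)"
          using lipschitz_on_normD[OF y_lip \<tau>T(1), of t] t p P by (intro mult_mono) auto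
        also have "\<dots> \<le> P * (M * \<delta>)" using \<tau>T M_nonneg P by (intro mult_left_mono) auto
        finally show ?thesis using PM\<delta> by simp
      qed
      moreover have "(g \<tau> - g t) \<bullet> (v - y t) \<le> e * norm (v - y t)"
      proof -
        have "(g \<tau> - g t) \<bullet> (v - y t) \<le> norm (g \<tau> - g t) * norm (v - y t)" by (rule norm_cauchy_schwarz)
        also have "\<dots> \<le> (C * \<bar>\<tau> - t\<bar>) * norm (v - y t)"
          using lipschitz_on_normD[OF g_lip \<tau>T(1), of t] t by (intro mult_right_mono) auto
        also have "\<dots> \<le> (C * \<delta>) * norm (v - y t)"
          using \<tau>T C_nonneg by (intro mult_right_mono mult_left_mono) auto
        also have "\<dots> \<le> e * norm (v - y t)" using C\<delta> by (intro mult_right_mono) auto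
        finally show ?thesis .
      qed
      moreover have "\<bar>\<phi> (y \<tau>) - \<phi> (y t)\<bar> < e / 2" using \<delta>1(2)[OF \<tau>T(1)] \<tau>T \<delta> by simp
      ultimately show "\<phi> (y t) + (slope \<tau> - g t) \<bullet> (v - y t) \<le> \<phi> v + e * (1 + norm (v - y t))"
        unfolding distrib_left by linarith
    qed
    then have "norm (slope \<tau> - slope t) \<le> \<eta>0 / 2" using sl by (rule e(2))
    then show ?thesis using \<eta>0 by (simp add: dist_norm)
  qed
  then show "\<exists>d>0. \<forall>\<tau>. dist \<tau> t < d \<longrightarrow> dist (slope \<tau>) (slope t) < \<eta>0" using \<delta>(1) by blast
qed

lemma differentiable_where_slope_continuous:
  assumes t: "t \<in> {0<..<T}" and c: "isCont slope t"
  shows "(y has_vector_derivative - slope t) (at t)"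
proof (rule has_vector_derivative_if_increments)
  fix \<eta> :: real assume "\<eta> > 0"
  then obtain \<delta>1 where \<delta>1: "\<delta>1 > 0" "\<And>\<tau>. dist \<tau> t < \<delta>1 \<Longrightarrow> dist (slope \<tau>) (slope t) < \<eta>"
    using c[unfolded continuous_at_eps_delta, rule_format, of \<eta>] by auto
  define \<delta> where "\<delta> = min \<delta>1 (min t (T - t))"
  have "norm (y b - y a - (b - a) *\<^sub>R - slope t) \<le> \<eta> * (b - a)"
    if ab: "a \<le> b" "\<bar>a - t\<bar> < \<delta>" "\<bar>b - t\<bar> < \<delta>" for a b
  proof (rule norm_increment_le_of_right_deriv[OF ab(1)])
    have sub: "{a..b} \<subseteq> {0..T}" using ab by (auto simp: \<delta>_def)
    then show "M-lipschitz_on {a..b} y" by (rule lipschitz_on_subset[OF y_lip])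
    fix \<tau> assume \<tau>: "a < \<tau>" "\<tau> < b"
    then have "dist \<tau> t < \<delta>1" "\<tau> \<in> {0..<T}" using ab by (auto simp: \<delta>_def dist_real_def)
    then show "\<exists>d. (y has_vector_derivative d) (at_right \<tau>) \<and> norm (d - - slope t) \<le> \<eta>"
      using right_derivative[of \<tau>] \<delta>1(2)[of \<tau>]
      by (intro exI[of _ "- slope \<tau>"]) (simp add: dist_norm norm_minus_commute less_imp_le)
  qed
  moreover have "0 < \<delta>" using \<delta>1 t by (simp add: \<delta>_def)
  ultimately show "\<exists>\<delta>>0. \<forall>a\<in>UNIV. \<forall>b\<in>UNIV. a \<le> b \<longrightarrow> \<bar>a - t\<bar> < \<delta> \<longrightarrow> \<bar>b - t\<bar> < \<delta> \<longrightarrow>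
      norm (y b - y a - (b - a) *\<^sub>R - slope t) \<le> \<eta> * (b - a)"
    by blast
qed simp

text \<open>
  The values of \<open>y\<close> lie in a Hilbert space of arbitrary dimension, and differentiability comes from
  the monotone structure: the norm of the right derivative has countably many discontinuities, and
  at every other time the right derivative is continuous.
\<close>

theorem strong_solution_off_countable:
  "\<exists>N. countable N \<and> (\<forall>t\<in>{0<..<T} - N. \<exists>d. (y has_vector_derivative d) (at t) \<and>
     - d - g t \<in> subdifferential \<phi> (y t))"
proof (intro exI[of _ "{t \<in> {0<..<T}. \<not> isCont (\<lambda>t. norm (slope t)) t}"] conjI ballI)
  show "countable {t \<in> {0<..<T}. \<not> isCont (\<lambda>t. norm (slope t)) t}"
    by (rule norm_slope_continuous_off_countable)
  fix t assume "t \<in> {0<..<T} - {t \<in> {0<..<T}. \<not> isCont (\<lambda>t. norm (slope t)) t}"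
  then have "(y has_vector_derivative - slope t) (at t)"
    by (intro differentiable_where_slope_continuous slope_continuous) auto
  then show "\<exists>d. (y has_vector_derivative d) (at t) \<and> - d - g t \<in> subdifferential \<phi> (y t)"
    using slope_subdifferential[of t] by (intro exI[of _ "- slope t"]) simp
qed

end

section \<open>The inertial system in phase space\<close>

locale inertial_system =
  fixes f \<phi> :: "'a::{real_inner,banach} \<Rightarrow> real" and \<beta> :: real
  assumes \<beta>: "0 \<le> \<beta>" and f_convex: "convex_on UNIV f"
    and f_C2: "twice_continuously_differentiable f" and f_bdd: "bdd_below (range f)"
    and grad_lipschitz: "\<And>B. bounded B \<Longrightarrow> \<exists>L. L-lipschitz_on B (grad f)"
    and damping: "damping_potential \<phi>"
begin

lemma \<phi>_nonneg: "0 \<le> \<phi> u" and \<phi>_convex: "convex_on UNIV \<phi>" and \<phi>_cont: "continuous_on UNIV \<phi>"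
  and \<phi>_0: "\<phi> 0 = 0"
  using damping by (auto simp: damping_potential_def)

abbreviation p\<^sub>0 :: "'a \<Rightarrow> 'a" where "p\<^sub>0 \<equiv> minimal_subgradient \<phi>"

lemma p0_subgradient: "p\<^sub>0 u \<in> subdifferential \<phi> u"
  by (rule minimal_subgradient_in_subdifferential[OF \<phi>_convex \<phi>_cont])

lemma p0_ineq: "\<phi> u + p\<^sub>0 u \<bullet> (v - u) \<le> \<phi> v"
  using p0_subgradient[of u] by (simp add: subdifferential_def)

lemma tangent: "f x + grad f x \<bullet> (v - x) \<le> f v"
  using f_C2 convex_above_tangent[OF f_convex GDERIV_grad]
  unfolding twice_continuously_differentiable_def by blast

lemma grad_monotone: "0 \<le> (grad f x - grad f y) \<bullet> (x - y)"
  using tangent[of x y] tangent[of y x] by (simp add: inner_diff)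

lemma grad_has_derivative: "(grad f has_derivative blinfun_apply (hess f x)) (at x)"
proof -
  have "grad f differentiable (at x)"
    using f_C2 by (simp add: twice_continuously_differentiable_def)
  then have d: "(grad f has_derivative frechet_derivative (grad f) (at x)) (at x)"
    by (simp add: frechet_derivative_works)
  then show ?thesis
    unfolding hess_def by (simp add: bounded_linear_Blinfun_apply has_derivative_bounded_linear)
qed

lemma grad_lipschitz_ball: "\<exists>L\<ge>0. L-lipschitz_on (cball 0 R) (grad f)"
  using grad_lipschitz[of "cball 0 R"] lipschitz_on_nonneg by blast

lemma grad_bounded: "\<exists>G\<ge>0. \<forall>x. norm x \<le> R \<longrightarrow> norm (grad f x) \<le> G"
proof -
  obtain L where L: "L \<ge> 0" "L-lipschitz_on (cball 0 (max R 0)) (grad f)"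
    using grad_lipschitz_ball by blast
  have "norm (grad f x) \<le> norm (grad f 0) + L * max R 0" if "norm x \<le> R" for x
  proof -
    have "norm (grad f x - grad f 0) \<le> L * norm (x - 0)"
      using that by (intro lipschitz_on_normD[OF L(2)]) auto
    also have "\<dots> \<le> L * max R 0" using that L(1) by (intro mult_left_mono) auto
    finally show ?thesis using norm_triangle_ineq2[of "grad f x" "grad f 0"] by linarith
  qed
  then show ?thesis using L(1) by (intro exI[of _ "norm (grad f 0) + L * max R 0"]) simp
qed

text \<open>
  The structural inequality of the problem. The convexity of \<open>f\<close> makes the damping by \<open>\<beta>\<close> monotone in the
  first component, the subdifferential is monotone in the second, and the remaining coupling terms
  are Lipschitz continuous on bounded sets.
\<close>

lemma monotone_coupling:
  assumes L: "L-lipschitz_on (cball 0 R) (grad f)" and R: "norm x \<le> R" "norm x' \<le> R"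
    and p: "p \<in> subdifferential \<phi> y" and p': "p' \<in> subdifferential \<phi> y'"
  shows "((y - \<beta> *\<^sub>R grad f x, - p - grad f x) - (y' - \<beta> *\<^sub>R grad f x', - p' - grad f x')) \<bullet>
      ((x, y) - (x', y')) \<le> (1 + L) * (norm ((x, y) - (x', y')))\<^sup>2"
proof -
  define dx dy dg where "dx = x - x'" and "dy = y - y'" and "dg = grad f x - grad f x'"
  have Lnn: "0 \<le> L" using L lipschitz_on_nonneg by blast
  have "0 \<le> dg \<bullet> dx" unfolding dg_def dx_def by (rule grad_monotone)
  then have 1: "0 \<le> \<beta> * (dg \<bullet> dx)" using \<beta> by simp
  have 2: "0 \<le> (p - p') \<bullet> dy" unfolding dy_def by (rule subdifferential_monotone[OF p p'])
  have "norm dg \<le> L * norm dx"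
    unfolding dg_def dx_def using R by (intro lipschitz_on_normD[OF L]) auto
  then have 3: "- (dg \<bullet> dy) \<le> L * norm dx * norm dy"
    using Cauchy_Schwarz_ineq2[of dg dy] mult_right_mono[of "norm dg" "L * norm dx" "norm dy"] by simp
  have 4: "dy \<bullet> dx \<le> norm dx * norm dy"
    using norm_cauchy_schwarz[of dy dx] by (simp add: mult.commute)
  have "((y - \<beta> *\<^sub>R grad f x, - p - grad f x) - (y' - \<beta> *\<^sub>R grad f x', - p' - grad f x')) \<bullet>
      ((x, y) - (x', y')) = (dy - \<beta> *\<^sub>R dg) \<bullet> dx + (- (p - p') - dg) \<bullet> dy"
    by (simp add: inner_prod_def dx_def dy_def dg_def algebra_simps)
  also have "\<dots> = dy \<bullet> dx - \<beta> * (dg \<bullet> dx) - (p - p') \<bullet> dy - dg \<bullet> dy"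
    by (simp add: inner_diff_left)
  also have "\<dots> \<le> norm dx * norm dy + L * norm dx * norm dy" using 1 2 3 4 by linarith
  also have "\<dots> = (1 + L) * (norm dx * norm dy)" by (simp add: algebra_simps)
  also have "\<dots> \<le> (1 + L) * (norm (dx, dy) * norm (dx, dy))"
    using Lnn norm_fst_le[of dx dy] norm_snd_le[of dy dx] by (intro mult_left_mono mult_mono) auto
  finally show ?thesis by (simp add: dx_def dy_def power2_eq_square)
qed

text \<open>
  The velocity of \<open>(x, x' + \<beta> *\<^sub>R grad f x)\<close> in phase space, with the minimal subgradient as selection.
  The Hessian term is the derivative of \<open>\<beta> *\<^sub>R grad f x\<close> and therefore is absorbed by the second
  coordinate.
\<close>

definition field :: "'a \<times> 'a \<Rightarrow> 'a \<times> 'a" where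
  "field z = (snd z - \<beta> *\<^sub>R grad f (fst z), - p\<^sub>0 (snd z) - grad f (fst z))"

lemma field_bounded: "\<exists>M\<ge>0. \<forall>z. norm z \<le> R \<longrightarrow> norm (field z) \<le> M"
proof -
  obtain G where G: "G \<ge> 0" "\<And>x. norm x \<le> R \<Longrightarrow> norm (grad f x) \<le> G" using grad_bounded by blast
  obtain P where P: "0 \<le> P" "\<And>u. norm u \<le> R \<Longrightarrow> norm (p\<^sub>0 u) \<le> P"
    using minimal_subgradient_bounded[OF damping] by blast
  have "norm (field z) \<le> (\<bar>R\<bar> + \<beta> * G) + (P + G)" if "norm z \<le> R" for z
  proof -
    have z: "norm (fst z) \<le> R" "norm (snd z) \<le> R"
      using that norm_fst_le[of "fst z" "snd z"] norm_snd_le[of "snd z" "fst z"] by auto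
    have "norm (snd z - \<beta> *\<^sub>R grad f (fst z)) \<le> norm (snd z) + \<beta> * norm (grad f (fst z))"
      using norm_triangle_ineq4[of "snd z" "\<beta> *\<^sub>R grad f (fst z)"] \<beta> by simp
    also have "\<dots> \<le> \<bar>R\<bar> + \<beta> * G" using z G \<beta> by (intro add_mono mult_left_mono) auto
    finally have 1: "norm (snd z - \<beta> *\<^sub>R grad f (fst z)) \<le> \<bar>R\<bar> + \<beta> * G" .
    have "norm (- p\<^sub>0 (snd z) - grad f (fst z)) \<le> P + G"
      using norm_triangle_ineq4[of "- p\<^sub>0 (snd z)" "grad f (fst z)"] P(2)[OF z(2)] G(2)[OF z(1)] by simp
    then show ?thesis unfolding field_def using 1 norm_Pair_le by (blast intro: order_trans add_mono)
  qed
  then show ?thesis using G P \<beta> by (intro exI[of _ "(\<bar>R\<bar> + \<beta> * G) + (P + G)"]) auto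
qed

lemma field_one_sided: "\<exists>K. \<forall>z w. norm z \<le> R \<longrightarrow> norm w \<le> R \<longrightarrow>
  (field z - field w) \<bullet> (z - w) \<le> K * (norm (z - w))\<^sup>2"
proof -
  obtain L where L: "L \<ge> 0" "L-lipschitz_on (cball 0 R) (grad f)" using grad_lipschitz_ball by blast
  have "(field z - field w) \<bullet> (z - w) \<le> (1 + L) * (norm (z - w))\<^sup>2" if "norm z \<le> R" "norm w \<le> R" for z w
    using monotone_coupling[OF L(2) _ _ p0_subgradient[of "snd z"] p0_subgradient[of "snd w"], of "fst z" "fst w"]
      that norm_fst_le[of "fst z" "snd z"] norm_fst_le[of "fst w" "snd w"]
    by (simp add: field_def)
  then show ?thesis by blast
qed

definition energy :: "'a \<times> 'a \<Rightarrow> real" where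
  "energy z = f (fst z) - Inf (range f) + (norm (snd z))\<^sup>2 / 2"

lemma Inf_f_le: "Inf (range f) \<le> f x"
  by (rule cInf_lower[OF _ f_bdd]) simp

text \<open>
  Along exact solutions the energy has derivative
  \<open>- \<beta> * (norm (grad f x))\<^sup>2 - p \<bullet> y \<le> 0\<close>. An Euler step reproduces this up to a second-order error,
  where the convexity of \<open>f\<close> is used at the new point.
\<close>

lemma energy_euler_step:
  assumes L: "L-lipschitz_on (cball 0 R) (grad f)" and M: "norm (field z) \<le> M" and h: "0 \<le> h"
    and R: "norm (fst z) \<le> R" "norm (fst (z + h *\<^sub>R field z)) \<le> R"
  shows "energy (z + h *\<^sub>R field z) \<le> energy z + h\<^sup>2 * ((L + 1) * M\<^sup>2)"
proof -
  define x y where "x = fst z" and "y = snd z"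
  define v u where "v = fst (field z)" and "u = snd (field z)"
  have Lnn: "0 \<le> L" using L lipschitz_on_nonneg by blast
  have Mnn: "0 \<le> M" using M norm_ge_zero order_trans by blast
  have v: "norm v \<le> M" using M norm_fst_le[of "fst (field z)" "snd (field z)"] by (simp add: v_def)
  have u: "norm u \<le> M" using M norm_snd_le[of "snd (field z)" "fst (field z)"] by (simp add: u_def)
  have "f (x + h *\<^sub>R v) \<le> f x + h * (grad f (x + h *\<^sub>R v) \<bullet> v)"
    using tangent[of "x + h *\<^sub>R v" x] by simp
  also have "grad f (x + h *\<^sub>R v) \<bullet> v \<le> grad f x \<bullet> v + (L * (h * M)) * M"
  proof -
    have "norm (grad f (x + h *\<^sub>R v) - grad f x) \<le> L * norm (x + h *\<^sub>R v - x)"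
      using R by (intro lipschitz_on_normD[OF L]) (auto simp: x_def v_def)
    also have "\<dots> \<le> L * (h * M)" using v h Lnn by (simp add: mult_left_mono)
    finally have "norm (grad f (x + h *\<^sub>R v) - grad f x) * norm v \<le> (L * (h * M)) * M"
      using v Lnn h Mnn by (intro mult_mono) auto
    then have "(grad f (x + h *\<^sub>R v) - grad f x) \<bullet> v \<le> (L * (h * M)) * M"
      using norm_cauchy_schwarz order_trans by blast
    then show ?thesis by (simp add: inner_diff_left)
  qed
  finally have 1: "f (x + h *\<^sub>R v) \<le> f x + h * (grad f x \<bullet> v + (L * (h * M)) * M)"
    using h by (simp add: mult_left_mono)
  have "(norm (y + h *\<^sub>R u))\<^sup>2 = (norm y)\<^sup>2 + 2 * (h * (y \<bullet> u)) + h\<^sup>2 * (norm u)\<^sup>2"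
    unfolding power2_norm_eq_inner by (simp add: inner_add inner_commute power2_eq_square)
  also have "\<dots> \<le> (norm y)\<^sup>2 + 2 * (h * (y \<bullet> u)) + h\<^sup>2 * (2 * M\<^sup>2)"
    using u h power_mono[OF u, of 2] by (intro add_mono mult_left_mono) (auto intro: order_trans)
  finally have 2: "(norm (y + h *\<^sub>R u))\<^sup>2 / 2 \<le> (norm y)\<^sup>2 / 2 + h * (y \<bullet> u) + h\<^sup>2 * M\<^sup>2" by simp
  have "0 \<le> p\<^sub>0 y \<bullet> y" using p0_ineq[of y 0] \<phi>_nonneg[of y] \<phi>_0 by simp
  moreover have "0 \<le> \<beta> * (grad f x \<bullet> grad f x)" using \<beta> by simp
  moreover have "grad f x \<bullet> v + y \<bullet> u = - \<beta> * (grad f x \<bullet> grad f x) - p\<^sub>0 y \<bullet> y"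
    by (simp add: v_def u_def field_def x_def y_def inner_diff inner_commute)
  ultimately have "grad f x \<bullet> v + y \<bullet> u \<le> 0" by linarith
  then have 3: "h * (grad f x \<bullet> v + y \<bullet> u) \<le> 0" using h by (simp add: mult_nonneg_nonpos)
  have "h * ((L * (h * M)) * M) + h\<^sup>2 * M\<^sup>2 = h\<^sup>2 * ((L + 1) * M\<^sup>2)"
    by (simp add: power2_eq_square algebra_simps)
  moreover have "energy (z + h *\<^sub>R field z) = f (x + h *\<^sub>R v) - Inf (range f) + (norm (y + h *\<^sub>R u))\<^sup>2 / 2"
    "energy z = f x - Inf (range f) + (norm y)\<^sup>2 / 2"
    by (simp_all add: energy_def x_def y_def u_def v_def)
  ultimately show ?thesis using 1 2 3 by (simp add: distrib_left)
qed

text \<open>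
  The gradient at \<open>fst z\<close> is replaced by that at \<open>x0\<close> with the right sign, because the gradient of
  \<open>f\<close> is monotone. So the displacement grows at a rate governed by the energy bound \<open>Y\<close>
  and the gradient at the initial point.
\<close>

lemma displacement_euler_step:
  assumes M: "norm (field z) \<le> M" and h: "0 \<le> h" "h * M\<^sup>2 \<le> 1" and Y: "norm (snd z) \<le> Y"
  shows "(norm (fst (z + h *\<^sub>R field z) - x0))\<^sup>2 \<le>
    (1 + h) * (norm (fst z - x0))\<^sup>2 + h * ((Y + \<beta> * norm (grad f x0))\<^sup>2 + 1)"
proof -
  define D where "D = Y + \<beta> * norm (grad f x0)"
  define x where "x = fst z"
  define v where "v = fst (field z)"
  have v: "norm v \<le> M" using M norm_fst_le[of "fst (field z)" "snd (field z)"] by (simp add: v_def)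
  have "v = snd z - \<beta> *\<^sub>R grad f x0 - \<beta> *\<^sub>R (grad f x - grad f x0)"
    by (simp add: v_def field_def x_def algebra_simps)
  then have "v \<bullet> (x - x0) = (snd z - \<beta> *\<^sub>R grad f x0) \<bullet> (x - x0) - \<beta> * ((grad f x - grad f x0) \<bullet> (x - x0))"
    by (simp only: inner_diff_left inner_scaleR_left)
  also have "\<dots> \<le> (snd z - \<beta> *\<^sub>R grad f x0) \<bullet> (x - x0)"
    using grad_monotone[of x x0] \<beta> by simp
  also have "\<dots> \<le> norm (snd z - \<beta> *\<^sub>R grad f x0) * norm (x - x0)" by (rule norm_cauchy_schwarz)
  also have "\<dots> \<le> D * norm (x - x0)"
    using norm_triangle_ineq4[of "snd z" "\<beta> *\<^sub>R grad f x0"] Y \<beta>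
    by (intro mult_right_mono) (auto simp: D_def)
  finally have "2 * (v \<bullet> (x - x0)) \<le> D\<^sup>2 + (norm (x - x0))\<^sup>2"
    using sum_squares_bound[of D "norm (x - x0)"] by linarith
  then have 1: "h * (2 * (v \<bullet> (x - x0))) \<le> h * (D\<^sup>2 + (norm (x - x0))\<^sup>2)"
    using h by (intro mult_left_mono)
  have "h * (h * (norm v)\<^sup>2) \<le> h * (h * M\<^sup>2)"
    using power_mono[OF v, of 2] h by (intro mult_left_mono) auto
  also have "\<dots> \<le> h * 1" using h by (intro mult_left_mono) auto
  finally have 2: "h * (h * (norm v)\<^sup>2) \<le> h" by simp
  have "(norm (x + h *\<^sub>R v - x0))\<^sup>2 = (norm ((x - x0) + h *\<^sub>R v))\<^sup>2" by (simp add: algebra_simps)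
  also have "\<dots> = (norm (x - x0))\<^sup>2 + h * (2 * (v \<bullet> (x - x0))) + h * (h * (norm v)\<^sup>2)"
    unfolding power2_norm_eq_inner by (simp add: inner_add inner_commute)
  finally show ?thesis using 1 2 unfolding D_def[symmetric] by (simp add: x_def v_def algebra_simps)
qed

lemma euler_a_priori:
  "\<exists>R h0. 0 < h0 \<and> (\<forall>h k. 0 < h \<longrightarrow> h \<le> h0 \<longrightarrow> real k * h \<le> T \<longrightarrow> norm (euler field h z0 k) \<le> R)"
proof -
  define x0 where "x0 = fst z0"
  \<comment> \<open>The step is taken so small that the energy gains at most 1 in total: this bounds the second
    component by \<open>Y\<close>. The displacement of the first then satisfies a discrete Gronwall inequality,
    and \<open>R\<close> is the resulting radius up to time \<open>T'\<close>.\<close>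
  define Y where "Y = sqrt (2 * (energy z0 + 1))"
  have e0: "0 \<le> energy z0" using Inf_f_le[of "fst z0"] by (simp add: energy_def)
  define Q where "Q = (Y + \<beta> * norm (grad f x0))\<^sup>2 + 1"
  define T' where "T' = max T 0"
  define R where "R = (norm x0 + sqrt (Q * exp T')) + Y"
  have Q: "0 \<le> Q" by (simp add: Q_def)
  obtain M where M: "0 \<le> M" "\<And>z. norm z \<le> R \<Longrightarrow> norm (field z) \<le> M" using field_bounded by blast
  obtain L where L: "0 \<le> L" "L-lipschitz_on (cball 0 (R + M)) (grad f)" using grad_lipschitz_ball by blast
  define c where "c = (L + 1) * M\<^sup>2"
  have c: "0 \<le> c" using L by (simp add: c_def)
  define h0 where "h0 = min 1 (min (1 / (M\<^sup>2 + 1)) (1 / (c * T' + 1)))"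
  have T': "0 \<le> T'" "T \<le> T'" by (auto simp: T'_def)
  have den: "0 < M\<^sup>2 + 1" "0 < c * T' + 1" using c T' by (auto intro: add_nonneg_pos)
  have h0: "0 < h0" using den by (simp add: h0_def)
  have main: "energy (euler field h z0 k) \<le> energy z0 + c * h * (real k * h) \<and>
      (norm (fst (euler field h z0 k) - x0))\<^sup>2 \<le> Q * ((1 + h) ^ k - 1) \<and>
      norm (euler field h z0 k) \<le> R" if h: "0 < h" "h \<le> h0" and k: "real k * h \<le> T" for h k
  proof -
    have "h \<le> 1 / (M\<^sup>2 + 1)" "h \<le> 1 / (c * T' + 1)" "h \<le> 1" using h by (auto simp: h0_def)
    then have "h * (M\<^sup>2 + 1) \<le> 1" "h * (c * T' + 1) \<le> 1" "h \<le> 1"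
      using den by (simp_all only: pos_le_divide_eq)
    then have hM: "h * M\<^sup>2 \<le> 1" and hc: "c * h * T' \<le> 1" and h1: "h \<le> 1"
      using h by (auto simp: algebra_simps)
    have inside: "norm (snd z) \<le> Y \<and> norm z \<le> R"
      if e: "energy z \<le> energy z0 + c * h * (real k * h)"
        and d: "(norm (fst z - x0))\<^sup>2 \<le> Q * ((1 + h) ^ k - 1)" and k: "real k * h \<le> T" for z k
    proof -
      have "c * h * (real k * h) \<le> c * h * T'" using k T' c h by (intro mult_left_mono) auto
      then have "energy z \<le> energy z0 + 1" using e hc by linarith
      moreover have "(norm (snd z))\<^sup>2 / 2 \<le> energy z" using Inf_f_le[of "fst z"] by (simp add: energy_def)
      ultimately have "(norm (snd z))\<^sup>2 / 2 \<le> energy z0 + 1" by (rule order_trans[rotated])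
      then have "(norm (snd z))\<^sup>2 \<le> 2 * (energy z0 + 1)" by simp
      then have Y: "norm (snd z) \<le> Y" unfolding Y_def by (rule real_le_rsqrt)
      have "(1 + h) ^ k \<le> exp h ^ k" using h by (intro power_mono) auto
      also have "\<dots> = exp (real k * h)" by (simp add: exp_of_nat_mult)
      also have "\<dots> \<le> exp T'" using k T' by simp
      finally have "Q * ((1 + h) ^ k - 1) \<le> Q * exp T'" using Q by (intro mult_left_mono) auto
      then have "norm (fst z - x0) \<le> sqrt (Q * exp T')" using d by (intro real_le_rsqrt) linarith
      then have "norm (fst z) \<le> norm x0 + sqrt (Q * exp T')"
        using norm_triangle_ineq2[of "fst z" x0] by linarith
      then have "norm (fst z, snd z) \<le> R" unfolding R_def using Y norm_Pair_le[of "fst z" "snd z"] by linarith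
      then show ?thesis using Y by simp
    qed
    show ?thesis using k
    proof (induction k)
      case 0
      have "energy z0 \<le> energy z0 + c * h * (real 0 * h)"
        "(norm (fst z0 - x0))\<^sup>2 \<le> Q * ((1 + h) ^ 0 - 1)" by (auto simp: x0_def)
      then show ?case using inside[of z0 0] T' 0 by auto
    next
      case (Suc k)
      define z where "z = euler field h z0 k"
      have kT: "real k * h \<le> T" using Suc.prems h by (simp add: algebra_simps)
      from Suc.IH[OF kT] have IH: "energy z \<le> energy z0 + c * h * (real k * h)"
        "(norm (fst z - x0))\<^sup>2 \<le> Q * ((1 + h) ^ k - 1)" "norm z \<le> R" by (auto simp: z_def)
      have Y: "norm (snd z) \<le> Y" using inside[OF IH(1,2) kT] by blast
      have Fz: "norm (field z) \<le> M" using M(2)[OF IH(3)] .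
      have x: "norm (fst z) \<le> R" using IH(3) norm_fst_le[of "fst z" "snd z"] by simp
      have "norm (fst (z + h *\<^sub>R field z)) \<le> norm (fst z) + h * norm (fst (field z))"
        using norm_triangle_ineq[of "fst z" "h *\<^sub>R fst (field z)"] h by simp
      also have "\<dots> \<le> R + 1 * M"
        using x h h1 Fz norm_fst_le[of "fst (field z)" "snd (field z)"]
        by (intro add_mono mult_mono) auto
      finally have x': "norm (fst (z + h *\<^sub>R field z)) \<le> R + M" by simp
      have "energy (z + h *\<^sub>R field z) \<le> energy z + h\<^sup>2 * c"
        unfolding c_def using x M(1) h by (intro energy_euler_step[OF L(2) Fz _ _ x']) auto
      also have "\<dots> \<le> energy z0 + c * h * (real (Suc k) * h)"
        using IH(1) by (simp add: power2_eq_square algebra_simps)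
      finally have e: "energy (z + h *\<^sub>R field z) \<le> energy z0 + c * h * (real (Suc k) * h)" .
      have "(norm (fst (z + h *\<^sub>R field z) - x0))\<^sup>2 \<le> (1 + h) * (norm (fst z - x0))\<^sup>2 + h * Q"
        unfolding Q_def using h by (intro displacement_euler_step[OF Fz _ hM Y]) auto
      also have "\<dots> \<le> (1 + h) * (Q * ((1 + h) ^ k - 1)) + h * Q"
        using IH(2) h by (intro add_mono mult_left_mono) auto
      also have "\<dots> = Q * ((1 + h) ^ Suc k - 1)" by (simp add: algebra_simps)
      finally have d: "(norm (fst (z + h *\<^sub>R field z) - x0))\<^sup>2 \<le> Q * ((1 + h) ^ Suc k - 1)" .
      show ?case using e d inside[OF e d Suc.prems] by (simp add: z_def)
    qed
  qed
  then show ?thesis using h0 by blast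
qed

lemma euler_limit_exists:
  "\<exists>z. z 0 = z0 \<and> (\<forall>T\<ge>0. \<exists>R M. M-lipschitz_on {0..T} z \<and> (\<forall>t\<in>{0..T}. norm (z t) \<le> R) \<and>
    (\<forall>\<epsilon>>0. \<exists>P S. approximant field R M T \<epsilon> z P S))"
  by (rule euler_polygons_converge) (use field_bounded field_one_sided euler_a_priori in blast)+

lemma limit_position_derivative:
  assumes z_lip: "M-lipschitz_on {0..T} z" and z_bd: "\<forall>t\<in>{0..T}. norm (z t) \<le> R"
    and appr: "\<forall>\<epsilon>>0. \<exists>P S. approximant field R M T \<epsilon> z P S" and t: "t \<in> {0..<T}"
  shows "((\<lambda>t. fst (z t)) has_vector_derivative fst (field (z t))) (at t within {0..})"
proof (rule has_vector_derivative_if_increments)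
  obtain L where L: "0 \<le> L" "L-lipschitz_on (cball 0 R) (grad f)" using grad_lipschitz_ball by blast
  define K where "K = 1 + \<beta> * L"
  have K: "0 \<le> K" using L \<beta> by (simp add: K_def)
  \<comment> \<open>The selection from the subdifferential only enters the second component; the first one is
    Lipschitz continuous on bounded sets.\<close>
  have Vlip: "norm (fst (field a) - fst (field b)) \<le> K * norm (a - b)" if "norm a \<le> R" "norm b \<le> R" for a b
  proof -
    have nf: "norm (fst a - fst b) \<le> norm (a - b)" "norm (snd a - snd b) \<le> norm (a - b)"
      using dist_fst_le[of a b] dist_snd_le[of a b] by (simp_all add: dist_norm)
    have "fst (field a) - fst (field b) = (snd a - snd b) - \<beta> *\<^sub>R (grad f (fst a) - grad f (fst b))"
      by (simp add: field_def algebra_simps)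
    then have "norm (fst (field a) - fst (field b)) \<le>
        norm (snd a - snd b) + \<beta> * norm (grad f (fst a) - grad f (fst b))"
      using norm_triangle_ineq4[of "snd a - snd b" "\<beta> *\<^sub>R (grad f (fst a) - grad f (fst b))"] \<beta> by simp
    also have "\<beta> * norm (grad f (fst a) - grad f (fst b)) \<le> \<beta> * (L * norm (a - b))"
    proof (rule mult_left_mono[OF _ \<beta>])
      have "norm (grad f (fst a) - grad f (fst b)) \<le> L * norm (fst a - fst b)"
        using that norm_fst_le[of "fst a" "snd a"] norm_fst_le[of "fst b" "snd b"]
        by (intro lipschitz_on_normD[OF L(2)]) auto
      also have "\<dots> \<le> L * norm (a - b)" using L nf by (intro mult_left_mono) auto
      finally show "norm (grad f (fst a) - grad f (fst b)) \<le> L * norm (a - b)" .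
    qed
    finally have "norm (fst (field a) - fst (field b)) \<le> norm (a - b) + \<beta> * (L * norm (a - b))"
      using nf(2) by simp
    then show ?thesis by (simp add: K_def algebra_simps)
  qed
  have cont: "continuous_on {0..T} (\<lambda>t. fst (field (z t)))"
  proof (rule lipschitz_on_continuous_on)
    show "(K * M)-lipschitz_on {0..T} (\<lambda>t. fst (field (z t)))"
    proof (rule lipschitz_onI)
      have M: "0 \<le> M" using z_lip lipschitz_on_nonneg by blast
      then show "0 \<le> K * M" using K by simp
      fix s r assume sr: "s \<in> {0..T}" "r \<in> {0..T}"
      have "norm (fst (field (z s)) - fst (field (z r))) \<le> K * norm (z s - z r)"
        using z_bd sr by (intro Vlip) auto
      also have "\<dots> \<le> K * (M * norm (s - r))"
        using K lipschitz_on_normD[OF z_lip sr] by (intro mult_left_mono) auto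
      finally show "dist (fst (field (z s))) (fst (field (z r))) \<le> K * M * dist s r"
        by (simp add: dist_norm)
    qed
  qed
  show "t \<in> {0..}" using t by simp
  fix \<eta> :: real assume \<eta>: "0 < \<eta>"
  define d where "d = fst (field (z t))"
  have "\<exists>\<delta>>0. \<forall>\<tau>\<in>{0..T}. dist \<tau> t < \<delta> \<longrightarrow> dist (fst (field (z \<tau>))) d < \<eta>"
    using cont t \<eta> unfolding continuous_on_iff d_def by (meson atLeastAtMost_iff atLeastLessThan_iff less_imp_le)
  then obtain \<delta>1 where \<delta>1: "\<delta>1 > 0" "\<And>\<tau>. \<tau> \<in> {0..T} \<Longrightarrow> \<bar>\<tau> - t\<bar> < \<delta>1 \<Longrightarrow> norm (fst (field (z \<tau>)) - d) < \<eta>"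
    unfolding dist_real_def dist_norm by blast
  define \<delta> where "\<delta> = min \<delta>1 (T - t)"
  have "norm (fst (z b) - fst (z a) - (b - a) *\<^sub>R d) \<le> \<eta> * (b - a)"
    if ab: "0 \<le> a" "a \<le> b" "\<bar>a - t\<bar> < \<delta>" "\<bar>b - t\<bar> < \<delta>" for a b
  proof (rule field_le_epsilon)
    fix e0 :: real assume e0: "0 < e0"
    have abT: "a \<in> {0..T}" "b \<in> {0..T}" "{a..b} \<subseteq> {0..T}" using ab by (auto simp: \<delta>_def)
    define \<epsilon> where "\<epsilon> = e0 / (K * (b - a) + 2)"
    have den: "0 < K * (b - a) + 2" using K ab by (intro add_nonneg_pos) auto
    have \<epsilon>: "0 < \<epsilon>" "\<epsilon> * (K * (b - a) + 2) = e0" using e0 den by (auto simp: \<epsilon>_def)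
    then obtain P S where PS: "approximant field R M T \<epsilon> z P S" using appr by blast
    then have P: "M-lipschitz_on {0..T} P" and PSt: "\<And>\<tau>. \<tau> \<in> {0..T} \<Longrightarrow>
        (P has_vector_derivative field (S \<tau>)) (at_right \<tau>) \<and> norm (S \<tau>) \<le> R \<and>
        norm (P \<tau> - z \<tau>) \<le> \<epsilon> \<and> norm (S \<tau> - z \<tau>) \<le> \<epsilon>"
      by (auto simp: approximant_def)
    have "norm (fst (P b) - fst (P a) - (b - a) *\<^sub>R d) \<le> (\<eta> + K * \<epsilon>) * (b - a)"
    proof (rule norm_increment_le_of_right_deriv[OF ab(2)])
      show "M-lipschitz_on {a..b} (\<lambda>\<tau>. fst (P \<tau>))"
      proof (rule lipschitz_onI)
        fix s r assume "s \<in> {a..b}" "r \<in> {a..b}"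
        then show "dist (fst (P s)) (fst (P r)) \<le> M * dist s r"
          using lipschitz_onD[OF P, of s r] abT(3) dist_fst_le[of "P s" "P r"] by force
      qed (use P lipschitz_on_nonneg in blast)
      fix \<tau> assume "a < \<tau>" "\<tau> < b"
      then have \<tau>: "\<tau> \<in> {0..T}" "\<bar>\<tau> - t\<bar> < \<delta>1" using ab abT by (auto simp: \<delta>_def)
      have "norm (fst (field (S \<tau>)) - d) \<le>
          norm (fst (field (S \<tau>)) - fst (field (z \<tau>))) + norm (fst (field (z \<tau>)) - d)"
        using norm_triangle_ineq[of "fst (field (S \<tau>)) - fst (field (z \<tau>))" "fst (field (z \<tau>)) - d"] by simp
      also have "\<dots> \<le> K * norm (S \<tau> - z \<tau>) + \<eta>"
        using PSt[OF \<tau>(1)] z_bd \<tau> \<delta>1(2)[OF \<tau>] by (intro add_mono Vlip) auto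
      also have "\<dots> \<le> K * \<epsilon> + \<eta>" using PSt[OF \<tau>(1)] K by (intro add_mono mult_left_mono) auto
      finally have "norm (fst (field (S \<tau>)) - d) \<le> \<eta> + K * \<epsilon>" by simp
      moreover have "((\<lambda>\<tau>. fst (P \<tau>)) has_vector_derivative fst (field (S \<tau>))) (at_right \<tau>)"
        using PSt[OF \<tau>(1)] bounded_linear.has_vector_derivative[OF bounded_linear_fst] by blast
      ultimately show "\<exists>d'. ((\<lambda>\<tau>. fst (P \<tau>)) has_vector_derivative d') (at_right \<tau>) \<and>
          norm (d' - d) \<le> \<eta> + K * \<epsilon>" by blast
    qed
    moreover have nf: "norm (fst (P \<tau>) - fst (z \<tau>)) \<le> \<epsilon>" if "\<tau> \<in> {0..T}" for \<tau>
      using PSt[OF that] dist_fst_le[of "P \<tau>" "z \<tau>"] by (simp add: dist_norm)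
    moreover have "norm (fst (z b) - fst (z a) - (b - a) *\<^sub>R d) \<le>
        norm (fst (P b) - fst (P a) - (b - a) *\<^sub>R d) + (\<epsilon> + \<epsilon>)"
    proof -
      have "fst (z b) - fst (z a) - (b - a) *\<^sub>R d = (fst (P b) - fst (P a) - (b - a) *\<^sub>R d)
          - ((fst (P b) - fst (z b)) - (fst (P a) - fst (z a)))" by simp
      then have "norm (fst (z b) - fst (z a) - (b - a) *\<^sub>R d) \<le>
          norm (fst (P b) - fst (P a) - (b - a) *\<^sub>R d) + norm ((fst (P b) - fst (z b)) - (fst (P a) - fst (z a)))"
        using norm_triangle_ineq4 by metis
      also have "norm ((fst (P b) - fst (z b)) - (fst (P a) - fst (z a))) \<le> \<epsilon> + \<epsilon>"
        by (intro norm_triangle_le_diff add_mono nf abT)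
      finally show ?thesis by simp
    qed
    ultimately have "norm (fst (z b) - fst (z a) - (b - a) *\<^sub>R d) \<le> (\<eta> + K * \<epsilon>) * (b - a) + (\<epsilon> + \<epsilon>)"
      by linarith
    also have "\<dots> = \<eta> * (b - a) + \<epsilon> * (K * (b - a) + 2)" by (simp add: algebra_simps)
    finally show "norm (fst (z b) - fst (z a) - (b - a) *\<^sub>R d) \<le> \<eta> * (b - a) + e0" using \<epsilon> by simp
  qed
  moreover have "0 < \<delta>" using \<delta>1 t by (simp add: \<delta>_def)
  ultimately show "\<exists>\<delta>>0. \<forall>a\<in>{0..}. \<forall>b\<in>{0..}. a \<le> b \<longrightarrow> \<bar>a - t\<bar> < \<delta> \<longrightarrow> \<bar>b - t\<bar> < \<delta> \<longrightarrow>
      norm (fst (z b) - fst (z a) - (b - a) *\<^sub>R fst (field (z t))) \<le> \<eta> * (b - a)"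
    unfolding d_def by fastforce
qed

text \<open>
  Polygons satisfy the variational inequality up to an error of order \<open>\<epsilon>\<close>, since they move along
  subgradients at nearby points; the inequality then passes to the limit.
\<close>

lemma limit_damped_evolution:
  assumes z_lip: "M-lipschitz_on {0..T} z" and z_bd: "\<forall>t\<in>{0..T}. norm (z t) \<le> R"
    and appr: "\<forall>\<epsilon>>0. \<exists>P S. approximant field R M T \<epsilon> z P S"
  shows "\<exists>C. damped_evolution \<phi> (\<lambda>t. grad f (fst (z t))) (\<lambda>t. snd (z t)) T M C"
proof -
  obtain L where L: "0 \<le> L" "L-lipschitz_on (cball 0 R) (grad f)" using grad_lipschitz_ball by blast
  obtain G where G: "G \<ge> 0" "\<And>x. norm x \<le> R \<Longrightarrow> norm (grad f x) \<le> G" using grad_bounded by blast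
  obtain B where B: "0 \<le> B" "\<And>u. norm u \<le> R \<Longrightarrow> norm (p\<^sub>0 u) \<le> B"
    using minimal_subgradient_bounded[OF damping] by blast
  have M: "0 \<le> M" using z_lip lipschitz_on_nonneg by blast
  have x_lip: "M-lipschitz_on {0..T} (\<lambda>t. fst (z t))" and y_lip: "M-lipschitz_on {0..T} (\<lambda>t. snd (z t))"
    using lipschitz_onD[OF z_lip] M dist_fst_le dist_snd_le
    by (blast intro: lipschitz_onI order_trans)+
  have zb: "norm (fst (z t)) \<le> R" "norm (snd (z t)) \<le> R" if "t \<in> {0..T}" for t
    using z_bd that norm_fst_le[of "fst (z t)" "snd (z t)"] norm_snd_le[of "snd (z t)" "fst (z t)"] by force+
  have "damped_evolution \<phi> (\<lambda>t. grad f (fst (z t))) (\<lambda>t. snd (z t)) T M (L * M)"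
  proof
    show "convex_on UNIV \<phi>" "continuous_on UNIV \<phi>" by (fact \<phi>_convex \<phi>_cont)+
    show "M-lipschitz_on {0..T} (\<lambda>t. snd (z t))" by (fact y_lip)
    show "(L * M)-lipschitz_on {0..T} (\<lambda>t. grad f (fst (z t)))"
      using zb by (intro lipschitz_on_compose2[OF x_lip] lipschitz_on_subset[OF L(2)]) auto
    fix v s t a b
    assume st: "0 \<le> s" "s \<le> t" "t \<le> T" and
      bound: "\<And>\<tau>. \<tau> \<in> {s..t} \<Longrightarrow> \<phi> v - \<phi> (snd (z \<tau>)) - grad f (fst (z \<tau>)) \<bullet> (snd (z \<tau>) - v) \<le> a + b * (\<tau> - s)"
    \<comment> \<open>\<open>K\<close> collects the errors made by evaluating the inequality at the node \<open>S \<tau>\<close> instead of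
      \<open>z \<tau>\<close>, each of them of order \<open>\<epsilon>\<close>.\<close>
    define K where "K = 2 * M + B + L * (R + norm v) + G"
    have approx_ineq: "(norm (snd (P t) - v))\<^sup>2 - (norm (snd (P s) - v))\<^sup>2 \<le>
        2 * (a + K * \<epsilon>) * (t - s) + b * (t - s)\<^sup>2"
      if \<epsilon>: "0 < \<epsilon>" and PS: "approximant field R M T \<epsilon> z P S" for \<epsilon> P S
    proof -
      have P: "M-lipschitz_on {0..T} P" and PSt: "\<And>\<tau>. \<tau> \<in> {0..T} \<Longrightarrow>
        (P has_vector_derivative field (S \<tau>)) (at_right \<tau>) \<and> norm (S \<tau>) \<le> R \<and> norm (field (S \<tau>)) \<le> M \<and>
        norm (P \<tau> - z \<tau>) \<le> \<epsilon> \<and> norm (S \<tau> - z \<tau>) \<le> \<epsilon>"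
        using PS by (auto simp: approximant_def)
      have sub: "{s..t} \<subseteq> {0..T}" using st by auto
      define w where "w \<tau> = snd (P \<tau>) - v" for \<tau>
      have w_lip: "M-lipschitz_on {s..t} w"
      proof (rule lipschitz_onI[OF _ M])
        fix q r assume "q \<in> {s..t}" "r \<in> {s..t}"
        then have "dist (P q) (P r) \<le> M * dist q r" using lipschitz_onD[OF P, of q r] sub by blast
        moreover have "dist (w q) (w r) = dist (snd (P q)) (snd (P r))" by (simp add: w_def dist_norm)
        ultimately show "dist (w q) (w r) \<le> M * dist q r" using dist_snd_le[of "P q" "P r"] by linarith
      qed
      obtain W where W: "0 \<le> W" "\<And>\<tau>. \<tau> \<in> {s..t} \<Longrightarrow> norm (w \<tau>) \<le> W"
        using lipschitz_on_interval_bounded[OF w_lip] by blast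
      have ww: "(M * W + W * M)-lipschitz_on {s..t} (\<lambda>\<tau>. w \<tau> \<bullet> w \<tau>)"
        by (intro lipschitz_on_inner w_lip W)
      have id_lip: "1-lipschitz_on {s..t} (\<lambda>\<tau>. \<tau> - s)" by (auto intro: lipschitz_onI simp: dist_real_def)
      have sq: "(1 * (t - s) + (t - s) * 1)-lipschitz_on {s..t} (\<lambda>\<tau>. (\<tau> - s) \<bullet> (\<tau> - s))"
        using st by (intro lipschitz_on_inner id_lip) auto
      define h where "h \<tau> = w \<tau> \<bullet> w \<tau> - (2 * (a + K * \<epsilon>)) * (\<tau> - s) - b * ((\<tau> - s) \<bullet> (\<tau> - s))" for \<tau>
      have "((M * W + W * M) + \<bar>2 * (a + K * \<epsilon>)\<bar> * 1 + \<bar>b\<bar> * (1 * (t - s) + (t - s) * 1))-lipschitz_on {s..t} h"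
        unfolding h_def by (intro lipschitz_intros ww id_lip sq)
      then have "h t \<le> h s"
      proof (rule antimono_if_right_deriv_nonpos[OF st(2) _ negligible_empty])
        fix \<tau> assume "s < \<tau>" "\<tau> < t"
        then have \<tau>: "\<tau> \<in> {s..t}" "\<tau> \<in> {0..T}" using st by auto
        define x\<^sub>1 y\<^sub>1 where "x\<^sub>1 = fst (S \<tau>)" and "y\<^sub>1 = snd (S \<tau>)"
        define x y where "x = fst (z \<tau>)" and "y = snd (z \<tau>)"
        define u where "u = snd (field (S \<tau>))"
        note PS\<tau> = PSt[OF \<tau>(2)]
        have b1: "norm x\<^sub>1 \<le> R" "norm y\<^sub>1 \<le> R"
          using PS\<tau> norm_fst_le[of x\<^sub>1 y\<^sub>1] norm_snd_le[of y\<^sub>1 x\<^sub>1] by (auto simp: x\<^sub>1_def y\<^sub>1_def)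
        have b0: "norm x \<le> R" "norm y \<le> R" using zb[OF \<tau>(2)] by (auto simp: x_def y_def)
        have c1: "norm (x\<^sub>1 - x) \<le> \<epsilon>" "norm (y\<^sub>1 - y) \<le> \<epsilon>"
          using PS\<tau> dist_fst_le[of "S \<tau>" "z \<tau>"] dist_snd_le[of "S \<tau>" "z \<tau>"]
          by (auto simp: x\<^sub>1_def y\<^sub>1_def x_def y_def dist_norm)
        have c2: "norm (snd (P \<tau>) - y) \<le> \<epsilon>"
          using PS\<tau> dist_snd_le[of "P \<tau>" "z \<tau>"] by (simp add: y_def dist_norm)
        have "norm (snd (P \<tau>) - y\<^sub>1) \<le> \<epsilon> + \<epsilon>"
          using norm_triangle_le_diff[OF add_mono[OF c2 c1(2)]] by simp
        moreover have "norm u \<le> M"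
          using PS\<tau> norm_snd_le[of "snd (field (S \<tau>))" "fst (field (S \<tau>))"] by (simp add: u_def)
        ultimately have "norm u * norm (snd (P \<tau>) - y\<^sub>1) \<le> M * (\<epsilon> + \<epsilon>)" using M by (intro mult_mono) auto
        then have i1: "u \<bullet> (snd (P \<tau>) - y\<^sub>1) \<le> M * (\<epsilon> + \<epsilon>)" using norm_cauchy_schwarz order_trans by blast
        have i2: "\<phi> y\<^sub>1 + p\<^sub>0 y\<^sub>1 \<bullet> (v - y\<^sub>1) \<le> \<phi> v" by (rule p0_ineq)
        have "norm (p\<^sub>0 y) * norm (y - y\<^sub>1) \<le> B * \<epsilon>"
          using B b0 c1 by (intro mult_mono) (auto simp: norm_minus_commute)
        then have "p\<^sub>0 y \<bullet> (y - y\<^sub>1) \<le> B * \<epsilon>" using norm_cauchy_schwarz order_trans by blast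
        then have i3: "\<phi> y - \<phi> y\<^sub>1 \<le> B * \<epsilon>" using p0_ineq[of y y\<^sub>1] by (simp add: inner_diff_right)
        have "norm (grad f x - grad f x\<^sub>1) \<le> L * norm (x - x\<^sub>1)"
          using b0 b1 by (intro lipschitz_on_normD[OF L(2)]) auto
        also have "\<dots> \<le> L * \<epsilon>" using c1 L by (intro mult_left_mono) (auto simp: norm_minus_commute)
        finally have "norm (grad f x - grad f x\<^sub>1) * norm (y\<^sub>1 - v) \<le> (L * \<epsilon>) * (R + norm v)"
          using b1 L \<epsilon> norm_triangle_ineq4[of y\<^sub>1 v] by (intro mult_mono) auto
        then have i4: "(grad f x - grad f x\<^sub>1) \<bullet> (y\<^sub>1 - v) \<le> (L * \<epsilon>) * (R + norm v)"
          using norm_cauchy_schwarz order_trans by blast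
        have "norm (grad f x) * norm (y - y\<^sub>1) \<le> G * \<epsilon>"
          using G b0 c1 by (intro mult_mono) (auto simp: norm_minus_commute)
        then have i5: "grad f x \<bullet> (y - y\<^sub>1) \<le> G * \<epsilon>" using norm_cauchy_schwarz order_trans by blast
        have "u \<bullet> w \<tau> = u \<bullet> (snd (P \<tau>) - y\<^sub>1) + u \<bullet> (y\<^sub>1 - v)" by (simp add: w_def inner_diff_right)
        also have "u \<bullet> (y\<^sub>1 - v) = p\<^sub>0 y\<^sub>1 \<bullet> (v - y\<^sub>1) - grad f x\<^sub>1 \<bullet> (y\<^sub>1 - v)"
          by (simp add: u_def field_def x\<^sub>1_def y\<^sub>1_def inner_diff)
        also have "grad f x\<^sub>1 \<bullet> (y\<^sub>1 - v) = grad f x \<bullet> (y - v) - (grad f x - grad f x\<^sub>1) \<bullet> (y\<^sub>1 - v)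
            - grad f x \<bullet> (y - y\<^sub>1)"
          by (simp add: inner_diff)
        finally have "u \<bullet> w \<tau> \<le> (\<phi> v - \<phi> y - grad f x \<bullet> (y - v)) +
            (M * (\<epsilon> + \<epsilon>) + B * \<epsilon> + (L * \<epsilon>) * (R + norm v) + G * \<epsilon>)"
          using i1 i2 i3 i4 i5 by linarith
        also have "\<phi> v - \<phi> y - grad f x \<bullet> (y - v) \<le> a + b * (\<tau> - s)"
          using bound[OF \<tau>(1)] by (simp add: x_def y_def)
        also have "M * (\<epsilon> + \<epsilon>) + B * \<epsilon> + (L * \<epsilon>) * (R + norm v) + G * \<epsilon> = K * \<epsilon>"
          by (simp add: K_def algebra_simps)
        finally have le: "u \<bullet> w \<tau> \<le> a + b * (\<tau> - s) + K * \<epsilon>" by simp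
        have "((\<lambda>\<tau>. snd (P \<tau>)) has_vector_derivative u) (at_right \<tau>)"
          unfolding u_def using PS\<tau> bounded_linear.has_vector_derivative[OF bounded_linear_snd] by blast
        then have "(w has_vector_derivative u) (at_right \<tau>)"
          unfolding w_def by (auto intro!: derivative_eq_intros)
        then have wd: "((\<lambda>\<tau>. w \<tau> \<bullet> w \<tau>) has_real_derivative 2 * (u \<bullet> w \<tau>)) (at_right \<tau>)"
          using has_derivative_inner[of w "\<lambda>x. x *\<^sub>R u" \<tau> "{\<tau><..}" w "\<lambda>x. x *\<^sub>R u"]
          unfolding has_field_derivative_def has_vector_derivative_def
          by (simp add: inner_commute algebra_simps mult_commute_abs)
        have "(h has_real_derivative (2 * (u \<bullet> w \<tau>) - 2 * (a + K * \<epsilon>) - 2 * b * (\<tau> - s))) (at_right \<tau>)"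
          unfolding h_def inner_real_def by (auto intro!: derivative_eq_intros wd simp: algebra_simps)
        then show "\<exists>D\<le>0. (h has_real_derivative D) (at_right \<tau>)"
          using le by (intro exI[of _ "2 * (u \<bullet> w \<tau>) - 2 * (a + K * \<epsilon>) - 2 * b * (\<tau> - s)"]) auto
      qed
      then show ?thesis by (simp add: h_def w_def power2_norm_eq_inner[symmetric] power2_eq_square)
    qed
    have "\<forall>n. \<exists>P S. approximant field R M T (1 / real (Suc n)) z P S" using appr by simp
    then obtain P S where PS: "\<And>n. approximant field R M T (1 / real (Suc n)) z (P n) (S n)" by metis
    have e_lim: "(\<lambda>n. 1 / real (Suc n)) \<longlonglongrightarrow> 0" using LIMSEQ_Suc[OF lim_1_over_n] by simp
    have P_lim: "(\<lambda>n. P n \<tau>) \<longlonglongrightarrow> z \<tau>" if "\<tau> \<in> {0..T}" for \<tau>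
    proof (rule LIM_zero_cancel, rule Lim_null_comparison[OF _ e_lim])
      show "\<forall>\<^sub>F n in sequentially. norm (P n \<tau> - z \<tau>) \<le> 1 / real (Suc n)"
        using PS that unfolding approximant_def by (intro always_eventually allI) blast
    qed
    show "(norm (snd (z t) - v))\<^sup>2 - (norm (snd (z s) - v))\<^sup>2 \<le> 2 * a * (t - s) + b * (t - s)\<^sup>2"
    proof (rule LIMSEQ_le)
      show "(\<lambda>n. (norm (snd (P n t) - v))\<^sup>2 - (norm (snd (P n s) - v))\<^sup>2) \<longlonglongrightarrow>
          (norm (snd (z t) - v))\<^sup>2 - (norm (snd (z s) - v))\<^sup>2"
        using st by (intro tendsto_intros P_lim) auto
      show "(\<lambda>n. 2 * (a + K * (1 / real (Suc n))) * (t - s) + b * (t - s)\<^sup>2) \<longlonglongrightarrow>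
          2 * a * (t - s) + b * (t - s)\<^sup>2"
      proof -
        have "(\<lambda>n. 2 * (a + K * (1 / real (Suc n))) * (t - s) + b * (t - s)\<^sup>2) \<longlonglongrightarrow>
            2 * (a + K * 0) * (t - s) + b * (t - s)\<^sup>2" by (intro tendsto_intros e_lim)
        then show ?thesis by simp
      qed
      show "\<exists>N. \<forall>n\<ge>N. (norm (snd (P n t) - v))\<^sup>2 - (norm (snd (P n s) - v))\<^sup>2 \<le>
          2 * (a + K * (1 / real (Suc n))) * (t - s) + b * (t - s)\<^sup>2"
        by (intro exI allI impI approx_ineq[OF _ PS]) simp
    qed
  qed
  then show ?thesis by blast
qed

end

section \<open>Measurability and one-sided derivatives\<close>

lemma at_within_Ici_not_bot:
  fixes t :: real
  assumes "0 \<le> t"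
  shows "at t within {0..} \<noteq> bot"
proof -
  have "at_right t \<le> at t within {0..}" using assms by (intro at_le) auto
  then show ?thesis using trivial_limit_at_right_real[of t] by (metis bot.extremum_uniqueI)
qed

lemma velocity_eqI:
  "\<lbrakk>0 \<le> t; (x has_vector_derivative v) (at t within {0..})\<rbrakk> \<Longrightarrow> velocity x t = v"
  unfolding velocity_def by (rule vector_derivative_within[OF at_within_Ici_not_bot])

lemma acceleration_eqI:
  "\<lbrakk>0 \<le> t; (velocity x has_vector_derivative a) (at t within {0..})\<rbrakk> \<Longrightarrow> acceleration x t = a"
  unfolding acceleration_def by (rule vector_derivative_within[OF at_within_Ici_not_bot])

lemma AE_lebesgue_on_iff_negligible:
  assumes "S \<in> sets lebesgue"
  shows "(AE t in lebesgue_on S. Q t) \<longleftrightarrow> (\<exists>N. negligible N \<and> (\<forall>t\<in>S - N. Q t))"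
proof -
  have "(AE t in lebesgue_on S. Q t) \<longleftrightarrow> (AE t in lebesgue. t \<in> S \<longrightarrow> Q t)"
    using assms by (intro AE_restrict_space_iff) auto
  also have "\<dots> \<longleftrightarrow> (\<exists>N. negligible N \<and> (\<forall>t\<in>S - N. Q t))"
    unfolding eventually_ae_filter negligible_iff_null_sets by auto
  finally show ?thesis .
qed

lemma AE_lebesgue_on_if_countable:
  fixes S N :: "real set"
  assumes "S \<in> sets lebesgue" "countable N" "\<And>t. t \<in> S - N \<Longrightarrow> Q t"
  shows "AE t in lebesgue_on S. Q t"
  unfolding AE_lebesgue_on_iff_negligible[OF assms(1)]
  using countable_imp_null_set_lborel[OF assms(2)] assms(3)
  by (blast intro: negligible_iff_null_sets[THEN iffD2] null_sets_completionI)

lemma simple_function_floor: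
  assumes "0 < T"
  shows "simple_function (lebesgue_on {0<..<T}) (\<lambda>t. \<lfloor>t * real k\<rfloor>)"
  unfolding simple_function_eq_measurable
proof
  have "(\<lambda>t. \<lfloor>t * real k\<rfloor>) ` space (lebesgue_on {0<..<T}) \<subseteq> {0..\<lfloor>T * real k\<rfloor>}"
    by (auto simp: space_restrict_space intro!: floor_mono mult_right_mono)
  then show "finite ((\<lambda>t. \<lfloor>t * real k\<rfloor>) ` space (lebesgue_on {0<..<T}))"
    by (rule finite_subset) simp
  have "(\<lambda>t. \<lfloor>t * real k\<rfloor>) \<in> borel \<rightarrow>\<^sub>M count_space UNIV" by measurable
  then have "(\<lambda>t. \<lfloor>t * real k\<rfloor>) \<in> lborel \<rightarrow>\<^sub>M count_space UNIV" by simp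
  then show "(\<lambda>t. \<lfloor>t * real k\<rfloor>) \<in> lebesgue_on {0<..<T} \<rightarrow>\<^sub>M count_space UNIV"
    by (intro measurable_restrict_space1 measurable_completion)
qed

lemma forward_quotient_tendsto:
  fixes v :: "real \<Rightarrow> 'b::real_normed_vector"
  assumes t: "0 \<le> t" and d: "(v has_vector_derivative a) (at t within {0..})"
  shows "(\<lambda>n. real (Suc n) *\<^sub>R (v (t + 1 / real (Suc n)) - v t)) \<longlonglongrightarrow> a"
proof (rule LIMSEQ_I)
  fix e :: real assume e: "0 < e"
  then obtain \<delta> where \<delta>: "\<delta> > 0" "\<And>s. s \<in> {0..} \<Longrightarrow> norm (s - t) < \<delta> \<Longrightarrow>
      norm (v s - v t - (s - t) *\<^sub>R a) \<le> (e / 2) * norm (s - t)"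
    using d unfolding has_vector_derivative_def has_derivative_within_alt by (meson half_gt_zero)
  obtain N where N: "1 / real (Suc N) < \<delta>" using \<delta>(1) by (meson nat_approx_posE)
  have "norm (real (Suc n) *\<^sub>R (v (t + 1 / real (Suc n)) - v t) - a) < e" if n: "n \<ge> N" for n
  proof -
    define m where "m = real (Suc n)"
    have m: "0 < m" by (simp add: m_def)
    have "1 / m \<le> 1 / real (Suc N)" unfolding m_def using n by (intro divide_left_mono) auto
    then have "1 / m < \<delta>" using N by simp
    then have "norm (v (t + 1 / m) - v t - (1 / m) *\<^sub>R a) \<le> (e / 2) * (1 / m)"
      using \<delta>(2)[of "t + 1 / m"] t m by simp
    then have "m * norm (v (t + 1 / m) - v t - (1 / m) *\<^sub>R a) \<le> m * ((e / 2) * (1 / m))"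
      using m by (intro mult_left_mono) auto
    moreover have "m *\<^sub>R (v (t + 1 / m) - v t) - a = m *\<^sub>R (v (t + 1 / m) - v t - (1 / m) *\<^sub>R a)"
      using m by (simp add: scaleR_diff_right)
    ultimately have "norm (m *\<^sub>R (v (t + 1 / m) - v t) - a) \<le> e / 2" using m by simp
    then show ?thesis unfolding m_def using e by linarith
  qed
  then show "\<exists>N. \<forall>n\<ge>N. norm (real (Suc n) *\<^sub>R (v (t + 1 / real (Suc n)) - v t) - a) < e" by blast
qed

text \<open>
  Strong measurability requires simple functions, also when the values span a nonseparable space.
  They are obtained from difference quotients of the continuous function \<open>v\<close> on finite grids.
\<close>

lemma Linfty_derivative:
  fixes v :: "real \<Rightarrow> 'b::real_normed_vector"
  assumes T: "0 < T" and lip: "K-lipschitz_on {0..T + 1} v"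
    and d: "AE t in lebesgue_on {0<..<T}. (v has_vector_derivative a t) (at t within {0..})"
  shows "a \<in> Linfty (lebesgue_on {0<..<T})"
proof -
  \<comment> \<open>Difference quotients of step \<open>1 / Suc n\<close>, sampled on a grid of the finer mesh
    \<open>1 / (Suc n)\<^sup>2\<close>, so that the sampling error, multiplied by \<open>Suc n\<close>, still tends to 0.\<close>
  define k where "k n = (Suc n) * (Suc n)" for n
  define s where "s n t = real (Suc n) *\<^sub>R (v (of_int \<lfloor>t * real (k n)\<rfloor> / real (k n) + 1 / real (Suc n))
      - v (of_int \<lfloor>t * real (k n)\<rfloor> / real (k n)))" for n t
  have K: "0 \<le> K" using lip lipschitz_on_nonneg by blast
  have simple: "simple_function (lebesgue_on {0<..<T}) (s n)" for n
    unfolding s_def by (rule simple_function_compose1[OF simple_function_floor[OF T]])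
  have lim: "(\<lambda>n. s n t) \<longlonglongrightarrow> a t \<and> norm (a t) \<le> K"
    if t: "t \<in> {0<..<T}" and dt: "(v has_vector_derivative a t) (at t within {0..})" for t
  proof -
    define q where "q n = real (Suc n) *\<^sub>R (v (t + 1 / real (Suc n)) - v t)" for n
    have q: "q \<longlonglongrightarrow> a t" unfolding q_def using t dt by (intro forward_quotient_tendsto) auto
    have "norm (q n) \<le> K" for n
    proof -
      have "norm (v (t + 1 / real (Suc n)) - v t) \<le> K * norm (t + 1 / real (Suc n) - t)"
        using t by (intro lipschitz_on_normD[OF lip]) (auto simp: add_mono)
      then have "real (Suc n) * norm (v (t + 1 / real (Suc n)) - v t) \<le> real (Suc n) * (K * (1 / real (Suc n)))"
        by (intro mult_left_mono) auto
      then show ?thesis by (simp add: q_def)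
    qed
    then have "norm (a t) \<le> K" by (intro Lim_bounded[OF tendsto_norm[OF q]]) auto
    moreover have "(\<lambda>n. s n t) \<longlonglongrightarrow> a t"
    proof (rule Lim_transform2[OF q])
      have "norm (q n - s n t) \<le> 2 * K * (1 / real (Suc n))" for n
      proof -
        define m where "m = real (Suc n)"
        have m: "1 \<le> m" by (simp add: m_def)
        define r where "r = of_int \<lfloor>t * real (k n)\<rfloor> / real (k n)"
        have k: "real (k n) = m * m" unfolding k_def m_def by (rule of_nat_mult)
        have kpos: "0 < real (k n)" using m unfolding k by simp
        have "of_int \<lfloor>t * real (k n)\<rfloor> \<le> t * real (k n)" "t * real (k n) < of_int \<lfloor>t * real (k n)\<rfloor> + 1"
          by linarith+
        then have r: "r \<le> t" "t \<le> r + 1 / real (k n)" "0 \<le> r"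
          unfolding r_def using t kpos by (simp_all add: pos_divide_le_eq pos_le_divide_eq add_divide_distrib[symmetric])
        have "0 < 1 / m" "1 / m \<le> 1" using m by auto
        then have mm: "t + 1 / m \<le> T + 1" "0 \<le> t + 1 / m" "r + 1 / m \<le> T + 1" "0 \<le> r + 1 / m"
          using t r unfolding greaterThanLessThan_iff by linarith+
        have 1: "norm (v (t + 1 / m) - v (r + 1 / m)) \<le> K * (1 / real (k n))"
        proof -
          have "norm (v (t + 1 / m) - v (r + 1 / m)) \<le> K * norm (t + 1 / m - (r + 1 / m))"
            using t r mm by (intro lipschitz_on_normD[OF lip]) auto
          also have "\<dots> \<le> K * (1 / real (k n))" using r K by (intro mult_left_mono) auto
          finally show ?thesis .
        qed
        have 2: "norm (v t - v r) \<le> K * (1 / real (k n))"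
        proof -
          have "norm (v t - v r) \<le> K * norm (t - r)"
            using t r mm by (intro lipschitz_on_normD[OF lip]) auto
          also have "\<dots> \<le> K * (1 / real (k n))" using r K by (intro mult_left_mono) auto
          finally show ?thesis .
        qed
        have "q n - s n t = m *\<^sub>R ((v (t + 1 / m) - v (r + 1 / m)) - (v t - v r))"
          by (simp add: q_def s_def m_def r_def algebra_simps)
        then have "norm (q n - s n t) = m * norm ((v (t + 1 / m) - v (r + 1 / m)) - (v t - v r))"
          using m by simp
        also have "\<dots> \<le> m * (K * (1 / real (k n)) + K * (1 / real (k n)))"
          using m norm_triangle_le_diff[OF add_mono[OF 1 2]] by (intro mult_left_mono) auto
        also have "\<dots> = 2 * K * (1 / m)" using m unfolding k by (simp add: field_simps)
        finally show ?thesis by (simp add: m_def)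
      qed
      then show "(\<lambda>n. q n - s n t) \<longlonglongrightarrow> 0"
        by (intro Lim_null_comparison[OF always_eventually tendsto_mult_right_zero[OF LIMSEQ_Suc[OF lim_1_over_n]]])
           auto
    qed
    ultimately show ?thesis by blast
  qed
  have "AE t in lebesgue_on {0<..<T}. t \<in> {0<..<T} \<and> (v has_vector_derivative a t) (at t within {0..})"
    using d AE_space by eventually_elim (simp add: space_restrict_space)
  then have "AE t in lebesgue_on {0<..<T}. (\<lambda>n. s n t) \<longlonglongrightarrow> a t"
    and "AE t in lebesgue_on {0<..<T}. norm (a t) \<le> K"
    using lim by (auto elim: eventually_mono)
  then show ?thesis unfolding Linfty_def strongly_measurable_def using simple by blast
qed

section \<open>Existence and uniqueness\<close>

context inertial_system
begin

lemma solution_exists: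
  "\<exists>x. x \<in> {0..} \<rightarrow>\<^sub>E UNIV \<and> strong_global_solution \<beta> f \<phi> x \<and> x 0 = x\<^sub>0 \<and> velocity x 0 = x\<^sub>1"
proof -
  obtain z where z0: "z 0 = (x\<^sub>0, x\<^sub>1 + \<beta> *\<^sub>R grad f x\<^sub>0)"
    and z: "\<And>T. T \<ge> 0 \<Longrightarrow> \<exists>R M. M-lipschitz_on {0..T} z \<and> (\<forall>t\<in>{0..T}. norm (z t) \<le> R) \<and>
      (\<forall>\<epsilon>>0. \<exists>P S. approximant field R M T \<epsilon> z P S)"
    using euler_limit_exists by meson
  define x y where "x t = fst (z t)" and "y t = snd (z t)" for t
  \<comment> \<open>By the first equation of the system, \<open>w\<close> is the velocity of \<open>x\<close>.\<close>
  define w where "w t = y t - \<beta> *\<^sub>R grad f (x t)" for t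
  define X where "X = restrict x {0..}"
  have x_der: "(x has_vector_derivative w t) (at t within {0..})" if "0 \<le> t" for t
  proof -
    obtain R M where "M-lipschitz_on {0..t + 1} z" "\<forall>t\<in>{0..t + 1}. norm (z t) \<le> R"
      "\<forall>\<epsilon>>0. \<exists>P S. approximant field R M (t + 1) \<epsilon> z P S" using z[of "t + 1"] \<open>0 \<le> t\<close> by auto
    from limit_position_derivative[OF this, of t] show ?thesis
      using that by (simp add: x_def[abs_def] w_def y_def field_def)
  qed
  have evolution: "\<exists>M C. damped_evolution \<phi> (\<lambda>t. grad f (x t)) y T M C" if "0 \<le> T" for T
    using z[OF that] limit_damped_evolution unfolding x_def y_def by blast
  have w_lip: "\<exists>K. K-lipschitz_on {0..T} w" if T: "0 \<le> T" for T
  proof -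
    obtain M C where "damped_evolution \<phi> (\<lambda>t. grad f (x t)) y T M C" using evolution[OF T] by blast
    then interpret damped_evolution \<phi> "\<lambda>t. grad f (x t)" y T M C .
    have "(M + \<beta> * C)-lipschitz_on {0..T} w"
      unfolding w_def using \<beta> by (intro lipschitz_intros y_lip g_lip)
    then show ?thesis by blast
  qed
  have "\<exists>N. countable N \<and> (\<forall>t\<in>{0<..<real n} - N. \<exists>d. (y has_vector_derivative d) (at t) \<and>
     - d - grad f (x t) \<in> subdifferential \<phi> (y t))" for n
  proof -
    obtain M C where "damped_evolution \<phi> (\<lambda>t. grad f (x t)) y (real n) M C"
      using evolution[of "real n"] by auto
    then show ?thesis by (rule damped_evolution.strong_solution_off_countable)
  qed
  then obtain N where N: "\<And>n. countable (N n)" "\<And>n t. t \<in> {0<..<real n} - N n \<Longrightarrow>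
      \<exists>d. (y has_vector_derivative d) (at t) \<and> - d - grad f (x t) \<in> subdifferential \<phi> (y t)"
    by metis
  define N0 where "N0 = (\<Union>n. N n)"
  have N0: "countable N0" using N(1) by (simp add: N0_def)
  have y_der: "\<exists>d. (y has_vector_derivative d) (at t) \<and> - d - grad f (x t) \<in> subdifferential \<phi> (y t)"
    if "0 < t" "t \<notin> N0" for t
  proof -
    obtain n where "t < real n" using reals_Archimedean2 by blast
    then show ?thesis using N(2)[of t n] that by (auto simp: N0_def)
  qed
  have X_der: "(X has_vector_derivative w t) (at t within {0..})" if "0 \<le> t" for t
    by (rule has_vector_derivative_transform[OF _ _ x_der[OF that]]) (use that in \<open>auto simp: X_def\<close>)
  have vel: "velocity X t = w t" if "0 \<le> t" for t using velocity_eqI[OF that X_der[OF that]] .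
  have vel_der: "(velocity X has_vector_derivative d - \<beta> *\<^sub>R hess f (X t) (velocity X t)) (at t within {0..})"
    if t: "0 < t" and d: "(y has_vector_derivative d) (at t)" for t d
  proof -
    have "((grad f \<circ> x) has_vector_derivative hess f (x t) (w t)) (at t within {0..})"
    proof (rule vector_derivative_diff_chain_within[OF x_der])
      show "(grad f has_derivative hess f (x t)) (at (x t) within x ` {0..})"
        by (rule has_derivative_at_withinI[OF grad_has_derivative])
    qed (use t in simp)
    then have "(w has_vector_derivative d - \<beta> *\<^sub>R hess f (x t) (w t)) (at t within {0..})"
      unfolding w_def[abs_def] using has_vector_derivative_at_within[OF d]
      by (auto intro!: derivative_eq_intros simp: o_def)
    then have "(velocity X has_vector_derivative d - \<beta> *\<^sub>R hess f (x t) (w t)) (at t within {0..})"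
      by (rule has_vector_derivative_transform[rotated 2]) (use t vel in auto)
    then show ?thesis using t vel by (simp add: X_def)
  qed
  have acc_der: "(velocity X has_vector_derivative acceleration X t) (at t within {0..})"
    if t: "0 < t" "t \<notin> N0" for t
  proof -
    obtain d where "(y has_vector_derivative d) (at t)" using y_der[OF t] by blast
    from vel_der[OF t(1) this] show ?thesis
      using acceleration_eqI[OF less_imp_le[OF t(1)]] by metis
  qed
  have sol: "0 \<in> {acceleration X t + p + \<beta> *\<^sub>R hess f (X t) (velocity X t) + grad f (X t) | p.
               p \<in> subdifferential \<phi> (velocity X t + \<beta> *\<^sub>R grad f (X t))}" if t: "0 < t" "t \<notin> N0" for t
  proof -
    obtain d where d: "(y has_vector_derivative d) (at t)" "- d - grad f (x t) \<in> subdifferential \<phi> (y t)"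
      using y_der[OF t] by blast
    have "acceleration X t = d - \<beta> *\<^sub>R hess f (X t) (velocity X t)"
      using acceleration_eqI[OF _ vel_der[OF t(1) d(1)]] t by simp
    then have "acceleration X t + (- d - grad f (x t)) + \<beta> *\<^sub>R hess f (X t) (velocity X t) + grad f (X t) = 0"
      using t by (simp add: X_def)
    moreover have "velocity X t + \<beta> *\<^sub>R grad f (X t) = y t"
      using t vel by (simp add: w_def X_def)
    ultimately show ?thesis using d(2) by (metis (mono_tags, lifting) mem_Collect_eq)
  qed
  have vel_lip: "\<exists>K. K-lipschitz_on {0..T} (velocity X)" if T: "0 \<le> T" for T
  proof -
    obtain K where K: "K-lipschitz_on {0..T} w" using w_lip[OF T] by blast
    have "K-lipschitz_on {0..T} (velocity X)"
      by (rule lipschitz_on_transform[OF K]) (use vel in auto)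
    then show ?thesis by blast
  qed
  have "strong_global_solution \<beta> f \<phi> X"
    unfolding strong_global_solution_def
  proof (intro conjI allI impI)
    show "X differentiable (at t within {0..})" if "0 \<le> t" for t
      using X_der[OF that] by (rule differentiableI_vector)
    show "continuous_on {0..} (velocity X)"
    proof -
      have "continuous (at t within {0..}) (velocity X)" if t: "0 \<le> t" for t
      proof -
        obtain K where "K-lipschitz_on {0..t + 1} (velocity X)" using vel_lip[of "t + 1"] t by auto
        then have "continuous (at t within {0..t + 1}) (velocity X)"
          using lipschitz_on_continuous_on t by (fastforce simp: continuous_on_eq_continuous_within)
        moreover have "at t within {0..t + 1} = at t within {0..}"
          by (rule at_within_nhd[of t "{t - 1<..<t + 1}"]) auto
        ultimately show ?thesis by simp
      qed
      then show ?thesis by (simp add: continuous_on_eq_continuous_within)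
    qed
    fix T :: real assume T: "0 < T"
    obtain K where K: "K-lipschitz_on {0..T + 1} (velocity X)" using vel_lip[of "T + 1"] T by auto
    then show "\<exists>L. L-lipschitz_on {0<..<T} (velocity X)"
      by (intro exI[of _ K] lipschitz_on_subset[OF K]) auto
    show "AE t in lebesgue_on {0<..<T}. velocity X differentiable (at t within {0..})"
      by (rule AE_lebesgue_on_if_countable[OF _ N0]) (auto intro: differentiableI_vector[OF acc_der])
    show "acceleration X \<in> Linfty (lebesgue_on {0<..<T})"
      by (intro Linfty_derivative[OF T K] AE_lebesgue_on_if_countable[OF _ N0]) (auto intro: acc_der)
  next
    show "AE t in lebesgue_on {0<..}.
        0 \<in> {acceleration X t + p + \<beta> *\<^sub>R hess f (X t) (velocity X t) + grad f (X t) | p.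
               p \<in> subdifferential \<phi> (velocity X t + \<beta> *\<^sub>R grad f (X t))}"
      by (rule AE_lebesgue_on_if_countable[OF _ N0]) (use sol in auto)
  qed
  moreover have "X 0 = x\<^sub>0" "velocity X 0 = x\<^sub>1"
    using z0 vel[of 0] by (auto simp: X_def x_def w_def y_def)
  moreover have "X \<in> {0..} \<rightarrow>\<^sub>E UNIV" by (simp add: X_def)
  ultimately show ?thesis by blast
qed

text \<open>
  The passage from the second-order inclusion to the first-order system. The Hessian term disappears
  by the chain rule, which makes \<open>y\<close> differentiable wherever the velocity is.
\<close>

lemma solution_first_order:
  assumes sol: "strong_global_solution \<beta> f \<phi> x" and T: "0 < T"
  defines "y \<equiv> \<lambda>t. velocity x t + \<beta> *\<^sub>R grad f (x t)"
  shows "\<And>t. 0 \<le> t \<Longrightarrow> (x has_vector_derivative velocity x t) (at t within {0..})"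
    and "\<exists>K. K-lipschitz_on {0..T} (\<lambda>t. (x t, y t))"
    and "\<exists>N. negligible N \<and> (\<forall>t\<in>{0<..<T} - N. \<exists>d. (y has_vector_derivative d) (at t within {0..}) \<and>
      - d - grad f (x t) \<in> subdifferential \<phi> (y t))"
proof -
  note sol_unfolded = sol[unfolded strong_global_solution_def]
  note differentiable = sol_unfolded[THEN conjunct1, rule_format]
  note velocity_cont = sol_unfolded[THEN conjunct2, THEN conjunct1]
  note local_regularity = sol_unfolded[THEN conjunct2, THEN conjunct2, THEN conjunct1, rule_format, OF T]
  note inclusion = sol_unfolded[THEN conjunct2, THEN conjunct2, THEN conjunct2]
  show x_der: "(x has_vector_derivative velocity x t) (at t within {0..})" if "0 \<le> t" for t
    using differentiable[OF that] unfolding velocity_def vector_derivative_works .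
  obtain L where L: "L-lipschitz_on {0<..<T} (velocity x)"
    using local_regularity[THEN conjunct1] by blast
  have "continuous_on {0..T} (velocity x)"
    by (rule continuous_on_subset[OF velocity_cont]) simp
  then have v_lip: "L-lipschitz_on {0..T} (velocity x)"
    using lipschitz_on_closure[OF L] T by simp
  obtain V where V: "0 \<le> V" "\<And>t. t \<in> {0..T} \<Longrightarrow> norm (velocity x t) \<le> V"
    using lipschitz_on_interval_bounded[OF v_lip] by blast
  have x_lip: "V-lipschitz_on {0..T} x"
  proof (rule bounded_derivative_imp_lipschitz)
    fix t assume t: "t \<in> {0..T}"
    show "(x has_derivative (\<lambda>s. s *\<^sub>R velocity x t)) (at t within {0..T})"
      using has_vector_derivative_within_subset[OF x_der, of t "{0..T}"] t
      by (auto simp: has_vector_derivative_def)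
    show "onorm (\<lambda>s. s *\<^sub>R velocity x t) \<le> V"
      using V(2)[OF t] by (intro onorm_le) (simp add: mult.commute[of V] mult_left_mono)
  qed (use V in auto)
  have "bounded (x ` {0..T})"
    by (intro compact_imp_bounded compact_continuous_image lipschitz_on_continuous_on[OF x_lip]) simp
  then obtain G where G: "G-lipschitz_on (x ` {0..T}) (grad f)" using grad_lipschitz by blast
  have "(L + \<beta> * (G * V))-lipschitz_on {0..T} y"
    unfolding y_def using \<beta> by (intro lipschitz_intros v_lip lipschitz_on_compose2[OF x_lip G])
  then show "\<exists>K. K-lipschitz_on {0..T} (\<lambda>t. (x t, y t))" using lipschitz_on_Pair[OF x_lip] by blast
  obtain N1 where N1: "negligible N1" "\<And>t. t \<in> {0<..<T} - N1 \<Longrightarrow> velocity x differentiable (at t within {0..})"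
    using local_regularity[THEN conjunct2, THEN conjunct1] by (auto simp: AE_lebesgue_on_iff_negligible)
  obtain N2 where N2: "negligible N2" "\<And>t. t \<in> {0<..} - N2 \<Longrightarrow>
      \<exists>p. 0 = acceleration x t + p + \<beta> *\<^sub>R hess f (x t) (velocity x t) + grad f (x t) \<and>
        p \<in> subdifferential \<phi> (velocity x t + \<beta> *\<^sub>R grad f (x t))"
    using inclusion by (auto simp: AE_lebesgue_on_iff_negligible)
  have "\<exists>d. (y has_vector_derivative d) (at t within {0..}) \<and> - d - grad f (x t) \<in> subdifferential \<phi> (y t)"
    if t: "t \<in> {0<..<T} - (N1 \<union> N2)" for t
  proof -
    have v_der: "(velocity x has_vector_derivative acceleration x t) (at t within {0..})"
      using N1(2)[of t] t unfolding acceleration_def vector_derivative_works by blast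
    have "((grad f \<circ> x) has_vector_derivative hess f (x t) (velocity x t)) (at t within {0..})"
    proof (rule vector_derivative_diff_chain_within[OF x_der])
      show "(grad f has_derivative hess f (x t)) (at (x t) within x ` {0..})"
        by (rule has_derivative_at_withinI[OF grad_has_derivative])
    qed (use t in simp)
    then have "(y has_vector_derivative acceleration x t + \<beta> *\<^sub>R hess f (x t) (velocity x t)) (at t within {0..})"
      unfolding y_def using v_der by (auto intro!: derivative_eq_intros simp: o_def)
    moreover obtain p where p: "0 = acceleration x t + p + \<beta> *\<^sub>R hess f (x t) (velocity x t) + grad f (x t)"
        "p \<in> subdifferential \<phi> (y t)"
      using N2(2)[of t] t unfolding y_def by auto
    moreover have "- (acceleration x t + \<beta> *\<^sub>R hess f (x t) (velocity x t)) - grad f (x t) =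
        p - (acceleration x t + p + \<beta> *\<^sub>R hess f (x t) (velocity x t) + grad f (x t))"
      by (simp add: algebra_simps)
    then have "- (acceleration x t + \<beta> *\<^sub>R hess f (x t) (velocity x t)) - grad f (x t) = p"
      unfolding p(1)[symmetric] by simp
    ultimately show ?thesis by metis
  qed
  then show "\<exists>N. negligible N \<and> (\<forall>t\<in>{0<..<T} - N. \<exists>d. (y has_vector_derivative d) (at t within {0..}) \<and>
      - d - grad f (x t) \<in> subdifferential \<phi> (y t))"
    using N1(1) N2(1) by (intro exI[of _ "N1 \<union> N2"]) (auto simp: negligible_Un)
qed

lemma solution_unique:
  assumes sol: "strong_global_solution \<beta> f \<phi> x" "strong_global_solution \<beta> f \<phi> x'"
    and init: "x 0 = x' 0" "velocity x 0 = velocity x' 0" and T: "0 < T"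
  shows "x T = x' T"
proof -
  define y where "y t = velocity x t + \<beta> *\<^sub>R grad f (x t)" for t
  define y' where "y' t = velocity x' t + \<beta> *\<^sub>R grad f (x' t)" for t
  obtain K K' where K: "K-lipschitz_on {0..T} (\<lambda>t. (x t, y t))" "K'-lipschitz_on {0..T} (\<lambda>t. (x' t, y' t))"
    using solution_first_order(2)[OF sol(1) T] solution_first_order(2)[OF sol(2) T]
    unfolding y_def y'_def by blast
  obtain N N' where N: "negligible N" "\<And>t. t \<in> {0<..<T} - N \<Longrightarrow>
      \<exists>d. (y has_vector_derivative d) (at t within {0..}) \<and> - d - grad f (x t) \<in> subdifferential \<phi> (y t)"
    and N': "negligible N'" "\<And>t. t \<in> {0<..<T} - N' \<Longrightarrow>
      \<exists>d. (y' has_vector_derivative d) (at t within {0..}) \<and> - d - grad f (x' t) \<in> subdifferential \<phi> (y' t)"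
    using solution_first_order(3)[OF sol(1) T] solution_first_order(3)[OF sol(2) T]
    unfolding y_def[abs_def] y'_def[abs_def] by meson
  obtain B B' where B: "\<And>t. t \<in> {0..T} \<Longrightarrow> norm (x t, y t) \<le> B" "\<And>t. t \<in> {0..T} \<Longrightarrow> norm (x' t, y' t) \<le> B'"
    using lipschitz_on_interval_bounded[OF K(1)] lipschitz_on_interval_bounded[OF K(2)] by metis
  define R where "R = max B B'"
  have bounded: "norm (x t) \<le> R" "norm (x' t) \<le> R" if "t \<in> {0..T}" for t
    using B(1)[OF that] B(2)[OF that] norm_fst_le[of "x t" "y t"] norm_fst_le[of "x' t" "y' t"]
    by (auto simp: R_def)
  obtain L where L: "0 \<le> L" "L-lipschitz_on (cball 0 R) (grad f)" using grad_lipschitz_ball by blast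
  define Z where "Z t = (x t, y t) - (x' t, y' t)" for t
  have "(norm (Z T))\<^sup>2 \<le> exp (2 * (1 + L) * (T - 0)) * ((norm (Z 0))\<^sup>2 + 2 * 0 * (T - 0))"
  proof (rule norm_gronwall[where N = "N \<union> N'"])
    show "(K + K')-lipschitz_on {0..T} Z" unfolding Z_def by (intro lipschitz_on_diff K)
    show "negligible (N \<union> N')" using N(1) N'(1) by simp
    fix t assume t: "0 < t" "t < T" "t \<notin> N \<union> N'"
    obtain d where d: "(y has_vector_derivative d) (at t within {0..})" "- d - grad f (x t) \<in> subdifferential \<phi> (y t)"
      using N(2)[of t] t by auto
    obtain d' where d': "(y' has_vector_derivative d') (at t within {0..})" "- d' - grad f (x' t) \<in> subdifferential \<phi> (y' t)"
      using N'(2)[of t] t by auto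
    have xd: "(x has_vector_derivative y t - \<beta> *\<^sub>R grad f (x t)) (at t within {0..})"
      "(x' has_vector_derivative y' t - \<beta> *\<^sub>R grad f (x' t)) (at t within {0..})"
      using solution_first_order(1)[OF sol(1) T, of t] solution_first_order(1)[OF sol(2) T, of t] t
      by (simp_all add: y_def y'_def)
    let ?D = "(y t - \<beta> *\<^sub>R grad f (x t), d) - (y' t - \<beta> *\<^sub>R grad f (x' t), d')"
    have "(Z has_vector_derivative ?D) (at t within {0..})"
      unfolding Z_def by (intro has_vector_derivative_diff has_vector_derivative_Pair xd d(1) d'(1))
    then have "(Z has_vector_derivative ?D) (at_right t)"
      by (rule has_vector_derivative_within_subset) (use t in auto)
    moreover have "?D \<bullet> Z t \<le> (1 + L) * (norm (Z t))\<^sup>2 + 0"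
      using monotone_coupling[OF L(2) bounded(1)[of t] bounded(2)[of t] d(2) d'(2)] t
      by (simp add: Z_def)
    ultimately show "\<exists>d. (Z has_vector_derivative d) (at_right t) \<and> d \<bullet> Z t \<le> (1 + L) * (norm (Z t))\<^sup>2 + 0"
      by blast
  qed (use T L in auto)
  also have "Z 0 = 0" using init by (simp add: Z_def y_def y'_def)
  finally have "Z T = 0" by simp
  then show ?thesis by (simp add: Z_def zero_prod_def)
qed

end

theorem theorem10p2:
  fixes f \<phi> :: "'a::{real_inner, banach} \<Rightarrow> real" and \<beta> :: real and x\<^sub>0 x\<^sub>1 :: 'a
  assumes "\<beta> \<ge> 0"
    and "convex_on UNIV f"
    and "twice_continuously_differentiable f"
    and "bdd_below (range f)"
    and "\<And>B. bounded B \<Longrightarrow> \<exists>L. L-lipschitz_on B (grad f)"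
    and "damping_potential \<phi>"
  shows "\<exists>!x. x \<in> {0..} \<rightarrow>\<^sub>E UNIV \<and> strong_global_solution \<beta> f \<phi> x \<and>
              x 0 = x\<^sub>0 \<and> velocity x 0 = x\<^sub>1"
proof -
  interpret inertial_system f \<phi> \<beta> by unfold_locales (fact assms)+
  show ?thesis
  proof (rule ex_ex1I[OF solution_exists])
    fix x x' :: "real \<Rightarrow> 'a"
    assume x: "x \<in> {0..} \<rightarrow>\<^sub>E UNIV \<and> strong_global_solution \<beta> f \<phi> x \<and> x 0 = x\<^sub>0 \<and> velocity x 0 = x\<^sub>1"
      and x': "x' \<in> {0..} \<rightarrow>\<^sub>E UNIV \<and> strong_global_solution \<beta> f \<phi> x' \<and> x' 0 = x\<^sub>0 \<and> velocity x' 0 = x\<^sub>1"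
    have "x t = x' t" if "0 \<le> t" for t
      using that solution_unique[of x x' t] x x' by (cases "t = 0") auto
    then show "x = x'" using x x' by (intro PiE_ext[of x "{0..}"]) auto
  qed
qed

end
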